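(* Let $k\ge1$. In $\bigotimes^k_{BP\langle k\rangle_*}BP\langle k\rangle_*(B\mathbb{Z}/2)$, for $0\le j\le k-1$ and every $z_I$, $$v_j\cdot z_I\equiv v_k\sum_E z_{I-E}$$ modulo higher filtration (i.e. modulo $F_2$), where $E=(e_1,\ldots,e_k)$ ranges over all $k$-tuples of nonnegative integers such that all nonzero $e_i$ are $2$-powers and $\sum_i e_i=2^k-2^j$.
   Context: $BP\langle k\rangle_*(-)$ is Johnson-Wilson homology at the prime $2$, with coefficients $BP\langle k\rangle_*=\mathbb{Z}_{(2)}[v_1,\ldots,v_k]$, $|v_j|=2(2^j-1)$, and $v_0=2$. $BP\langle k\rangle_*(B\mathbb{Z}/2)$ is generated by classes $z_i$ of degree $2i-1$, $i\ge1$ (images of the standard generators $z_i\in BP_{2i-1}(B\mathbb{Z}/2)$, which have only relations $\sum_{j\ge 0} a_jz_{i-j}=0$, where $a_j\in BP_{2j}$ are the coefficients of the $[2]$-series and $z_n=0$ for $n\le 0$; here $BP_*=\mathbb{Z}_{(2)}[v_1,v_2,\ldots]$, and modulo $(v_0,v_1,\ldots)^2$, $a_{2^i-1}\equiv v_i$ and $a_j\equiv0$ if $j+1$ is not a $2$-power). For $I=(i_1,\ldots,i_k)$ with all $i_j\ge1$, $z_I=z_{i_1}\otimes\cdots\otimes z_{i_k}$; $I-E=(i_1-e_1,\ldots,i_k-e_k)$, and $z_J=0$ if any entry of $J$ is $\le0$. The filtration is $F_s=(v_0,v_1,\ldots,v_k)^s\cdot\bigotimes^k_{BP\langle k\rangle_*}BP\langle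 k\rangle_*(B\mathbb{Z}/2)$; the classes $v_k^sz_I$ form an $\mathbb{F}_2$-basis of $F_s/F_{s+1}$. *)

theory Defs
  imports
    "HOL-Computational_Algebra.Formal_Power_Series"
    "HOL-Library.Poly_Mapping"
    "HOL-Algebra.Module"
    "HOL-Algebra.Ideal_Product"
begin

section \<open>The coefficient rings\<close>

text \<open>
  An element of \<open>qv\<close> is a polynomial over the rationals in variables indexed by the naturals; the
  variable with index \<open>i \<ge> 1\<close> is $v_i$.  The variable with index 0 is never used, because $v_0$
  denotes the constant 2.  The rings $BP_* = \mathbb{Z}_{(2)}[v_1, v_2, \ldots]$ and
  $BP\langle k\rangle_* = \mathbb{Z}_{(2)}[v_1, \ldots, v_k]$ are subrings.
\<close>

type_synonym qv = "(nat \<Rightarrow>\<^sub>0 nat) \<Rightarrow>\<^sub>0 rat"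

definition vgen :: "nat \<Rightarrow> qv" where
  "vgen i = (if i = 0 then 2 else Poly_Mapping.single (Poly_Mapping.single i 1) 1)"

definition Z2loc :: "rat set" where
  "Z2loc = {q. odd (snd (quotient_of q))}"

definition Z2_poly_ring :: "nat set \<Rightarrow> qv ring" where
  "Z2_poly_ring S =
    \<lparr>carrier = {p. (\<forall>m. Poly_Mapping.lookup p m \<in> Z2loc) \<and>
                   (\<forall>m\<in>Poly_Mapping.keys p. Poly_Mapping.keys m \<subseteq> S)},
     mult = (*), one = 1, zero = 0, add = (+)\<rparr>"

definition BP :: "qv ring" where
  "BP = Z2_poly_ring {1..}"

definition BPk :: "nat \<Rightarrow> qv ring" where
  "BPk k = Z2_poly_ring {1..k}"

text \<open>The ring homomorphism $BP_* \to BP\langle k\rangle_*$ with $v_i \mapsto 0$ for $i > k$.\<close>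

definition BP_to_BPk :: "nat \<Rightarrow> qv \<Rightarrow> qv" where
  "BP_to_BPk k p =
    (\<Sum>m\<in>{m\<in>Poly_Mapping.keys p. Poly_Mapping.keys m \<subseteq> {1..k}}.
       Poly_Mapping.single m (Poly_Mapping.lookup p m))"

definition homogeneous :: "nat \<Rightarrow> qv \<Rightarrow> bool" where
  "homogeneous d p \<longleftrightarrow>
    (\<forall>m\<in>Poly_Mapping.keys p.
       (\<Sum>i\<in>Poly_Mapping.keys m. Poly_Mapping.lookup m i * (2 * (2 ^ i - 1))) = d)"

primrec ideal_power :: "('a, 'b) ring_scheme \<Rightarrow> 'a set \<Rightarrow> nat \<Rightarrow> 'a set" where
  "ideal_power R I 0 = carrier R"
| "ideal_power R I (Suc n) = ideal_prod R I (ideal_power R I n)"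


section \<open>The formal group law of BP and its 2-series\<close>

text \<open>
  The polynomial generators $v_i$ of $BP_*$ may be any of the usual ones
  (Hazewinkel, Araki, ...) for which $a_{2^i-1} \equiv v_i$ modulo $(v_0, v_1, \ldots)^2$.  To
  allow every such choice, \<open>h n\<close> stands for the $n$-th Hazewinkel generator, written as a
  polynomial in the chosen generators; \<open>h = vgen\<close> is the choice of the Hazewinkel generators.
  Since the coefficient $a_{2^n-1}$ is congruent to the $n$-th Hazewinkel generator modulo
  $(v_0, v_1, \ldots)^2$, the last condition is the normalisation above.
\<close>

definition hazewinkel_in_generators :: "(nat \<Rightarrow> qv) \<Rightarrow> bool" where
  "hazewinkel_in_generators h \<longleftrightarrow>
    (\<forall>n\<ge>1. h n \<in> carrier BP \<and> homogeneous (2 * (2 ^ n - 1)) (h n) \<and>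
            h n - vgen n \<in> ideal_power BP (genideal BP (range vgen)) 2)"

text \<open>
  Hazewinkel's recursion $2\ell_n = \sum_{i<n} \ell_i h_{n-i}^{2^i}$ for the logarithm
  $\log(x) = \sum_n \ell_n x^{2^n}$ of the formal group law.
\<close>

fun log_coeff :: "(nat \<Rightarrow> qv) \<Rightarrow> nat \<Rightarrow> qv" where
  "log_coeff h n =
    (if n = 0 then 1
     else Poly_Mapping.single 0 (1/2) * (\<Sum>i\<in>{..<n}. log_coeff h i * h (n - i) ^ 2 ^ i))"

declare log_coeff.simps [simp del]

definition log_series :: "(nat \<Rightarrow> qv) \<Rightarrow> qv fps" where
  "log_series h = Abs_fps (\<lambda>m. \<Sum>n\<in>{n. m = 2 ^ n}. log_coeff h n)"

text \<open>
  The 2-series is $[2](x) = x +_F x = \log^{-1}(\log x + \log x)$.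
\<close>

definition two_series :: "(nat \<Rightarrow> qv) \<Rightarrow> qv fps" where
  "two_series h =
    (THE s. fps_nth s 0 = 0 \<and> fps_compose (log_series h) s = log_series h + log_series h)"

definition two_coeff :: "(nat \<Rightarrow> qv) \<Rightarrow> nat \<Rightarrow> qv" where
  "two_coeff h j = fps_nth (two_series h) (j + 1)"


section \<open>Presented modules and tensor powers\<close>

text \<open>
  The fields \<open>mult\<close> and \<open>one\<close> of a module record play no role.
\<close>

definition free_module :: "('a, 'c) ring_scheme \<Rightarrow> 'x set \<Rightarrow> ('a, 'x \<Rightarrow> 'a) module" where
  "free_module R X =
    \<lparr>carrier = {f. (\<forall>x. f x \<in> carrier R) \<and> finite {x. f x \<noteq> \<zero>\<^bsub>R\<^esub>} \<and> {x. f x \<noteq> \<zero>\<^bsub>R\<^esub>} \<subseteq> X},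
     mult = undefined, one = undefined,
     zero = (\<lambda>x. \<zero>\<^bsub>R\<^esub>), add = (\<lambda>f g x. f x \<oplus>\<^bsub>R\<^esub> g x),
     smult = (\<lambda>r f x. r \<otimes>\<^bsub>R\<^esub> f x)\<rparr>"

definition basis_elt :: "('a, 'c) ring_scheme \<Rightarrow> 'x \<Rightarrow> 'x \<Rightarrow> 'a" where
  "basis_elt R x = (\<lambda>y. if y = x then \<one>\<^bsub>R\<^esub> else \<zero>\<^bsub>R\<^esub>)"

definition submodule_span ::
  "('a, 'c) ring_scheme \<Rightarrow> ('a, 'm, 'd) module_scheme \<Rightarrow> 'm set \<Rightarrow> 'm set" where
  "submodule_span R M S = \<Inter>{N. submodule N R M \<and> S \<subseteq> N}"

definition quotient_module ::
  "('a, 'm, 'd) module_scheme \<Rightarrow> 'm set \<Rightarrow> ('a, 'm set) module" where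
  "quotient_module M N =
    \<lparr>carrier = a_rcosets\<^bsub>M\<^esub> N, mult = undefined, one = undefined,
     zero = N, add = set_add M,
     smult = (\<lambda>r A. \<Union>a\<in>A. N +>\<^bsub>M\<^esub> (r \<odot>\<^bsub>M\<^esub> a))\<rparr>"

text \<open>
  The \<open>k\<close>-fold tensor power of \<open>M\<close> over \<open>R\<close>: the free module on \<open>k\<close>-tuples of elements of \<open>M\<close>
  (extensional functions on \<open>{1..k}\<close>) modulo multilinearity.
\<close>

definition tensor_free ::
  "('a, 'c) ring_scheme \<Rightarrow> ('a, 'm, 'd) module_scheme \<Rightarrow> nat \<Rightarrow> ('a, (nat \<Rightarrow> 'm) \<Rightarrow> 'a) module" where
  "tensor_free R M k = free_module R (PiE {1..k} (\<lambda>_. carrier M))"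

definition tensor_relations ::
  "('a, 'c) ring_scheme \<Rightarrow> ('a, 'm, 'd) module_scheme \<Rightarrow> nat \<Rightarrow> ((nat \<Rightarrow> 'm) \<Rightarrow> 'a) set" where
  "tensor_relations R M k =
    {basis_elt R (t(i := x \<oplus>\<^bsub>M\<^esub> y)) \<ominus>\<^bsub>tensor_free R M k\<^esub>
       (basis_elt R (t(i := x)) \<oplus>\<^bsub>tensor_free R M k\<^esub> basis_elt R (t(i := y))) | t i x y.
       t \<in> PiE {1..k} (\<lambda>_. carrier M) \<and> i \<in> {1..k} \<and> x \<in> carrier M \<and> y \<in> carrier M} \<union>
    {basis_elt R (t(i := r \<odot>\<^bsub>M\<^esub> x)) \<ominus>\<^bsub>tensor_free R M k\<^esub>
       (r \<odot>\<^bsub>tensor_free R M k\<^esub> basis_elt R (t(i := x))) | t i x r.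
       t \<in> PiE {1..k} (\<lambda>_. carrier M) \<and> i \<in> {1..k} \<and> x \<in> carrier M \<and> r \<in> carrier R}"

definition tensor_kernel ::
  "('a, 'c) ring_scheme \<Rightarrow> ('a, 'm, 'd) module_scheme \<Rightarrow> nat \<Rightarrow> ((nat \<Rightarrow> 'm) \<Rightarrow> 'a) set" where
  "tensor_kernel R M k = submodule_span R (tensor_free R M k) (tensor_relations R M k)"

definition tensor_power ::
  "('a, 'c) ring_scheme \<Rightarrow> ('a, 'm, 'd) module_scheme \<Rightarrow> nat
    \<Rightarrow> ('a, ((nat \<Rightarrow> 'm) \<Rightarrow> 'a) set) module" where
  "tensor_power R M k = quotient_module (tensor_free R M k) (tensor_kernel R M k)"

definition pure_tensor ::
  "('a, 'c) ring_scheme \<Rightarrow> ('a, 'm, 'd) module_scheme \<Rightarrow> nat \<Rightarrow> (nat \<Rightarrow> 'm)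
    \<Rightarrow> ((nat \<Rightarrow> 'm) \<Rightarrow> 'a) set" where
  "pure_tensor R M k t =
    tensor_kernel R M k +>\<^bsub>tensor_free R M k\<^esub> basis_elt R (restrict t {1..k})"


section \<open>The homology of \<open>B\<int>/2\<close>\<close>

text \<open>
  $BP\langle k\rangle_*(B\mathbb{Z}/2)$ (reduced homology) is given by its presentation over
  $BP\langle k\rangle_*$: generators $z_i$, $i \ge 1$, and relations $\sum_j a_j z_{i-j} = 0$, $i \ge 1$,
  where only the terms with $i - j \ge 1$ are present.
\<close>

definition BZ2_free :: "nat \<Rightarrow> (qv, nat \<Rightarrow> qv) module" where
  "BZ2_free k = free_module (BPk k) {1..}"

definition BZ2_relation :: "(nat \<Rightarrow> qv) \<Rightarrow> nat \<Rightarrow> nat \<Rightarrow> nat \<Rightarrow> qv" where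
  "BZ2_relation h k i =
    finsum (BZ2_free k)
      (\<lambda>j. BP_to_BPk k (two_coeff h j) \<odot>\<^bsub>BZ2_free k\<^esub> basis_elt (BPk k) (i - j)) {..<i}"

definition BZ2_kernel :: "(nat \<Rightarrow> qv) \<Rightarrow> nat \<Rightarrow> (nat \<Rightarrow> qv) set" where
  "BZ2_kernel h k = submodule_span (BPk k) (BZ2_free k) (BZ2_relation h k ` {1..})"

definition BPk_BZ2 :: "(nat \<Rightarrow> qv) \<Rightarrow> nat \<Rightarrow> (qv, (nat \<Rightarrow> qv) set) module" where
  "BPk_BZ2 h k = quotient_module (BZ2_free k) (BZ2_kernel h k)"

definition zgen :: "(nat \<Rightarrow> qv) \<Rightarrow> nat \<Rightarrow> int \<Rightarrow> (nat \<Rightarrow> qv) set" where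
  "zgen h k n =
    (if n \<le> 0 then \<zero>\<^bsub>BPk_BZ2 h k\<^esub>
     else BZ2_kernel h k +>\<^bsub>BZ2_free k\<^esub> basis_elt (BPk k) (nat n))"

definition BZ2_tensor ::
  "(nat \<Rightarrow> qv) \<Rightarrow> nat \<Rightarrow> (qv, ((nat \<Rightarrow> (nat \<Rightarrow> qv) set) \<Rightarrow> qv) set) module" where
  "BZ2_tensor h k = tensor_power (BPk k) (BPk_BZ2 h k) k"

definition z_tensor ::
  "(nat \<Rightarrow> qv) \<Rightarrow> nat \<Rightarrow> (nat \<Rightarrow> int) \<Rightarrow> ((nat \<Rightarrow> (nat \<Rightarrow> qv) set) \<Rightarrow> qv) set" where
  "z_tensor h k I = pure_tensor (BPk k) (BPk_BZ2 h k) k (\<lambda>i. zgen h k (I i))"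

text \<open>$F_s = (v_0, \ldots, v_k)^s \cdot \bigotimes^k BP\langle k\rangle_*(B\mathbb{Z}/2)$.\<close>

definition filtration ::
  "(nat \<Rightarrow> qv) \<Rightarrow> nat \<Rightarrow> nat \<Rightarrow> ((nat \<Rightarrow> (nat \<Rightarrow> qv) set) \<Rightarrow> qv) set set" where
  "filtration h k s =
    submodule_span (BPk k) (BZ2_tensor h k)
      {r \<odot>\<^bsub>BZ2_tensor h k\<^esub> x | r x.
         r \<in> ideal_power (BPk k) (genideal (BPk k) (vgen ` {0..k})) s \<and> x \<in> carrier (BZ2_tensor h k)}"

definition exponent_tuples :: "nat \<Rightarrow> nat \<Rightarrow> (nat \<Rightarrow> nat) set" where
  "exponent_tuples k j =
    {E \<in> PiE {1..k} (\<lambda>_. UNIV).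
       (\<forall>i\<in>{1..k}. E i \<noteq> 0 \<longrightarrow> (\<exists>n. E i = 2 ^ n)) \<and> (\<Sum>i\<in>{1..k}. E i) = 2 ^ k - 2 ^ j}"

end

theory Submission
  imports Defs "HOL-Library.Function_Algebras"
begin

text \<open>
  Write $S_m$ for the operator that lowers the $m$-th index of $z_I$ by one. Modulo $F_2$ the relation
  of $BP\langle k\rangle_*(B\mathbb{Z}/2)$ in the $m$-th tensor factor says $\sum_{j\le k} v_j S_m^{2^j} = 0$,
  for each of the $k$ factors, because the coefficients of the 2-series are $v_i$ or $0$ modulo
  $(v_0, v_1, \ldots)^2$. These are $k$ linear equations for the $k + 1$ operators $v_0, \ldots, v_k$;
  solving them expresses $v_j$ as $v_k$ times the Dickson invariant of degree $2^k - 2^j$ in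
  $S_1, \ldots, S_k$, and modulo 2 that invariant is the sum of the monomials $S^E$ of the theorem.

  The solution has two halves. In \<open>dickson_relations\<close> the sums of monomials are shown to satisfy
  the equations: in $\sum_{j, E} S^E S_m^{2^j}$ the terms cancel in pairs, since the two powers of 2
  that make up the exponent of $S_m$ can be exchanged (\<open>exponent_swap\<close>). In
  \<open>shift_relations_unique\<close> the solution is shown to be unique: Cramer's rule multiplies a solution of
  the homogeneous system by the Moore determinant $\det(S_m^{2^j})$, and this determinant has a
  lexicographically extreme monomial, so that it can be cancelled by induction on the index, all indices
  being bounded below. Both halves only use additions in a group modulo a subgroup, and are applied to
  the free module on tuples modulo the preimage of $F_2$.

  The topological input is \<open>two_coeff_BPk\<close>: the coefficients of the 2-series are 2-locally integral
  and have the stated residues. Integrality is Hazewinkel's functional equation argument. Let $\sigma$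
  be the lift $v_i \mapsto v_i^2$ of the Frobenius and let $\log^{(i)}$ be the logarithm with $\sigma^i$ applied to its
  coefficients. Then $\log x = x + \sum_{i\ge 1} \frac{v_i}{2} \log^{(i)}(x^{2^i})$, and for
  $s = [2](x)$ the equation $\log s = 2 \log x$ becomes
  \[ s = 2x + \sum_{i\ge 1} v_i D_i, \qquad
  D_i = \tfrac12 \bigl(\log^{(i)}((\sigma^i s)(x^{2^i})) - \log^{(i)}(s^{2^i})\bigr). \]
  The two arguments are congruent modulo 2, which makes $D_i$ integral as far as $s$ is known to be
  integral; induction on the degree makes $s$ integral (\<open>two_series_integral\<close>). Setting all $v_i$ with $i \ge 1$ to $0$ turns $D_i$
  into $(1 - 2^{2^i - 1}) x^{2^i}$, so $D_i \equiv x^{2^i}$ modulo $(v_0, v_1, \ldots)$ and therefore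
  $s \equiv \sum_i v_i x^{2^i}$ modulo its square. This is done for the Hazewinkel generators; any
  other choice of generators is a specialisation of it (\<open>two_series_subst\<close>).
\<close>

section \<open>Substitution in polynomials and the 2-local subrings\<close>

abbreviation var :: "nat \<Rightarrow> qv" where
  "var i \<equiv> Poly_Mapping.single (Poly_Mapping.single i (Suc 0)) 1"

abbreviation qconst :: "rat \<Rightarrow> qv" where
  "qconst c \<equiv> Poly_Mapping.single 0 c"

lemma poly_eq_sum_monomials:
  assumes "finite A" "Poly_Mapping.keys p \<subseteq> A"
  shows "p = (\<Sum>m\<in>A. Poly_Mapping.single m (Poly_Mapping.lookup p m))"
proof (rule poly_mapping_eqI)
  fix m
  have "Poly_Mapping.lookup (\<Sum>m\<in>A. Poly_Mapping.single m (Poly_Mapping.lookup p m)) m =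
      (\<Sum>n\<in>A. if n = m then Poly_Mapping.lookup p n else 0)"
    by (simp add: lookup_sum lookup_single when_def)
  also have "\<dots> = (if m \<in> A then Poly_Mapping.lookup p m else 0)"
    using assms by simp
  also have "\<dots> = Poly_Mapping.lookup p m"
    using assms by (auto simp: in_keys_iff)
  finally show "Poly_Mapping.lookup p m =
      Poly_Mapping.lookup (\<Sum>m\<in>A. Poly_Mapping.single m (Poly_Mapping.lookup p m)) m" ..
qed

definition monomial_value :: "(nat \<Rightarrow> qv) \<Rightarrow> (nat \<Rightarrow>\<^sub>0 nat) \<Rightarrow> qv" where
  "monomial_value g m = (\<Prod>i\<in>Poly_Mapping.keys m. g i ^ Poly_Mapping.lookup m i)"

text \<open>
  The ring endomorphism of $\mathbb{Q}[v]$ that sends the variable $i$ to \<open>g i\<close>. The Frobenius lift, the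
  augmentation, the projection onto $BP\langle k\rangle_*$ and the change of generators are all of this form.
\<close>

definition substitute :: "(nat \<Rightarrow> qv) \<Rightarrow> qv \<Rightarrow> qv" where
  "substitute g p = (\<Sum>m\<in>Poly_Mapping.keys p. qconst (Poly_Mapping.lookup p m) * monomial_value g m)"

lemma monomial_value_superset:
  assumes "finite A" "Poly_Mapping.keys m \<subseteq> A"
  shows "monomial_value g m = (\<Prod>i\<in>A. g i ^ Poly_Mapping.lookup m i)"
  unfolding monomial_value_def using assms
  by (intro prod.mono_neutral_left) (auto simp: in_keys_iff)

lemma monomial_value_0 [simp]: "monomial_value g 0 = 1"
  by (simp add: monomial_value_def)

lemma monomial_value_add: "monomial_value g (m + n) = monomial_value g m * monomial_value g n"
proof -
  define A where "A = Poly_Mapping.keys m \<union> Poly_Mapping.keys n"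
  have "finite A" "Poly_Mapping.keys (m + n) \<subseteq> A" "Poly_Mapping.keys m \<subseteq> A" "Poly_Mapping.keys n \<subseteq> A"
    using Poly_Mapping.keys_add[of m n] by (auto simp: A_def)
  then show ?thesis
    by (simp add: monomial_value_superset[of A] lookup_add power_add prod.distrib)
qed

lemma monomial_value_single [simp]: "monomial_value g (Poly_Mapping.single i e) = g i ^ e"
  by (cases "e = 0") (auto simp: monomial_value_def)

lemma substitute_superset:
  assumes "finite A" "Poly_Mapping.keys p \<subseteq> A"
  shows "substitute g p = (\<Sum>m\<in>A. qconst (Poly_Mapping.lookup p m) * monomial_value g m)"
  unfolding substitute_def using assms
  by (intro sum.mono_neutral_left) (auto simp: in_keys_iff)

lemma substitute_add: "substitute g (p + q) = substitute g p + substitute g q"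
proof -
  define A where "A = Poly_Mapping.keys p \<union> Poly_Mapping.keys q"
  have "finite A" "Poly_Mapping.keys (p + q) \<subseteq> A" "Poly_Mapping.keys p \<subseteq> A" "Poly_Mapping.keys q \<subseteq> A"
    using Poly_Mapping.keys_add[of p q] by (auto simp: A_def)
  then show ?thesis
    by (simp add: substitute_superset[of A] lookup_add single_add distrib_right sum.distrib)
qed

lemma substitute_single: "substitute g (Poly_Mapping.single m c) = qconst c * monomial_value g m"
  by (cases "c = 0") (auto simp: substitute_def)

lemma substitute_0 [simp]: "substitute g 0 = 0"
  by (simp add: substitute_def)

lemma substitute_qconst [simp]: "substitute g (qconst c) = qconst c"
  by (simp add: substitute_single)

lemma substitute_1 [simp]: "substitute g 1 = 1"
  using substitute_qconst[of g 1] by simp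

lemma substitute_var [simp]: "substitute g (var i) = g i"
  by (simp add: substitute_single)

lemma substitute_sum: "substitute g (sum f A) = (\<Sum>a\<in>A. substitute g (f a))"
  by (induction A rule: infinite_finite_induct) (auto simp: substitute_add)

lemma substitute_uminus: "substitute g (- p) = - substitute g p"
  using substitute_add[of g p "- p"] by (simp add: add_eq_0_iff)

lemma substitute_diff: "substitute g (p - q) = substitute g p - substitute g q"
  using substitute_add[of g p "- q"] by (simp add: substitute_uminus)

lemma substitute_mult_single:
  "substitute g (Poly_Mapping.single m c * Poly_Mapping.single n d) =
     substitute g (Poly_Mapping.single m c) * substitute g (Poly_Mapping.single n d)"
proof -
  have "qconst (c * d) = qconst c * qconst d" by (simp add: mult_single)
  then show ?thesis
    by (simp add: mult_single substitute_single monomial_value_add mult_ac)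
qed

lemma substitute_mult: "substitute g (p * q) = substitute g p * substitute g q"
proof -
  let ?s = "\<lambda>p m. Poly_Mapping.single m (Poly_Mapping.lookup p m) :: qv"
  have p: "p = (\<Sum>m\<in>Poly_Mapping.keys p. ?s p m)" and q: "q = (\<Sum>m\<in>Poly_Mapping.keys q. ?s q m)"
    by (intro poly_eq_sum_monomials; simp)+
  have "substitute g (p * q) =
      (\<Sum>m\<in>Poly_Mapping.keys p. \<Sum>n\<in>Poly_Mapping.keys q. substitute g (?s p m * ?s q n))"
    by (subst p, subst q) (simp add: sum_product substitute_sum)
  also have "\<dots> = (\<Sum>m\<in>Poly_Mapping.keys p. substitute g (?s p m)) * (\<Sum>n\<in>Poly_Mapping.keys q. substitute g (?s q n))"
    by (simp add: substitute_mult_single sum_product)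
  also have "\<dots> = substitute g p * substitute g q"
    by (subst (2) p, subst (2) q) (simp add: substitute_sum)
  finally show ?thesis .
qed

lemma substitute_power: "substitute g (p ^ n) = substitute g p ^ n"
  by (induction n) (auto simp: substitute_mult)

lemma monomial_value_var: "monomial_value var m = Poly_Mapping.single m 1"
proof -
  have vp: "var i ^ e = Poly_Mapping.single (Poly_Mapping.single i e) 1" for i e
    by (induction e) (auto simp: mult_single single_add[symmetric])
  have sp: "(\<Prod>i\<in>A. Poly_Mapping.single (f i) (1::rat)) = Poly_Mapping.single (\<Sum>i\<in>A. f i) 1"
    if "finite A" for A :: "nat set" and f :: "nat \<Rightarrow> nat \<Rightarrow>\<^sub>0 nat"
    using that by (induction A) (auto simp: mult_single)
  have "m = (\<Sum>i\<in>Poly_Mapping.keys m. Poly_Mapping.single i (Poly_Mapping.lookup m i))"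
  proof (rule poly_mapping_eqI)
    fix j
    show "Poly_Mapping.lookup m j =
        Poly_Mapping.lookup (\<Sum>i\<in>Poly_Mapping.keys m. Poly_Mapping.single i (Poly_Mapping.lookup m i)) j"
      by (auto simp: lookup_sum lookup_single when_def in_keys_iff)
  qed
  then show ?thesis
    unfolding monomial_value_def vp by (subst sp) simp_all
qed

lemma substitute_var_id: "substitute var p = p"
proof -
  have "substitute var p = (\<Sum>m\<in>Poly_Mapping.keys p. Poly_Mapping.single m (Poly_Mapping.lookup p m))"
    unfolding substitute_def monomial_value_var by (simp add: mult_single)
  also have "\<dots> = p" by (rule poly_eq_sum_monomials[symmetric]) auto
  finally show ?thesis .
qed

lemma BP_to_BPk_eq_subst: "BP_to_BPk k p = substitute (\<lambda>i. if i \<in> {1..k} then var i else 0) p"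
proof -
  let ?g = "\<lambda>i. if i \<in> {1..k} then var i else 0"
  have mono: "monomial_value ?g m = (if Poly_Mapping.keys m \<subseteq> {1..k} then Poly_Mapping.single m 1 else 0)" for m
  proof (cases "Poly_Mapping.keys m \<subseteq> {1..k}")
    case True
    then have "monomial_value ?g m = monomial_value var m"
      unfolding monomial_value_def by (intro prod.cong) auto
    then show ?thesis using True monomial_value_var by simp
  next
    case False
    then obtain i where i: "i \<in> Poly_Mapping.keys m" "i \<notin> {1..k}" by blast
    then have "?g i ^ Poly_Mapping.lookup m i = 0" by (auto simp: in_keys_iff)
    then have "monomial_value ?g m = 0"
      unfolding monomial_value_def by (intro prod_zero bexI[OF _ i(1)]) simp_all
    then show ?thesis using False by simp
  qed
  have "substitute ?g p = (\<Sum>m\<in>Poly_Mapping.keys p.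
      if Poly_Mapping.keys m \<subseteq> {1..k} then Poly_Mapping.single m (Poly_Mapping.lookup p m) else 0)"
    unfolding substitute_def mono by (intro sum.cong) (auto simp: mult_single)
  then show ?thesis
    by (simp add: BP_to_BPk_def sum.If_cases Int_def Collect_conj_eq[symmetric])
qed

lemma Z2loc_iff: "q \<in> Z2loc \<longleftrightarrow> (\<exists>a b. odd b \<and> q = of_int a / of_int b)"
proof
  assume "q \<in> Z2loc"
  then show "\<exists>a b. odd b \<and> q = of_int a / of_int b"
    using quotient_of_div[of q] by (cases "quotient_of q") (auto simp: Z2loc_def)
next
  assume "\<exists>a b. odd b \<and> q = of_int a / of_int b"
  then obtain a b where ab: "odd b" "q = of_int a / of_int b" by blast
  obtain p r where pr: "quotient_of q = (p, r)" by fastforce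
  have r: "r > 0" "coprime p r" "q = of_int p / of_int r"
    using quotient_of_denom_pos[OF pr] quotient_of_coprime[OF pr] quotient_of_div[OF pr] by auto
  have "b \<noteq> 0" using ab by auto
  then have "of_int (p * b) = (of_int (a * r) :: rat)"
    using ab r by (simp add: field_simps)
  then have "p * b = a * r" by (simp only: of_int_eq_iff)
  have "odd r"
  proof
    assume "even r"
    then have "even (p * b)" using \<open>p * b = a * r\<close> by simp
    then have "even p" using ab by simp
    then show False using r(2) \<open>even r\<close> by (meson coprime_common_divisor odd_one)
  qed
  then show "q \<in> Z2loc" using pr by (simp add: Z2loc_def)
qed

lemma Z2loc_of_int [simp]: "of_int a \<in> Z2loc"
  unfolding Z2loc_iff by (rule exI[of _ a], rule exI[of _ 1]) simp

lemma Z2loc_0 [simp]: "0 \<in> Z2loc" and Z2loc_1 [simp]: "1 \<in> Z2loc" and Z2loc_numeral [simp]: "numeral n \<in> Z2loc"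
  using Z2loc_of_int[of 0] Z2loc_of_int[of 1] Z2loc_of_int[of "numeral n"] by auto

lemma Z2loc_add [intro]: "p \<in> Z2loc \<Longrightarrow> q \<in> Z2loc \<Longrightarrow> p + q \<in> Z2loc"
proof -
  assume "p \<in> Z2loc" "q \<in> Z2loc"
  then obtain a b c d where "odd b" "odd d" "p = of_int a / of_int b" "q = of_int c / of_int d"
    unfolding Z2loc_iff by blast
  moreover from this have "b \<noteq> 0" "d \<noteq> 0" by auto
  ultimately have "odd (b * d)" "p + q = of_int (a * d + c * b) / of_int (b * d)"
    by (auto simp: field_simps)
  then show ?thesis unfolding Z2loc_iff by blast
qed

lemma Z2loc_mult [intro]: "p \<in> Z2loc \<Longrightarrow> q \<in> Z2loc \<Longrightarrow> p * q \<in> Z2loc"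
proof -
  assume "p \<in> Z2loc" "q \<in> Z2loc"
  then obtain a b c d where "odd b" "odd d" "p = of_int a / of_int b" "q = of_int c / of_int d"
    unfolding Z2loc_iff by blast
  then have "odd (b * d)" "p * q = of_int (a * c) / of_int (b * d)" by auto
  then show ?thesis unfolding Z2loc_iff by blast
qed

lemma Z2loc_uminus [intro]: "p \<in> Z2loc \<Longrightarrow> - p \<in> Z2loc"
  using Z2loc_mult[OF Z2loc_of_int[of "-1"], of p] by simp

text \<open>
  The carrier of \<^term>\<open>Z2_poly_ring S\<close> as a plain set, so that membership can be treated by closure rules
  for the ring operations of the type.
\<close>

definition Z2polys :: "nat set \<Rightarrow> qv set" where
  "Z2polys S = {p. (\<forall>m. Poly_Mapping.lookup p m \<in> Z2loc) \<and>
                   (\<forall>m\<in>Poly_Mapping.keys p. Poly_Mapping.keys m \<subseteq> S)}"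

lemma carrier_Z2_poly_ring [simp]: "carrier (Z2_poly_ring S) = Z2polys S"
  and mult_Z2_poly_ring [simp]: "mult (Z2_poly_ring S) = (*)"
  and add_Z2_poly_ring [simp]: "add (Z2_poly_ring S) = (+)"
  and one_Z2_poly_ring [simp]: "one (Z2_poly_ring S) = 1"
  and zero_Z2_poly_ring [simp]: "zero (Z2_poly_ring S) = 0"
  by (simp_all add: Z2_poly_ring_def Z2polys_def)

lemma Z2polys_single [intro]:
  "c \<in> Z2loc \<Longrightarrow> Poly_Mapping.keys m \<subseteq> S \<Longrightarrow> Poly_Mapping.single m c \<in> Z2polys S"
  by (auto simp: Z2polys_def lookup_single when_def)

lemma Z2polys_0 [simp]: "0 \<in> Z2polys S"
  by (simp add: Z2polys_def)

lemma Z2polys_qconst: "c \<in> Z2loc \<Longrightarrow> qconst c \<in> Z2polys S"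
  by auto

lemma Z2polys_1 [simp]: "1 \<in> Z2polys S"
  using Z2polys_qconst[of 1 S] by simp

lemma Z2polys_var: "i \<in> S \<Longrightarrow> var i \<in> Z2polys S"
  by auto

lemma Z2polys_add [intro]: "p \<in> Z2polys S \<Longrightarrow> q \<in> Z2polys S \<Longrightarrow> p + q \<in> Z2polys S"
  using Poly_Mapping.keys_add[of p q] by (fastforce simp: Z2polys_def lookup_add)

lemma Z2polys_uminus [intro]: "p \<in> Z2polys S \<Longrightarrow> - p \<in> Z2polys S"
  by (auto simp: Z2polys_def)

lemma Z2polys_diff [intro]: "p \<in> Z2polys S \<Longrightarrow> q \<in> Z2polys S \<Longrightarrow> p - q \<in> Z2polys S"
  using Z2polys_add[OF _ Z2polys_uminus, of p S q] by simp

lemma Z2polys_sum [intro]: "(\<And>a. a \<in> A \<Longrightarrow> f a \<in> Z2polys S) \<Longrightarrow> sum f A \<in> Z2polys S"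
  by (induction A rule: infinite_finite_induct) auto

text \<open>
  The coefficient \<open>c\<close> of a monomial is recorded to be the one of \<open>p\<close>, so that assumptions on
  particular coefficients of \<open>p\<close> can be used in the induction.
\<close>

lemma Z2polys_induct [consumes 1, case_names zero single add]:
  assumes "p \<in> Z2polys S"
    and "P 0"
    and "\<And>m c. c \<in> Z2loc \<Longrightarrow> Poly_Mapping.keys m \<subseteq> S \<Longrightarrow> c = Poly_Mapping.lookup p m \<Longrightarrow>
      P (Poly_Mapping.single m c)"
    and "\<And>p q. p \<in> Z2polys S \<Longrightarrow> q \<in> Z2polys S \<Longrightarrow> P p \<Longrightarrow> P q \<Longrightarrow> P (p + q)"
  shows "P p"
proof -
  have "(\<Sum>m\<in>A. Poly_Mapping.single m (Poly_Mapping.lookup p m)) \<in> Z2polys S \<and>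
      P (\<Sum>m\<in>A. Poly_Mapping.single m (Poly_Mapping.lookup p m))"
    if "finite A" "A \<subseteq> Poly_Mapping.keys p" for A
    using that
  proof (induction A)
    case (insert m A)
    have m: "Poly_Mapping.lookup p m \<in> Z2loc" "Poly_Mapping.keys m \<subseteq> S"
      using assms(1) insert.prems by (auto simp: Z2polys_def)
    then have "Poly_Mapping.single m (Poly_Mapping.lookup p m) \<in> Z2polys S" by auto
    then show ?case using insert assms(3)[OF m refl] assms(4) by auto
  qed (simp add: assms(2))
  from this[of "Poly_Mapping.keys p"] poly_eq_sum_monomials[of "Poly_Mapping.keys p" p]
  show ?thesis by simp
qed

lemma Z2polys_mult [intro]: "p \<in> Z2polys S \<Longrightarrow> q \<in> Z2polys S \<Longrightarrow> p * q \<in> Z2polys S"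
proof (induction p rule: Z2polys_induct)
  case (single m c)
  note mc = single(1,2)
  from \<open>q \<in> Z2polys S\<close> show ?case
  proof (induction q rule: Z2polys_induct)
    case (single n d)
    then show ?case using mc Poly_Mapping.keys_add[of m n]
      by (fastforce simp: mult_single)
  qed (auto simp: distrib_left)
qed (auto simp: distrib_right)

lemma Z2polys_power [intro]: "p \<in> Z2polys S \<Longrightarrow> p ^ n \<in> Z2polys S"
  by (induction n) auto

lemma Z2polys_numeral [simp]: "numeral n \<in> Z2polys S"
  using Z2polys_qconst[of "numeral n" S] by simp

lemma Z2polys_vgen: "i \<in> insert 0 S \<Longrightarrow> vgen i \<in> Z2polys S"
  by (auto simp: vgen_def)

lemma substitute_Z2polys:
  assumes "p \<in> Z2polys S" "\<And>i. i \<in> S \<Longrightarrow> g i \<in> Z2polys S'"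
  shows "substitute g p \<in> Z2polys S'"
  using assms(1)
proof (induction p rule: Z2polys_induct)
  case (single m c)
  have "(\<Prod>i\<in>A. g i ^ Poly_Mapping.lookup m i) \<in> Z2polys S'" if "A \<subseteq> S" for A
    using that by (induction A rule: infinite_finite_induct) (auto intro!: Z2polys_mult Z2polys_power assms(2))
  then have "monomial_value g m \<in> Z2polys S'" using single by (simp add: monomial_value_def)
  then show ?case using single by (simp add: substitute_single Z2polys_mult Z2polys_qconst)
qed (auto simp: substitute_add)

lemma cring_Z2_poly_ring: "cring (Z2_poly_ring S)"
proof (rule cringI)
  show "abelian_group (Z2_poly_ring S)"
  proof (rule abelian_groupI)
    fix x assume "x \<in> carrier (Z2_poly_ring S)"
    then show "\<exists>y\<in>carrier (Z2_poly_ring S). y \<oplus>\<^bsub>Z2_poly_ring S\<^esub> x = \<zero>\<^bsub>Z2_poly_ring S\<^esub>"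
      by (auto intro!: bexI[of _ "- x"])
  qed (auto simp: add_ac)
  show "comm_monoid (Z2_poly_ring S)"
    by (rule comm_monoidI) (auto simp: mult_ac)
qed (auto simp: distrib_right)

lemma a_inv_Z2_poly_ring: "x \<in> Z2polys S \<Longrightarrow> \<ominus>\<^bsub>Z2_poly_ring S\<^esub> x = - x"
proof -
  interpret R: cring "Z2_poly_ring S" by (rule cring_Z2_poly_ring)
  assume "x \<in> Z2polys S"
  then show ?thesis using R.minus_equality[of "- x" x] by auto
qed

text \<open>
  Since $v_0 = 2$ belongs to the ideal, the index 0 is added to the variables of the ring.
\<close>

definition v_ideal :: "nat set \<Rightarrow> qv set" where
  "v_ideal S = genideal (Z2_poly_ring S) (vgen ` insert 0 S)"

lemma ideal_v_ideal: "ideal (v_ideal S) (Z2_poly_ring S)"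
proof -
  interpret R: cring "Z2_poly_ring S" by (rule cring_Z2_poly_ring)
  show ?thesis unfolding v_ideal_def
    by (rule R.genideal_ideal) (use Z2polys_vgen in auto)
qed

lemma ideal_ideal_power:
  assumes "cring R" "ideal I R"
  shows "ideal (ideal_power R I n) R"
proof -
  interpret R: cring R by fact
  show ?thesis
    by (induction n) (auto simp: R.oneideal intro!: R.ideal_prod_is_ideal assms(2))
qed

definition v_square :: "nat set \<Rightarrow> qv set" where
  "v_square S = ideal_power (Z2_poly_ring S) (v_ideal S) 2"

lemma ideal_v_square: "ideal (v_square S) (Z2_poly_ring S)"
  unfolding v_square_def by (intro ideal_ideal_power cring_Z2_poly_ring ideal_v_ideal)

lemma
  assumes "ideal I (Z2_poly_ring S)"
  shows Z2_ideal_zero: "0 \<in> I"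
    and Z2_ideal_add: "a \<in> I \<Longrightarrow> b \<in> I \<Longrightarrow> a + b \<in> I"
    and Z2_ideal_diff: "a \<in> I \<Longrightarrow> b \<in> I \<Longrightarrow> a - b \<in> I"
    and Z2_ideal_mult_left: "a \<in> I \<Longrightarrow> x \<in> Z2polys S \<Longrightarrow> x * a \<in> I"
    and Z2_ideal_subset: "I \<subseteq> Z2polys S"
    and Z2_ideal_sum: "(\<And>a. a \<in> A \<Longrightarrow> f a \<in> I) \<Longrightarrow> sum f A \<in> I"
proof -
  interpret ideal I "Z2_poly_ring S" by fact
  show zero: "0 \<in> I" using additive_subgroup.zero_closed[OF ideal.axioms(1)[OF assms]] by simp
  show add: "a + b \<in> I" if "a \<in> I" "b \<in> I" for a b
    using additive_subgroup.a_closed[OF ideal.axioms(1)[OF assms] that] by simp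
  show mult: "x * a \<in> I" if "a \<in> I" "x \<in> Z2polys S" for x a using I_l_closed[of a x] that by simp
  show "a - b \<in> I" if "a \<in> I" "b \<in> I" for a b
    using add[OF that(1) mult[of b "- 1"]] that(2) by (simp add: Z2polys_uminus)
  show "I \<subseteq> Z2polys S" using a_subset by simp
  show "sum f A \<in> I" if "\<And>a. a \<in> A \<Longrightarrow> f a \<in> I"
    using that by (induction A rule: infinite_finite_induct) (auto simp: zero add)
qed

lemma vgen_in_v_ideal: "i \<in> insert 0 S \<Longrightarrow> vgen i \<in> v_ideal S"
proof -
  interpret R: cring "Z2_poly_ring S" by (rule cring_Z2_poly_ring)
  show "i \<in> insert 0 S \<Longrightarrow> vgen i \<in> v_ideal S"
    unfolding v_ideal_def using R.genideal_self[of "vgen ` insert 0 S"] Z2polys_vgen[of _ S] by auto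
qed

lemma v_square_prod: "a \<in> v_ideal S \<Longrightarrow> b \<in> v_ideal S \<Longrightarrow> a * b \<in> v_square S"
proof -
  assume a: "a \<in> v_ideal S" and b: "b \<in> v_ideal S"
  have "b * 1 \<in> ideal_power (Z2_poly_ring S) (v_ideal S) 1"
    using ideal_prod.prod[OF b, of 1 "Z2polys S" "Z2_poly_ring S"] by simp
  then show ?thesis
    using ideal_prod.prod[OF a, of b _ "Z2_poly_ring S"]
    by (simp add: v_square_def numeral_2_eq_2)
qed

lemma v_square_subset_v_ideal: "v_square S \<subseteq> v_ideal S"
proof -
  interpret R: cring "Z2_poly_ring S" by (rule cring_Z2_poly_ring)
  have "ideal (ideal_power (Z2_poly_ring S) (v_ideal S) 1) (Z2_poly_ring S)"
    by (intro ideal_ideal_power cring_Z2_poly_ring ideal_v_ideal)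
  from R.ideal_prod_inter[OF ideal_v_ideal this] show ?thesis
    by (auto simp: v_square_def numeral_2_eq_2)
qed

lemma v_ideal_image:
  assumes \<theta>: "\<And>p q. \<theta> (p + q) = \<theta> p + \<theta> q" "\<And>p q. \<theta> (p * q) = \<theta> p * \<theta> q"
    and carr: "\<And>p. p \<in> Z2polys S \<Longrightarrow> \<theta> p \<in> Z2polys S'"
    and gens: "\<And>i. i \<in> insert 0 S \<Longrightarrow> \<theta> (vgen i) \<in> v_ideal S'"
    and p: "p \<in> v_ideal S"
  shows "\<theta> p \<in> v_ideal S'"
proof -
  interpret R: cring "Z2_poly_ring S" by (rule cring_Z2_poly_ring)
  note I' = ideal_v_ideal[of S']
  have \<theta>0: "\<theta> 0 = 0" using \<theta>(1)[of 0 0] by simp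
  have \<theta>m: "\<theta> (- x) = - \<theta> x" for x using \<theta>(1)[of x "- x"] \<theta>0 by (simp add: add_eq_0_iff)
  have "ideal {x \<in> Z2polys S. \<theta> x \<in> v_ideal S'} (Z2_poly_ring S)"
  proof (rule idealI)
    show "ring (Z2_poly_ring S)" by (rule R.ring_axioms)
    show "subgroup {x \<in> Z2polys S. \<theta> x \<in> v_ideal S'} (add_monoid (Z2_poly_ring S))"
    proof (rule R.add.subgroupI)
      fix a assume a: "a \<in> {x \<in> Z2polys S. \<theta> x \<in> v_ideal S'}"
      then have "\<ominus>\<^bsub>Z2_poly_ring S\<^esub> a = - a"
        using a_inv_Z2_poly_ring[of a S] by simp
      then show "\<ominus>\<^bsub>Z2_poly_ring S\<^esub> a \<in> {x \<in> Z2polys S. \<theta> x \<in> v_ideal S'}"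
        using a Z2_ideal_diff[OF I' Z2_ideal_zero[OF I'], of "\<theta> a"] \<theta>m by auto
    qed (use \<theta> \<theta>0 Z2_ideal_zero[OF I'] Z2_ideal_add[OF I'] in auto)
  qed (use \<theta> carr Z2_ideal_mult_left[OF I'] in \<open>auto simp: mult.commute\<close>)
  then have "v_ideal S \<subseteq> {x \<in> Z2polys S. \<theta> x \<in> v_ideal S'}"
    unfolding v_ideal_def[of S] by (rule R.genideal_minimal) (use gens Z2polys_vgen in auto)
  then show ?thesis using p by blast
qed

text \<open>
  A ring homomorphism that sends generators of one ideal into another one does the same for their
  squares. This transports congruences along a change of generators and along $BP_* \to BP\langle k\rangle_*$.
\<close>

lemma v_square_image:
  assumes \<theta>: "\<And>p q. \<theta> (p + q) = \<theta> p + \<theta> q" "\<And>p q. \<theta> (p * q) = \<theta> p * \<theta> q"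
    and carr: "\<And>p. p \<in> Z2polys S \<Longrightarrow> \<theta> p \<in> Z2polys S'"
    and gens: "\<And>i. i \<in> insert 0 S \<Longrightarrow> \<theta> (vgen i) \<in> v_ideal S'"
    and p: "p \<in> v_square S"
  shows "\<theta> p \<in> v_square S'"
proof -
  interpret R: cring "Z2_poly_ring S" by (rule cring_Z2_poly_ring)
  have one: "ideal_power (Z2_poly_ring S) (v_ideal S) 1 \<subseteq> v_ideal S"
    using R.ideal_prod_inter[OF ideal_v_ideal R.oneideal] by auto
  have "p \<in> ideal_prod (Z2_poly_ring S) (v_ideal S) (ideal_power (Z2_poly_ring S) (v_ideal S) 1)"
    using p by (simp add: v_square_def numeral_2_eq_2)
  then show ?thesis
  proof (induction rule: ideal_prod.induct)
    case (prod i j)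
    then have "\<theta> i \<in> v_ideal S'" "\<theta> j \<in> v_ideal S'"
      using v_ideal_image[OF \<theta> carr gens] one by blast+
    then show ?case using \<theta> v_square_prod by simp
  next
    case (sum s t)
    then show ?case using \<theta> Z2_ideal_add[OF ideal_v_square] by simp
  qed
qed

text \<open>
  Every nonconstant monomial is divisible by one of the $v_i$, and $v_0 = 2$ takes care of the constant.
\<close>

lemma in_v_ideal_if_const:
  assumes p: "p \<in> Z2polys S" and S: "0 \<notin> S" and c: "Poly_Mapping.lookup p 0 / 2 \<in> Z2loc"
  shows "p \<in> v_ideal S"
  using p
proof (induction p rule: Z2polys_induct)
  case zero
  then show ?case using Z2_ideal_zero[OF ideal_v_ideal] .
next
  case (single m d)
  show ?case
  proof (cases "m = 0")
    case True
    have "qconst (d / 2) * vgen 0 = qconst d"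
      by (simp add: vgen_def mult_single flip: single_numeral)
    then show ?thesis
      using Z2_ideal_mult_left[OF ideal_v_ideal vgen_in_v_ideal, of 0 S "qconst (d / 2)"] c single True
      by (auto intro: Z2polys_qconst)
  next
    case False
    then obtain i where i: "i \<in> Poly_Mapping.keys m" by fastforce
    then have iS: "i \<in> S" "i \<noteq> 0" using single(2) S by (blast, metis subsetD)
    define n where "n = m - Poly_Mapping.single i 1"
    have m: "n + Poly_Mapping.single i 1 = m"
      using i by (intro poly_mapping_eqI) (auto simp: n_def lookup_add lookup_minus lookup_single when_def in_keys_iff)
    have "Poly_Mapping.keys n \<subseteq> Poly_Mapping.keys m"
      by (auto simp: n_def in_keys_iff lookup_minus)
    then have "Poly_Mapping.single n d \<in> Z2polys S" using single by auto
    then have "Poly_Mapping.single n d * vgen i \<in> v_ideal S"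
      by (intro Z2_ideal_mult_left[OF ideal_v_ideal vgen_in_v_ideal]) (use iS in auto)
    also have "Poly_Mapping.single n d * vgen i = Poly_Mapping.single m d"
      using iS m by (simp add: vgen_def mult_single)
    finally show ?thesis .
  qed
next
  case (add p q)
  then show ?case using Z2_ideal_add[OF ideal_v_ideal] by simp
qed

section \<open>Composition equations for power series\<close>

unbundle fps_syntax

lemma fps_power_nth_cong_less:
  fixes s t :: "'a::comm_ring_1 fps"
  assumes "\<And>m. m < n \<Longrightarrow> s $ m = t $ m" "m < n"
  shows "(s ^ i) $ m = (t ^ i) $ m"
  using assms(2)
proof (induction i arbitrary: m)
  case (Suc i)
  then show ?case
    unfolding power_Suc fps_mult_nth using assms(1) by (intro sum.cong) auto
qed simp

text \<open>
  In a product of at least two series without constant term, the coefficient of degree \<open>n\<close> involves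
  only coefficients of degree less than \<open>n\<close>. Composition equations are therefore triangular.
\<close>

lemma fps_power_nth_cong:
  fixes s t :: "'a::comm_ring_1 fps"
  assumes "s $ 0 = 0" "\<And>m. m < n \<Longrightarrow> s $ m = t $ m" "t $ 0 = 0" "i \<ge> 2"
  shows "(s ^ i) $ n = (t ^ i) $ n"
proof -
  obtain j where i: "i = Suc j" "j \<ge> 1" using assms(4) by (cases i) auto
  then have z: "(s ^ j) $ 0 = 0" "(t ^ j) $ 0 = 0"
    using assms(1,3) by (auto simp: fps_power_zeroth zero_power)
  have "s $ a * (s ^ j) $ (n - a) = t $ a * (t ^ j) $ (n - a)" if "a \<in> {0..n}" for a
  proof (cases "a = 0 \<or> a = n")
    case True
    then show ?thesis using assms z by auto
  next
    case False
    then have "a < n" "n - a < n" using that by auto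
    then show ?thesis
      using assms(2) fps_power_nth_cong_less[of n s t "n - a" j] by simp
  qed
  then show ?thesis unfolding i power_Suc fps_mult_nth by (intro sum.cong) auto
qed

text \<open>
  The coefficients of the solution \<open>s\<close> of \<open>f oo s = g\<close>. The powers in the recursive call are those of the
  part of \<open>s\<close> that is already known.
\<close>

function compose_solution :: "'a::comm_ring_1 fps \<Rightarrow> 'a fps \<Rightarrow> nat \<Rightarrow> 'a" where
  "compose_solution f g n =
     g $ n - (\<Sum>i\<in>{2..n}. f $ i * (Abs_fps (\<lambda>m. if m < n then compose_solution f g m else 0) ^ i) $ n)"
  by auto
termination by (relation "measure (\<lambda>(f, g, n). n)") auto

declare compose_solution.simps [simp del]

lemma fps_compose_nth_split:
  fixes f s :: "'a::comm_ring_1 fps"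
  assumes "f $ 0 = 0" "f $ 1 = 1" "s $ 0 = 0"
  shows "(f oo s) $ n = s $ n + (\<Sum>i\<in>{2..n}. f $ i * (s ^ i) $ n)"
proof (cases "n = 0")
  case True
  then show ?thesis using assms by (simp add: fps_compose_nth)
next
  case False
  then have "{0..n} = insert 0 (insert 1 {2..n})" by auto
  then show ?thesis using assms by (simp add: fps_compose_nth)
qed

lemma fps_compose_ex1:
  fixes f g :: "'a::comm_ring_1 fps"
  assumes f: "f $ 0 = 0" "f $ 1 = 1" and g: "g $ 0 = 0"
  shows "\<exists>!s. s $ 0 = 0 \<and> f oo s = g"
proof (rule ex_ex1I)
  define s where "s = Abs_fps (compose_solution f g)"
  have s0: "s $ 0 = 0" by (simp add: s_def compose_solution.simps[of f g 0] g)
  have "(f oo s) $ n = g $ n" for n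
  proof -
    have "(\<Sum>i\<in>{2..n}. f $ i * (s ^ i) $ n) =
        (\<Sum>i\<in>{2..n}. f $ i * (Abs_fps (\<lambda>m. if m < n then compose_solution f g m else 0) ^ i) $ n)"
    proof (intro sum.cong refl arg_cong2[where f = "(*)"])
      fix i assume "i \<in> {2..n}"
      then show "(s ^ i) $ n = (Abs_fps (\<lambda>m. if m < n then compose_solution f g m else 0) ^ i) $ n"
        using s0 by (intro fps_power_nth_cong) (auto simp: s_def)
    qed
    moreover have "s $ n = g $ n - (\<Sum>i\<in>{2..n}. f $ i *
        (Abs_fps (\<lambda>m. if m < n then compose_solution f g m else 0) ^ i) $ n)"
      unfolding s_def fps_nth_Abs_fps by (rule compose_solution.simps)
    ultimately show ?thesis by (simp add: fps_compose_nth_split[OF f s0])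
  qed
  then show "\<exists>s. s $ 0 = 0 \<and> f oo s = g" using s0 by (auto simp: fps_eq_iff)
next
  fix s t assume s: "s $ 0 = 0 \<and> f oo s = g" and t: "t $ 0 = 0 \<and> f oo t = g"
  have "s $ n = t $ n" for n
  proof (induction n rule: less_induct)
    case (less n)
    have "(\<Sum>i\<in>{2..n}. f $ i * (s ^ i) $ n) = (\<Sum>i\<in>{2..n}. f $ i * (t ^ i) $ n)"
      using s t less by (intro sum.cong refl arg_cong2[where f = "(*)"] fps_power_nth_cong) auto
    then show ?case
      using s t fps_compose_nth_split[OF f, of s n] fps_compose_nth_split[OF f, of t n] by simp
  qed
  then show "s = t" by (simp add: fps_eq_iff)
qed

section \<open>The 2-series and its specialisation\<close>

lemma log_series_nth_0 [simp]: "log_series h $ 0 = 0"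
proof -
  have "{n. (0::nat) = 2 ^ n} = {}" by simp
  then show ?thesis by (simp add: log_series_def)
qed

lemma log_coeff_0 [simp]: "log_coeff h 0 = 1"
  by (simp add: log_coeff.simps)

lemma log_series_nth_power_of_2: "log_series h $ (2 ^ n) = log_coeff h n"
proof -
  have "{m. (2::nat) ^ n = 2 ^ m} = {n}" by auto
  then show ?thesis by (simp add: log_series_def)
qed

lemma log_series_nth_other: "(\<And>n. m \<noteq> 2 ^ n) \<Longrightarrow> log_series h $ m = 0"
  by (simp add: log_series_def)

lemma log_series_nth_1 [simp]: "log_series h $ Suc 0 = 1"
  using log_series_nth_power_of_2[of h 0] by simp

lemma two_series_unique:
  assumes "s $ 0 = 0" "log_series h oo s = log_series h + log_series h"
  shows "two_series h = s"
proof -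
  have "\<exists>!s. s $ 0 = 0 \<and> log_series h oo s = log_series h + log_series h"
    by (rule fps_compose_ex1) auto
  then show ?thesis unfolding two_series_def using assms by (intro the1_equality) auto
qed

lemma two_series:
  "two_series h $ 0 = 0" "log_series h oo two_series h = log_series h + log_series h"
proof -
  have "\<exists>!s. s $ 0 = 0 \<and> log_series h oo s = log_series h + log_series h"
    by (rule fps_compose_ex1) auto
  from theI'[OF this] show "two_series h $ 0 = 0"
    "log_series h oo two_series h = log_series h + log_series h"
    unfolding two_series_def by auto
qed

definition fps_map :: "(qv \<Rightarrow> qv) \<Rightarrow> qv fps \<Rightarrow> qv fps" where
  "fps_map \<theta> t = Abs_fps (\<lambda>n. \<theta> (t $ n))"

lemma fps_map_nth [simp]: "fps_map \<theta> t $ n = \<theta> (t $ n)"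
  by (simp add: fps_map_def)

lemma fps_map_subst:
  "fps_map (substitute g) (s + t) = fps_map (substitute g) s + fps_map (substitute g) t"
  "fps_map (substitute g) (s - t) = fps_map (substitute g) s - fps_map (substitute g) t"
  "fps_map (substitute g) (s * t) = fps_map (substitute g) s * fps_map (substitute g) t"
  "fps_map (substitute g) (fps_const c) = fps_const (substitute g c)"
  "fps_map (substitute g) 1 = 1"
  "fps_map (substitute g) fps_X = fps_X"
  by (auto simp: fps_eq_iff substitute_add substitute_diff fps_mult_nth substitute_mult substitute_sum fps_X_def)

lemma fps_map_subst_power: "fps_map (substitute g) (s ^ n) = fps_map (substitute g) s ^ n"
  by (induction n) (auto simp: fps_map_subst)

lemma fps_map_subst_compose:
  "fps_map (substitute g) (s oo t) = fps_map (substitute g) s oo fps_map (substitute g) t"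
  by (auto simp: fps_eq_iff fps_compose_nth substitute_sum substitute_mult fps_map_subst_power[symmetric])

lemma log_coeff_subst: "log_coeff h n = substitute h (log_coeff vgen n)"
proof (induction n rule: less_induct)
  case (less n)
  show ?case
  proof (cases "n = 0")
    case False
    have "log_coeff h i * h (n - i) ^ 2 ^ i = substitute h (log_coeff vgen i * vgen (n - i) ^ 2 ^ i)"
      if "i < n" for i
    proof -
      have "vgen (n - i) = var (n - i)" using that by (simp add: vgen_def)
      then show ?thesis using that less by (simp add: substitute_mult substitute_power)
    qed
    then show ?thesis
      using False by (simp add: log_coeff.simps[of _ n] substitute_mult substitute_sum)
  qed simp
qed

text \<open>
  A choice \<open>h\<close> of generators is the image of the Hazewinkel generators under the substitution
  $v_n \mapsto$ \<open>h n\<close>, and composition equations are preserved by coefficientwise homomorphisms. So it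
  suffices to study \<open>two_series vgen\<close>.
\<close>

lemma two_series_subst: "two_series h = fps_map (substitute h) (two_series vgen)"
proof (rule two_series_unique)
  have L: "log_series h = fps_map (substitute h) (log_series vgen)"
    by (auto simp: fps_eq_iff log_series_def substitute_sum log_coeff_subst[of h])
  show "fps_map (substitute h) (two_series vgen) $ 0 = 0" using two_series(1)[of vgen] by simp
  show "log_series h oo fps_map (substitute h) (two_series vgen) = log_series h + log_series h"
    unfolding L fps_map_subst_compose[symmetric] two_series(2) fps_map_subst ..
qed

section \<open>The functional equation of the logarithm\<close>

text \<open>
  Partial sums of $\sum_n f_n t^{2^n}$. For $t$ without constant term, the coefficient of degree $N$ is reached as soon as
  $2^{B+1} > N$. Identities between finite sums, valid for every series \<open>t\<close>, thus replace identities
  between infinite ones.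
\<close>

definition log_sum :: "(nat \<Rightarrow> qv) \<Rightarrow> nat \<Rightarrow> qv fps \<Rightarrow> qv fps" where
  "log_sum f B t = (\<Sum>n\<le>B. fps_const (f n) * t ^ (2 ^ n))"

lemma compose_log_series_nth:
  assumes "t $ 0 = 0" "N < 2 ^ Suc B"
  shows "(log_series h oo t) $ N = log_sum (log_coeff h) B t $ N"
proof -
  have "(log_series h oo t) $ N = (\<Sum>i\<in>{0..N}. log_series h $ i * (t ^ i) $ N)"
    by (simp add: fps_compose_nth)
  also have "\<dots> = (\<Sum>i\<in>{0..N} \<union> (\<lambda>n. 2 ^ n) ` {..B}. log_series h $ i * (t ^ i) $ N)"
    using assms(1) by (intro sum.mono_neutral_left) (auto simp: startsby_zero_power_prefix)
  also have "\<dots> = (\<Sum>i\<in>(\<lambda>n. 2 ^ n) ` {..B}. log_series h $ i * (t ^ i) $ N)"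
  proof (intro sum.mono_neutral_right ballI)
    fix i assume i: "i \<in> {0..N} \<union> (\<lambda>n. 2 ^ n) ` {..B} - (\<lambda>n. 2 ^ n) ` {..B}"
    have "i \<noteq> 2 ^ n" for n
    proof
      assume n: "i = 2 ^ n"
      then have "(2::nat) ^ n < 2 ^ Suc B" using i assms(2) by auto
      then have "n \<le> B" using power_less_imp_less_exp[of "2::nat" n "Suc B"] by simp
      then show False using i n by auto
    qed
    then show "log_series h $ i * (t ^ i) $ N = 0" by (simp add: log_series_nth_other)
  qed auto
  also have "\<dots> = (\<Sum>n\<le>B. log_coeff h n * (t ^ (2 ^ n)) $ N)"
    by (subst sum.reindex) (auto simp: inj_on_def log_series_nth_power_of_2)
  finally show ?thesis by (simp add: log_sum_def fps_sum_nth)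
qed

lemma two_series_log_sum:
  assumes "N < 2 ^ Suc B"
  shows "log_sum (log_coeff h) B (two_series h) $ N = 2 * log_sum (log_coeff h) B fps_X $ N"
proof -
  have "log_sum (log_coeff h) B (two_series h) $ N = (log_series h + log_series h) $ N"
    by (simp only: compose_log_series_nth[OF two_series(1) assms, symmetric] two_series(2))
  also have "\<dots> = 2 * (log_series h oo fps_X) $ N"
    by (simp only: fps_compose_fps_X fps_add_nth mult_2)
  also have "\<dots> = 2 * log_sum (log_coeff h) B fps_X $ N"
    by (subst compose_log_series_nth[of _ _ B]) (use assms in auto)
  finally show ?thesis .
qed

text \<open>
  The $i$-th iterate of $v_j \mapsto v_j^2$, which lifts the Frobenius map $p \mapsto p^2$ of $\mathbb{F}_2[v]$.
\<close>

definition frob :: "nat \<Rightarrow> qv \<Rightarrow> qv" where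
  "frob i = substitute (\<lambda>j. var j ^ (2 ^ i))"

lemma substitute_substitute: "substitute g (substitute h p) = substitute (\<lambda>i. substitute g (h i)) p"
proof -
  have "substitute g (monomial_value h m) = monomial_value (\<lambda>i. substitute g (h i)) m" for m
  proof -
    have "substitute g (\<Prod>i\<in>A. f i) = (\<Prod>i\<in>A. substitute g (f i))" for f and A :: "nat set"
      by (induction A rule: infinite_finite_induct) (auto simp: substitute_mult)
    then show ?thesis by (simp add: monomial_value_def substitute_power)
  qed
  then show ?thesis by (simp add: substitute_def[of h] substitute_def[of "\<lambda>i. substitute g (h i)"] substitute_sum substitute_mult)
qed

lemma frob_frob: "frob i (frob j p) = frob (i + j) p"
  by (simp add: frob_def substitute_substitute substitute_power power_mult[symmetric] power_add mult.commute)

lemma frob_0 [simp]: "frob 0 p = p"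
  by (simp add: frob_def substitute_var_id)

lemma log_coeff_vgen:
  assumes "n > 0"
  shows "log_coeff vgen n = qconst (1/2) * (\<Sum>i<n. log_coeff vgen i * var (n - i) ^ 2 ^ i)"
  using assms by (simp add: log_coeff.simps[of _ n] vgen_def)

text \<open>
  Both Hazewinkel's recursion and this one, in which the Frobenius lift acts on the remaining factor, expand
  to the same sum over compositions of \<open>n\<close>: the recursion splits off the last part, this one the
  first.
\<close>

lemma log_coeff_twisted:
  assumes "n > 0"
  shows "log_coeff vgen n = qconst (1/2) * (\<Sum>i=1..n. var i * frob i (log_coeff vgen (n - i)))"
  using assms
proof (induction n rule: less_induct)
  case (less n)
  let ?l = "log_coeff vgen" and ?c = "qconst (1/2)"
  have A: "?l a * var (n - a) ^ 2 ^ a =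
      (\<Sum>i=1..a. ?c * var i * frob i (?l (a - i)) * var (n - a) ^ 2 ^ a)" if "0 < a" "a < n" for a
    using less.IH[OF that(2,1)] by (simp add: sum_distrib_left sum_distrib_right mult_ac)
  have B: "var i * frob i (?l (n - i)) =
      (\<Sum>a\<in>{i..<n}. ?c * var i * frob i (?l (a - i)) * var (n - a) ^ 2 ^ a)" if "0 < i" "i < n" for i
  proof -
    have "frob i (?l (n - i)) = ?c * (\<Sum>b<n - i. frob i (?l b) * var (n - i - b) ^ (2 ^ i * 2 ^ b))"
      using that by (simp add: log_coeff_vgen[of "n - i"] frob_def substitute_mult substitute_sum substitute_power power_mult)
    also have "(\<Sum>b<n - i. frob i (?l b) * var (n - i - b) ^ (2 ^ i * 2 ^ b)) =
        (\<Sum>a\<in>{i..<n}. frob i (?l (a - i)) * var (n - a) ^ 2 ^ a)"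
      by (rule sum.reindex_bij_witness[where i = "\<lambda>a. a - i" and j = "\<lambda>b. b + i"])
        (auto simp: power_add mult.commute add.commute)
    finally show ?thesis by (simp add: sum_distrib_left mult_ac)
  qed
  have split1: "{..<n} = insert 0 {0<..<n}" and split2: "{1..n} = insert n {0<..<n}"
    using less.prems by auto
  have "(\<Sum>a<n. ?l a * var (n - a) ^ 2 ^ a) = var n + (\<Sum>a\<in>{0<..<n}. ?l a * var (n - a) ^ 2 ^ a)"
    unfolding split1 by simp
  also have "(\<Sum>a\<in>{0<..<n}. ?l a * var (n - a) ^ 2 ^ a) =
      (\<Sum>a\<in>{0<..<n}. \<Sum>i=1..a. ?c * var i * frob i (?l (a - i)) * var (n - a) ^ 2 ^ a)"
    using A by (intro sum.cong) auto
  also have "\<dots> = (\<Sum>i\<in>{0<..<n}. \<Sum>a\<in>{i..<n}. ?c * var i * frob i (?l (a - i)) * var (n - a) ^ 2 ^ a)"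
    unfolding sum.Sigma[OF finite_greaterThanLessThan ballI[OF finite_atLeastAtMost]]
      sum.Sigma[OF finite_greaterThanLessThan ballI[OF finite_atLeastLessThan]]
    by (rule sum.reindex_bij_witness[where i = "\<lambda>(x, y). (y, x)" and j = "\<lambda>(x, y). (y, x)"]) auto
  also have "\<dots> = (\<Sum>i\<in>{0<..<n}. var i * frob i (?l (n - i)))"
    using B by (intro sum.cong) auto
  also have "var n + \<dots> = (\<Sum>i=1..n. var i * frob i (?l (n - i)))"
    unfolding split2 by (simp add: frob_def)
  finally show ?case using less.prems by (simp add: log_coeff_vgen)
qed

abbreviation BPs :: "qv set" where "BPs \<equiv> Z2polys {0<..}"

lemma frob_BPs: "p \<in> BPs \<Longrightarrow> frob i p \<in> BPs"
  unfolding frob_def by (rule substitute_Z2polys) (auto intro: Z2polys_var)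

lemma log_coeff_denominator: "2 ^ n * log_coeff vgen n \<in> BPs"
proof (induction n rule: less_induct)
  case (less n)
  show ?case
  proof (cases "n = 0")
    case False
    then obtain m where m: "n = Suc m" by (cases n) auto
    have half: "2 * qconst (1/2) = 1"
      using mult_single[of 0 2 0 "1/2::rat"] by simp
    define S where "S = (\<Sum>i<n. log_coeff vgen i * var (n - i) ^ 2 ^ i)"
    have "2 ^ n * log_coeff vgen n = 2 ^ n * (qconst (1/2) * S)"
      using False by (simp add: log_coeff_vgen S_def)
    also have "\<dots> = 2 * qconst (1/2) * (2 ^ m * S)"
      by (simp only: m power_Suc mult_ac)
    also have "\<dots> = 2 * qconst (1/2) * (\<Sum>i<n. 2 ^ m * (log_coeff vgen i * var (n - i) ^ 2 ^ i))"
      by (simp only: S_def sum_distrib_left)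
    also have "\<dots> = (\<Sum>i<n. 2 ^ (m - i) * (2 ^ i * log_coeff vgen i) * var (n - i) ^ 2 ^ i)"
      unfolding half mult_1
    proof (intro sum.cong refl)
      fix i assume "i \<in> {..<n}"
      then have "(2::qv) ^ m = 2 ^ (m - i) * 2 ^ i" using m by (simp flip: power_add)
      then show "2 ^ m * (log_coeff vgen i * var (n - i) ^ 2 ^ i) =
          2 ^ (m - i) * (2 ^ i * log_coeff vgen i) * var (n - i) ^ 2 ^ i"
        by (simp add: mult_ac)
    qed
    also have "\<dots> \<in> BPs"
      using less by (intro Z2polys_sum Z2polys_mult[OF Z2polys_mult]) (auto intro!: Z2polys_power Z2polys_var)
    finally show ?thesis .
  qed simp
qed

lemma fps_two_times_nth: "(2 * t :: 'a::comm_ring_1 fps) $ n = 2 * t $ n"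
  by (simp only: mult_2 fps_add_nth)

lemma substitute_two_times: "substitute g (2 * p) = 2 * substitute g p"
  by (simp only: mult_2 substitute_add)

text \<open>
  The functional equation $\log t = t + \sum_i \frac{v_i}{2} \log^{(i)}(t^{2^i})$, truncated.
\<close>

lemma log_sum_twisted:
  "log_sum (log_coeff vgen) B t =
     t + (\<Sum>i=1..B. fps_const (qconst (1/2) * var i) *
       log_sum (\<lambda>n. frob i (log_coeff vgen n)) (B - i) (t ^ (2 ^ i)))"
proof -
  let ?l = "log_coeff vgen" and ?c = "qconst (1/2)"
  have "log_sum ?l B t = (\<Sum>n\<in>insert 0 {1..B}. fps_const (?l n) * t ^ (2 ^ n))"
    unfolding log_sum_def by (intro sum.cong) auto
  also have "\<dots> = t + (\<Sum>n=1..B. fps_const (?l n) * t ^ (2 ^ n))" by simp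
  also have "(\<Sum>n=1..B. fps_const (?l n) * t ^ (2 ^ n)) =
      (\<Sum>n=1..B. \<Sum>i=1..n. fps_const (?c * var i * frob i (?l (n - i))) * t ^ (2 ^ n))"
  proof (intro sum.cong refl)
    fix n assume "n \<in> {1..B}"
    then have "?l n = (\<Sum>i=1..n. ?c * var i * frob i (?l (n - i)))"
      by (subst log_coeff_twisted) (auto simp: sum_distrib_left mult.assoc)
    moreover have "fps_const (\<Sum>i=1..n. f i) = (\<Sum>i=1..n. fps_const (f i))" for f :: "nat \<Rightarrow> qv"
      by (simp add: fps_eq_iff fps_sum_nth)
    ultimately show "fps_const (?l n) * t ^ (2 ^ n) =
        (\<Sum>i=1..n. fps_const (?c * var i * frob i (?l (n - i))) * t ^ (2 ^ n))"
      by (simp only: sum_distrib_right)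
  qed
  also have "\<dots> = (\<Sum>i=1..B. \<Sum>m\<le>B - i. fps_const (?c * var i * frob i (?l m)) * t ^ (2 ^ (i + m)))"
    unfolding sum.Sigma[OF finite_atLeastAtMost ballI[OF finite_atLeastAtMost]]
      sum.Sigma[OF finite_atLeastAtMost ballI[OF finite_atMost]]
    by (rule sum.reindex_bij_witness[where i = "\<lambda>(i, m). (i + m, i)" and j = "\<lambda>(n, i). (i, n - i)"]) auto
  also have "\<dots> = (\<Sum>i=1..B. fps_const (?c * var i) * log_sum (\<lambda>n. frob i (?l n)) (B - i) (t ^ (2 ^ i)))"
    by (intro sum.cong refl)
      (simp add: log_sum_def sum_distrib_left power_mult[symmetric] power_add mult.assoc[symmetric])
  finally show ?thesis .
qed

text \<open>
  The lift $t \mapsto (\sigma^i t)(x^{2^i})$ of the $2^i$-th power map to power series.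
\<close>

definition frob_series :: "nat \<Rightarrow> qv fps \<Rightarrow> qv fps" where
  "frob_series i t = fps_map (frob i) t oo fps_X ^ (2 ^ i)"

lemma frob_series_nth:
  "frob_series i t $ N = (if 2 ^ i dvd N then frob i (t $ (N div 2 ^ i)) else 0)"
proof -
  have "frob_series i t $ N = (\<Sum>m=0..N. if N = 2 ^ i * m then frob i (t $ m) else 0)"
    unfolding frob_series_def fps_compose_nth power_mult[symmetric]
    by (intro sum.cong) auto
  also have "\<dots> = (if 2 ^ i dvd N then frob i (t $ (N div 2 ^ i)) else 0)"
  proof (cases "2 ^ i dvd N")
    case True
    then have "(N = 2 ^ i * m) = (N div 2 ^ i = m)" for m by auto
    then show ?thesis using True by simp
  next
    case False
    then show ?thesis by (auto intro!: sum.neutral)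
  qed
  finally show ?thesis .
qed

lemma frob_series_mult: "frob_series i (s * t) = frob_series i s * frob_series i t"
  unfolding frob_series_def frob_def fps_map_subst by (rule fps_compose_mult_distrib) simp

lemma frob_series_power: "frob_series i (t ^ n) = frob_series i t ^ n"
proof (induction n)
  case 0
  show ?case by (simp add: frob_series_def frob_def fps_map_subst)
qed (simp add: frob_series_mult)

lemma frob_series_log_sum:
  "frob_series i (log_sum f B t) = log_sum (\<lambda>n. frob i (f n)) B (frob_series i t)"
proof -
  have "frob_series i (sum g A) = (\<Sum>a\<in>A. frob_series i (g a))" for g and A :: "nat set"
    by (simp add: fps_eq_iff fps_sum_nth frob_series_nth frob_def substitute_sum)
  moreover have "frob_series i (fps_const c) = fps_const (frob i c)" for c
    by (simp add: frob_series_def frob_def fps_map_subst)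
  ultimately show ?thesis
    by (simp add: log_sum_def frob_series_mult frob_series_power)
qed

lemma frob_series_X: "frob_series i fps_X = fps_X ^ (2 ^ i)"
  by (simp add: frob_series_def frob_def fps_map_subst fps_X_power_compose)

section \<open>Integrality of the 2-series\<close>

definition integral_series :: "qv fps set" where
  "integral_series = {t. \<forall>n. t $ n \<in> BPs}"

lemma
  shows integral_series_mult: "s \<in> integral_series \<Longrightarrow> t \<in> integral_series \<Longrightarrow> s * t \<in> integral_series"
    and integral_series_add: "s \<in> integral_series \<Longrightarrow> t \<in> integral_series \<Longrightarrow> s + t \<in> integral_series"
    and integral_series_1: "1 \<in> integral_series"
    and integral_series_const: "c \<in> BPs \<Longrightarrow> fps_const c \<in> integral_series"
    and integral_series_frob: "t \<in> integral_series \<Longrightarrow> frob_series i t \<in> integral_series"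
  by (auto simp: integral_series_def fps_mult_nth frob_series_nth intro!: frob_BPs)

lemma integral_series_power: "t \<in> integral_series \<Longrightarrow> t ^ n \<in> integral_series"
  by (induction n) (auto intro: integral_series_1 integral_series_mult)

lemma integral_series_sum: "(\<And>a. a \<in> A \<Longrightarrow> f a \<in> integral_series) \<Longrightarrow> sum f A \<in> integral_series"
  by (auto simp: integral_series_def fps_sum_nth)

lemma integral_series_2: "2 ^ n \<in> integral_series"
  using integral_series_power[OF integral_series_add[OF integral_series_1 integral_series_1], of n]
  by simp

lemma Z2loc_half_diff_square: "(q::rat) \<in> Z2loc \<Longrightarrow> (q - q ^ 2) / 2 \<in> Z2loc"
proof -
  assume "q \<in> Z2loc"
  then obtain a b where ab: "odd b" "q = of_int a / of_int b" unfolding Z2loc_iff by blast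
  have "even (a * b - a ^ 2)" using ab(1) by auto
  then obtain c where c: "a * b - a ^ 2 = 2 * c" by blast
  have "b \<noteq> 0" using ab by auto
  then have "(q - q ^ 2) / 2 = of_int (a * b - a ^ 2) / (2 * of_int (b ^ 2))"
    unfolding ab(2) by (simp add: field_simps power2_eq_square)
  also have "\<dots> = of_int c / of_int (b ^ 2)" unfolding c by simp
  finally show ?thesis unfolding Z2loc_iff using ab(1) by (intro exI[of _ c] exI[of _ "b ^ 2"]) auto
qed

text \<open>
  On a monomial $c v^m$ the difference is $(c - c^2) v^{2m}$, and $c - c^2$ is even for 2-local integers; the
  cross terms of a sum are even.
\<close>

lemma frob_lift:
  assumes "p \<in> BPs"
  shows "\<exists>q\<in>BPs. frob 1 p - p ^ 2 = 2 * q"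
  using assms
proof (induction p rule: Z2polys_induct)
  case zero
  show ?case by (rule bexI[of _ 0]) (auto simp: frob_def)
next
  case (single m c)
  have mon: "monomial_value (\<lambda>j. var j ^ 2 ^ 1) m = monomial_value var m ^ 2"
    by (simp add: monomial_value_def prod_power_distrib power_mult[symmetric] mult.commute)
  have "monomial_value var m = Poly_Mapping.single m 1"
    by (rule monomial_value_var)
  then have "frob 1 (Poly_Mapping.single m c) = Poly_Mapping.single (m + m) c"
    unfolding frob_def substitute_single mon by (simp add: mult_single power2_eq_square)
  then have "frob 1 (Poly_Mapping.single m c) - Poly_Mapping.single m c ^ 2 =
      Poly_Mapping.single (m + m) (c - c ^ 2)"
    by (simp add: power2_eq_square mult_single single_diff)
  also have "\<dots> = 2 * Poly_Mapping.single (m + m) ((c - c ^ 2) / 2)"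
    unfolding mult_2 single_add[symmetric] by simp
  finally show ?case
    using Z2loc_half_diff_square[OF single(1)] single(2) Poly_Mapping.keys_add[of m m]
    by (intro bexI[of _ "Poly_Mapping.single (m + m) ((c - c ^ 2) / 2)"]) auto
next
  case (add p q)
  then obtain a b where ab: "a \<in> BPs" "frob 1 p - p ^ 2 = 2 * a" "b \<in> BPs" "frob 1 q - q ^ 2 = 2 * b"
    by blast
  have "frob 1 (p + q) - (p + q) ^ 2 = (frob 1 p - p ^ 2) + (frob 1 q - q ^ 2) - 2 * (p * q)"
    by (simp add: frob_def substitute_add power2_eq_square algebra_simps)
  also have "\<dots> = 2 * (a + b - p * q)" unfolding ab by (simp add: algebra_simps)
  finally show ?case using ab add by (intro bexI[of _ "a + b - p * q"]) auto
qed

lemma sum_symmetric: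
  fixes f :: "nat \<Rightarrow> 'a::comm_ring_1"
  assumes "\<And>i. i \<le> n \<Longrightarrow> f (n - i) = f i"
  shows "(\<Sum>i=0..n. f i) = 2 * (\<Sum>i\<in>{i. 2 * i < n}. f i) + (if even n then f (n div 2) else 0)"
proof -
  have fin: "finite {i. 2 * i < n}" by (rule finite_subset[of _ "{..n}"]) auto
  have "{0..n} = ({i. 2 * i < n} \<union> {i. i \<le> n \<and> n < 2 * i}) \<union> {i. 2 * i = n}" by auto
  then have "(\<Sum>i=0..n. f i) = sum f (({i. 2 * i < n} \<union> {i. i \<le> n \<and> n < 2 * i}) \<union> {i. 2 * i = n})"
    by simp
  also have "\<dots> = sum f {i. 2 * i < n} + sum f {i. i \<le> n \<and> n < 2 * i} + sum f {i. 2 * i = n}"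
    using fin by (subst sum.union_disjoint; (subst sum.union_disjoint)?)
      (auto intro: finite_subset[of _ "{..n}"])
  also have "sum f {i. i \<le> n \<and> n < 2 * i} = sum f {i. 2 * i < n}"
    by (rule sum.reindex_bij_witness[where i = "\<lambda>i. n - i" and j = "\<lambda>i. n - i"]) (use assms in auto)
  also have "sum f {i. 2 * i = n} = (if even n then f (n div 2) else 0)"
  proof (cases "even n")
    case True
    then have "{i. 2 * i = n} = {n div 2}" by auto
    then show ?thesis using True by simp
  next
    case False
    then have "{i. 2 * i = n} = {}" by auto
    then show ?thesis using False by simp
  qed
  finally show ?thesis by (simp only: mult_2)
qed

text \<open>
  In the square of a series, the two terms $t_a t_b$ and $t_b t_a$ of each degree combine, so that modulo 2 only
  the squares of the coefficients remain; on them the lift for polynomials applies.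
\<close>

lemma frob_series_lift_1:
  assumes "t \<in> integral_series"
  shows "\<exists>c\<in>integral_series. frob_series 1 t - t ^ 2 = 2 * c"
proof -
  have t: "t $ n \<in> BPs" for n using assms by (simp add: integral_series_def)
  have "\<exists>q\<in>BPs. (frob_series 1 t - t ^ 2) $ n = 2 * q" for n
  proof -
    define r where "r = (\<Sum>i\<in>{i. 2 * i < n}. t $ i * t $ (n - i))"
    have r: "r \<in> BPs" unfolding r_def using t by auto
    have sq: "(t ^ 2) $ n = 2 * r + (if even n then t $ (n div 2) * t $ (n - n div 2) else 0)"
      unfolding r_def power2_eq_square fps_mult_nth
      by (rule sum_symmetric) (auto simp: mult.commute)
    show ?thesis
    proof (cases "even n")
      case True
      obtain q where q: "q \<in> BPs" "frob 1 (t $ (n div 2)) - (t $ (n div 2)) ^ 2 = 2 * q"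
        using frob_lift[OF t] by blast
      define a b where "a = frob 1 (t $ (n div 2))" and "b = t $ (n div 2)"
      have "n - n div 2 = n div 2" using True by auto
      then have "(frob_series 1 t - t ^ 2) $ n = a - (2 * r + b * b)"
        unfolding fps_sub_nth sq using True by (simp add: frob_series_nth a_def b_def)
      also have "\<dots> = (a - b ^ 2) - 2 * r" by (simp add: power2_eq_square)
      also have "\<dots> = 2 * (q - r)"
        unfolding q(2)[folded a_def b_def] by (simp add: right_diff_distrib)
      finally show ?thesis using q r by (intro bexI[of _ "q - r"]) auto
    next
      case False
      then have "(frob_series 1 t - t ^ 2) $ n = 2 * (- r)"
        by (simp add: sq frob_series_nth)
      then show ?thesis using r by (intro bexI[of _ "- r"]) auto
    qed
  qed
  then obtain q where q: "\<And>n. q n \<in> BPs" "\<And>n. (frob_series 1 t - t ^ 2) $ n = 2 * q n" by metis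
  have "frob_series 1 t - t ^ 2 = 2 * Abs_fps q"
    using q(2) by (simp add: fps_eq_iff fps_two_times_nth)
  then show ?thesis using q(1) by (intro bexI[of _ "Abs_fps q"]) (auto simp: integral_series_def)
qed

text \<open>
  Each squaring gains one factor 2. This makes up for the denominator $2^n$ of the $n$-th coefficient of the
  logarithm and leaves one factor 2 to spare.
\<close>

lemma power_2_power_cong:
  assumes "a \<in> integral_series" "b \<in> integral_series" "c \<in> integral_series" "a - b = 2 * c"
  shows "\<exists>c'\<in>integral_series. a ^ 2 ^ n - b ^ 2 ^ n = 2 ^ Suc n * c'"
proof (induction n)
  case 0
  then show ?case using assms by auto
next
  case (Suc n)
  then obtain d where d: "d \<in> integral_series" "a ^ 2 ^ n - b ^ 2 ^ n = 2 ^ Suc n * d" by blast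
  define x y where "x = a ^ 2 ^ n" and "y = b ^ 2 ^ n"
  have x: "x = y + 2 ^ Suc n * d" using d(2) by (simp add: x_def y_def algebra_simps)
  have "a ^ 2 ^ Suc n - b ^ 2 ^ Suc n = x ^ 2 - y ^ 2"
    by (simp add: x_def y_def power_mult[symmetric] mult.commute)
  also have "\<dots> = 2 ^ Suc (Suc n) * (d * (y + 2 ^ n * d))"
    unfolding x by (simp add: power2_eq_square algebra_simps)
  finally show ?case
    using assms d(1) unfolding y_def
    by (intro bexI[of _ "d * (b ^ 2 ^ n + 2 ^ n * d)"]
        integral_series_mult integral_series_add integral_series_2 integral_series_power)
qed

lemma frob_series_lift:
  assumes "t \<in> integral_series"
  shows "\<exists>c\<in>integral_series. frob_series i t - t ^ 2 ^ i = 2 * c"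
proof (induction i)
  case 0
  have "frob_series 0 t = t" by (simp add: fps_eq_iff frob_series_nth)
  then show ?case using integral_series_const[of 0] by (intro bexI[of _ 0]) auto
next
  case (Suc i)
  then obtain c where c: "c \<in> integral_series" "frob_series i t - t ^ 2 ^ i = 2 * c" by blast
  obtain d where d: "d \<in> integral_series"
    "frob_series 1 (frob_series i t) - (frob_series i t) ^ 2 = 2 * d"
    using frob_series_lift_1[OF integral_series_frob[OF assms]] by blast
  have "frob_series (Suc i) t = frob_series 1 (frob_series i t)"
  proof (rule fps_ext)
    fix N
    show "frob_series (Suc i) t $ N = frob_series 1 (frob_series i t) $ N"
    proof (cases "even N")
      case True
      then obtain M where M: "N = 2 * M" by blast
      have "frob (Suc 0) 0 = 0" by (simp add: frob_def)
      then show ?thesis unfolding M by (simp add: frob_series_nth frob_frob)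
    next
      case False
      then have "\<not> 2 ^ Suc i dvd N" by (metis dvd_mult_left power_Suc)
      then show ?thesis using False by (simp add: frob_series_nth)
    qed
  qed
  moreover have "(frob_series i t) ^ 2 = t ^ 2 ^ Suc i + 2 * (2 * c * (t ^ 2 ^ i + c))"
  proof -
    have "frob_series i t = t ^ 2 ^ i + 2 * c" using c(2) by (simp add: algebra_simps)
    then have "(frob_series i t) ^ 2 = (t ^ 2 ^ i) ^ 2 + 2 * (2 * c * (t ^ 2 ^ i + c))"
      by (simp add: power2_eq_square algebra_simps)
    then show ?thesis by (simp add: power_mult[symmetric] mult.commute)
  qed
  ultimately have "frob_series (Suc i) t - t ^ 2 ^ Suc i = 2 * (d + 2 * c * (t ^ 2 ^ i + c))"
    using d(2) by (simp add: algebra_simps)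
  moreover have "d + 2 ^ 1 * c * (t ^ 2 ^ i + c) \<in> integral_series"
    by (intro integral_series_mult integral_series_add integral_series_2 integral_series_power assms c d)
  ultimately show ?case
    by (intro bexI[of _ "d + 2 * c * (t ^ 2 ^ i + c)"]) simp_all
qed

text \<open>
  The series $D_i$ of the introductory formula, with truncated logarithms.
\<close>

definition correction :: "nat \<Rightarrow> nat \<Rightarrow> qv fps \<Rightarrow> qv fps" where
  "correction i B t = fps_const (qconst (1/2)) *
     (log_sum (\<lambda>n. frob i (log_coeff vgen n)) B (frob_series i t) -
      log_sum (\<lambda>n. frob i (log_coeff vgen n)) B (t ^ 2 ^ i))"

lemma half_times_two: "fps_const (qconst (1/2)) * 2 = 1"
proof -
  have "qconst (1/2) * 2 = 1" using mult_single[of 0 "1/2::rat" 0 2] by simp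
  then have "fps_const (qconst (1/2)) * fps_const 2 = (1 :: qv fps)"
    by (simp only: fps_const_mult fps_const_1_eq_1)
  then show ?thesis by (simp only: numeral_fps_const)
qed

text \<open>
  The two arguments are congruent modulo 2, so their $2^n$-th powers are congruent modulo $2^{n+1}$. This
  cancels the denominator $2^n$ of the coefficient of the logarithm and the factor $\frac12$.
\<close>

lemma correction_integral:
  assumes "t \<in> integral_series"
  shows "correction i B t \<in> integral_series"
proof -
  obtain c where c: "c \<in> integral_series" "frob_series i t - t ^ 2 ^ i = 2 * c"
    using frob_series_lift[OF assms] by blast
  have "fps_const (qconst (1/2)) * (fps_const (frob i (log_coeff vgen n)) *
      (frob_series i t ^ 2 ^ n - (t ^ 2 ^ i) ^ 2 ^ n)) \<in> integral_series" for n
  proof -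
    obtain d where d: "d \<in> integral_series"
      "frob_series i t ^ 2 ^ n - (t ^ 2 ^ i) ^ 2 ^ n = 2 ^ Suc n * d"
      using power_2_power_cong[OF integral_series_frob[OF assms] integral_series_power[OF assms] c] by blast
    have "(2 :: qv fps) ^ n = fps_const (2 ^ n)"
      by (simp add: numeral_fps_const flip: fps_const_power)
    then have "fps_const (qconst (1/2)) * (fps_const (frob i (log_coeff vgen n)) * (2 ^ Suc n * d)) =
        (fps_const (qconst (1/2)) * 2) * (fps_const (2 ^ n * frob i (log_coeff vgen n)) * d)"
      by (simp add: mult_ac flip: fps_const_mult)
    also have "\<dots> = fps_const (frob i (2 ^ n * log_coeff vgen n)) * d"
    proof -
      have "substitute g (2 ^ n) = 2 ^ n" for g
        using substitute_power[of g 2 n] substitute_qconst[of g 2] by simp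
      then show ?thesis by (simp add: half_times_two frob_def substitute_mult)
    qed
    also have "\<dots> \<in> integral_series"
      by (intro integral_series_mult integral_series_const frob_BPs log_coeff_denominator d)
    finally show ?thesis unfolding d(2) .
  qed
  then show ?thesis
    unfolding correction_def log_sum_def sum_subtractf[symmetric] right_diff_distrib[symmetric]
      sum_distrib_left
    by (intro integral_series_sum)
qed

text \<open>
  Subtract the functional equation at $s$ from twice the functional equation at $x$. The term
  $2 \log^{(i)}(x^{2^i})$ is $\log^{(i)}((\sigma^i s)(x^{2^i}))$, the Frobenius lift of the equation
  $2 \log x = \log s$. Since $i \ge 1$, coefficient \<open>N\<close> of each correction involves only coefficients of $s$
  below \<open>N\<close>, so that \<open>s\<close> may be replaced by any series \<open>t\<close> that agrees with it so far.
\<close>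

lemma two_series_nth_correction:
  assumes N: "N \<ge> 1" and t0: "t $ 0 = 0" and t: "\<And>m. m < N \<Longrightarrow> t $ m = two_series vgen $ m"
  shows "two_series vgen $ N = 2 * fps_X $ N + (\<Sum>i=1..N. var i * correction i (N - i) t $ N)"
proof -
  define s where "s = two_series vgen"
  let ?l = "log_coeff vgen" and ?c = "qconst (1/2)"
  let ?G = "\<lambda>i. log_sum (\<lambda>n. frob i (?l n)) (N - i)"
  have s0: "s $ 0 = 0" by (simp add: s_def two_series)
  have c2: "2 * ?c = 1" using mult_single[of 0 2 0 "1/2::rat"] by simp
  have N2: "N < 2 ^ Suc N" using less_exp[of "Suc N"] by simp
  \<comment> \<open>The Frobenius lift of $2 \log x = \log s$, read off in degree $N / 2^i < N$.\<close>
  have X: "2 * ?G i (fps_X ^ 2 ^ i) $ N = ?G i (frob_series i t) $ N" if i: "i \<in> {1..N}" for i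
  proof (cases "2 ^ i dvd N")
    case False
    then show ?thesis
      by (simp add: frob_series_X[symmetric] frob_series_log_sum[symmetric] frob_series_nth)
  next
    case True
    define M where "M = N div 2 ^ i"
    have MN: "N = 2 ^ i * M" using True by (simp add: M_def)
    have "(1::nat) < 2 ^ i" using i by (intro one_less_power) auto
    then have "M < N" unfolding MN using MN N by (intro n_less_m_mult_n) (auto intro!: Nat.gr0I)
    have "2 ^ i * M < 2 ^ i * 2 ^ Suc (N - i)"
      unfolding MN[symmetric] power_add[symmetric] using N2 i by simp
    then have M2: "M < 2 ^ Suc (N - i)" by simp
    have "log_sum ?l (N - i) t $ M = log_sum ?l (N - i) s $ M"
      unfolding log_sum_def fps_sum_nth fps_mult_left_const_nth
      by (intro sum.cong refl arg_cong2[where f = "(*)"] fps_power_nth_cong_less[of N])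
        (use t \<open>M < N\<close> in \<open>auto simp: s_def\<close>)
    also have "\<dots> = 2 * log_sum ?l (N - i) fps_X $ M"
      unfolding s_def by (rule two_series_log_sum[OF M2])
    finally have "frob i (log_sum ?l (N - i) t $ M) = 2 * frob i (log_sum ?l (N - i) fps_X $ M)"
      by (simp add: frob_def substitute_two_times)
    then show ?thesis
      using True by (simp add: frob_series_X[symmetric] frob_series_log_sum[symmetric] frob_series_nth M_def)
  qed
  \<comment> \<open>All exponents are at least 2, so that coefficient \<open>N\<close> of \<open>s\<close> does not occur.\<close>
  have pow: "?G i (s ^ 2 ^ i) $ N = ?G i (t ^ 2 ^ i) $ N" if i: "i \<in> {1..N}" for i
  proof -
    have "((s ^ 2 ^ i) ^ 2 ^ n) $ N = ((t ^ 2 ^ i) ^ 2 ^ n) $ N" for n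
    proof -
      have "(2::nat) ^ 1 \<le> 2 ^ (i + n)" using i by (intro power_increasing) auto
      then have "(s ^ 2 ^ (i + n)) $ N = (t ^ 2 ^ (i + n)) $ N"
        using s0 t0 t by (intro fps_power_nth_cong) (auto simp: s_def)
      then show ?thesis by (simp add: power_mult[symmetric] power_add)
    qed
    then show ?thesis by (simp add: log_sum_def fps_sum_nth)
  qed
  have "s $ N + (\<Sum>i=1..N. ?c * var i * ?G i (s ^ 2 ^ i) $ N) = log_sum ?l N s $ N"
    by (subst log_sum_twisted) (simp add: fps_sum_nth)
  also have "\<dots> = 2 * log_sum ?l N fps_X $ N"
    unfolding s_def by (rule two_series_log_sum[OF N2])
  also have "\<dots> = 2 * fps_X $ N + (\<Sum>i=1..N. ?c * var i * (2 * ?G i (fps_X ^ 2 ^ i) $ N))"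
    by (subst log_sum_twisted) (simp add: fps_sum_nth distrib_left sum_distrib_left mult_ac)
  finally have "s $ N = 2 * fps_X $ N + ((\<Sum>i=1..N. ?c * var i * (2 * ?G i (fps_X ^ 2 ^ i) $ N)) -
      (\<Sum>i=1..N. ?c * var i * ?G i (s ^ 2 ^ i) $ N))"
    by (simp add: algebra_simps)
  also have "(\<Sum>i=1..N. ?c * var i * (2 * ?G i (fps_X ^ 2 ^ i) $ N)) -
      (\<Sum>i=1..N. ?c * var i * ?G i (s ^ 2 ^ i) $ N) = (\<Sum>i=1..N. var i * correction i (N - i) t $ N)"
    unfolding sum_subtractf[symmetric] using X pow
    by (intro sum.cong refl) (simp add: correction_def algebra_simps)
  finally show ?thesis by (simp add: s_def)
qed

text \<open>
  Induction on the degree: the part of the series below \<open>N\<close> is integral, hence so are its corrections, hence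
  so is coefficient \<open>N\<close>.
\<close>

lemma two_series_integral: "two_series vgen \<in> integral_series"
proof -
  have "two_series vgen $ N \<in> BPs" for N
  proof (induction N rule: less_induct)
    case (less N)
    show ?case
    proof (cases "N = 0")
      case True
      then show ?thesis by (simp add: two_series)
    next
      case False
      \<comment> \<open>Only the coefficients below \<open>N\<close> are known to be integral at this point.\<close>
      define t where "t = fps_cutoff N (two_series vgen)"
      have "t \<in> integral_series" using less by (simp add: t_def integral_series_def)
      then have "correction i B t $ n \<in> BPs" for i B n
        using correction_integral by (auto simp: integral_series_def)
      moreover have "two_series vgen $ N = 2 * fps_X $ N + (\<Sum>i=1..N. var i * correction i (N - i) t $ N)"
        by (rule two_series_nth_correction) (use False in \<open>auto simp: t_def two_series\<close>)
      moreover have "fps_X $ N \<in> BPs" by (simp add: fps_X_def)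
      ultimately show ?thesis
        by (auto intro!: Z2polys_sum Z2polys_mult Z2polys_add Z2polys_var)
    qed
  qed
  then show ?thesis by (simp add: integral_series_def)
qed

section \<open>The 2-series modulo the square of the ideal of the generators\<close>

abbreviation augment :: "qv \<Rightarrow> qv" where
  "augment \<equiv> substitute (\<lambda>_. 0)"

lemma augment_eq: "augment p = qconst (Poly_Mapping.lookup p 0)"
proof -
  have "monomial_value (\<lambda>_. 0) m = (if m = 0 then 1 else 0)" for m
  proof (cases "m = 0")
    case False
    then obtain i where "i \<in> Poly_Mapping.keys m" by fastforce
    then show ?thesis using False
      unfolding monomial_value_def by (auto intro!: prod_zero bexI[of _ i] simp: in_keys_iff)
  qed simp
  then have "augment p = (\<Sum>m\<in>Poly_Mapping.keys p. if m = 0 then qconst (Poly_Mapping.lookup p m) else 0)"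
    unfolding substitute_def by (intro sum.cong) auto
  then show ?thesis by (auto simp: in_keys_iff)
qed

lemma augment_frob: "augment (frob i p) = augment p"
  by (simp add: frob_def substitute_substitute substitute_power power_0_left)

lemma augment_log_coeff: "augment (log_coeff vgen n) = (if n = 0 then 1 else 0)"
proof (cases "n = 0")
  case False
  then show ?thesis
    by (simp add: log_coeff_vgen substitute_mult substitute_sum substitute_power power_0_left)
qed simp

text \<open>
  All higher coefficients of the logarithm lie in the kernel of the augmentation, which turns the formal group
  law into the additive one.
\<close>

lemma augment_log_sum: "fps_map augment (log_sum (\<lambda>n. frob i (log_coeff vgen n)) B t) = fps_map augment t"
proof (rule fps_ext)
  fix N
  have "fps_map augment (log_sum (\<lambda>n. frob i (log_coeff vgen n)) B t) $ N =
      (\<Sum>n\<le>B. if n = 0 then augment (t $ N) else 0)"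
    unfolding fps_map_nth log_sum_def fps_sum_nth substitute_sum
    by (intro sum.cong) (auto simp: substitute_mult augment_frob augment_log_coeff)
  then show "fps_map augment (log_sum (\<lambda>n. frob i (log_coeff vgen n)) B t) $ N = fps_map augment t $ N"
    by simp
qed

lemma augment_correction:
  assumes "fps_map augment t = 2 * fps_X" "i \<ge> 1"
  shows "augment (correction i B t $ N) = qconst (1 - 2 ^ (2 ^ i - 1)) * (fps_X ^ 2 ^ i) $ N"
proof -
  have F: "fps_map augment (frob_series i t) = 2 * fps_X ^ 2 ^ i"
  proof (rule fps_ext)
    fix n
    have "augment (t $ m) = 2 * fps_X $ m" for m
      by (metis assms(1) fps_map_nth fps_two_times_nth)
    moreover have "(n div 2 ^ i = Suc 0 \<and> 2 ^ i dvd n) = (n = 2 ^ i)" by auto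
    ultimately show "fps_map augment (frob_series i t) $ n = (2 * fps_X ^ 2 ^ i) $ n"
      by (auto simp: frob_series_nth augment_frob fps_two_times_nth)
  qed
  have P: "fps_map augment (t ^ 2 ^ i) = 2 ^ 2 ^ i * fps_X ^ 2 ^ i"
    unfolding fps_map_subst_power assms(1) power_mult_distrib ..
  obtain e where e: "(2::nat) ^ i = Suc e" by (metis nat_power_eq_Suc_0_iff not0_implies_Suc power_not_zero zero_neq_numeral)
  have "fps_map augment (correction i B t) =
      fps_const (qconst (1/2)) * (2 * fps_X ^ 2 ^ i - 2 ^ 2 ^ i * fps_X ^ 2 ^ i)"
    unfolding correction_def fps_map_subst augment_log_sum F P by simp
  also have "\<dots> = (fps_const (qconst (1/2)) * 2) * ((1 - 2 ^ e) * fps_X ^ 2 ^ i)"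
    unfolding e by (simp add: algebra_simps)
  also have "\<dots> = (1 - 2 ^ e) * fps_X ^ 2 ^ i"
    unfolding half_times_two by simp
  also have "(1 - 2 ^ e :: qv fps) = fps_const (qconst (1 - 2 ^ e))"
  proof -
    have "(2::qv) ^ e = qconst (2 ^ e)" by (induction e) (simp_all add: mult_single flip: single_numeral)
    then have "fps_const (1 - 2 ^ e) = fps_const (qconst (1 - 2 ^ e))"
      by (simp add: single_diff)
    moreover have "(1 - 2 ^ e :: qv fps) = fps_const (1 - 2 ^ e)"
      by (simp only: fps_const_1_eq_1[symmetric] numeral_fps_const fps_const_power fps_const_sub)
    ultimately show ?thesis by simp
  qed
  finally have "fps_map augment (correction i B t) = fps_const (qconst (1 - 2 ^ e)) * fps_X ^ 2 ^ i" .
  then show ?thesis using fps_map_nth[of augment "correction i B t" N] e by simp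
qed

lemma augment_two_series: "fps_map augment (two_series vgen) = 2 * fps_X"
proof (rule fps_ext)
  fix N
  have N2: "N < 2 ^ Suc N" using less_exp[of "Suc N"] by simp
  have l: "augment (log_sum (log_coeff vgen) N t $ N) = augment (t $ N)" for t
  proof -
    have "fps_map augment (log_sum (log_coeff vgen) N t) $ N = fps_map augment t $ N"
      by (simp only: augment_log_sum[of 0 N t, unfolded frob_0])
    then show ?thesis by (simp only: fps_map_nth)
  qed
  have "augment (two_series vgen $ N) = augment (2 * log_sum (log_coeff vgen) N fps_X $ N)"
    using two_series_log_sum[OF N2, of vgen] l[of "two_series vgen"] by simp
  also have "\<dots> = 2 * augment (fps_X $ N)" by (simp add: substitute_two_times l)
  finally show "fps_map augment (two_series vgen) $ N = (2 * fps_X) $ N"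
    by (simp add: fps_two_times_nth fps_X_def)
qed

text \<open>
  The correction $D_i$ and $x^{2^i}$ have the same image under the augmentation up to a multiple of 2, so their
  difference has coefficients in the ideal and $v_i$ times it in the square.
  The sum has at most one term, which is present if \<open>Suc j\<close> is a power of 2.
\<close>

lemma two_coeff_vgen:
  "two_coeff vgen j \<in> BPs"
  "two_coeff vgen j - (\<Sum>i\<in>{i. i \<le> Suc j \<and> Suc j = 2 ^ i}. vgen i) \<in> v_square {0<..}"
proof -
  define s where "s = two_series vgen"
  define N where "N = Suc j"
  show int: "two_coeff vgen j \<in> BPs"
    using two_series_integral by (simp add: two_coeff_def integral_series_def)
  have eq: "s $ N = 2 * fps_X $ N + (\<Sum>i=1..N. var i * correction i (N - i) s $ N)"
    unfolding s_def by (rule two_series_nth_correction) (auto simp: N_def two_series)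
  define d where "d = (\<lambda>i. correction i (N - i) s $ N - (fps_X ^ 2 ^ i) $ N)"
  have d: "d i \<in> v_ideal {0<..}" if i: "i \<in> {1..N}" for i
  proof (rule in_v_ideal_if_const)
    have "correction i (N - i) s \<in> integral_series"
      unfolding s_def by (intro correction_integral two_series_integral)
    then show "d i \<in> BPs" by (auto simp: d_def integral_series_def)
    have X: "augment ((fps_X ^ 2 ^ i) $ N) = (fps_X ^ 2 ^ i) $ N" by simp
    have "augment (d i) = (qconst (1 - 2 ^ (2 ^ i - 1)) - 1) * (fps_X ^ 2 ^ i) $ N"
      unfolding d_def substitute_diff X using i augment_correction[OF augment_two_series, of i]
      by (simp add: s_def algebra_simps)
    also have "\<dots> = (if N = 2 ^ i then qconst (- (2 ^ (2 ^ i - 1))) else 0)"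
      by (simp add: single_diff single_uminus)
    finally have l: "Poly_Mapping.lookup (d i) 0 = (if N = 2 ^ i then - (2 ^ (2 ^ i - 1)) else 0)"
      unfolding augment_eq by (metis lookup_single_eq lookup_zero)
    have "(2::nat) ^ 1 \<le> 2 ^ i" using i by (intro power_increasing) auto
    \<comment> \<open>Since $i \ge 1$, the exponent is positive and the constant coefficient even.\<close>
    then obtain e where "(2::nat) ^ i - 1 = Suc e" by (cases "(2::nat) ^ i - 1") auto
    moreover have "- (2 ^ e) \<in> Z2loc" using Z2loc_of_int[of "- (2 ^ e)"] by simp
    ultimately show "Poly_Mapping.lookup (d i) 0 / 2 \<in> Z2loc" unfolding l by simp
  qed simp
  have "s $ N - (\<Sum>i=0..N. vgen i * (fps_X ^ 2 ^ i) $ N) = (\<Sum>i=1..N. var i * d i)"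
  proof -
    have "{0..N} = insert 0 {1..N}" by auto
    then have "(\<Sum>i=0..N. vgen i * (fps_X ^ 2 ^ i) $ N) = 2 * fps_X $ N + (\<Sum>i=1..N. vgen i * (fps_X ^ 2 ^ i) $ N)"
      by (simp add: vgen_def del: fps_X_power_nth)
    also have "(\<Sum>i=1..N. vgen i * (fps_X ^ 2 ^ i) $ N) = (\<Sum>i=1..N. var i * (fps_X ^ 2 ^ i) $ N)"
      by (intro sum.cong) (auto simp: vgen_def)
    finally show ?thesis
      unfolding eq d_def by (simp add: right_diff_distrib sum_subtractf)
  qed
  also have "\<dots> \<in> v_square {0<..}"
  proof (intro Z2_ideal_sum[OF ideal_v_square] v_square_prod d)
    fix i assume "i \<in> {1..N}"
    then show "var i \<in> v_ideal {0<..}" using vgen_in_v_ideal[of i "{0<..}"] by (auto simp: vgen_def)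
  qed
  also have "(\<Sum>i=0..N. vgen i * (fps_X ^ 2 ^ i) $ N) = (\<Sum>i\<in>{i. i \<le> Suc j \<and> Suc j = 2 ^ i}. vgen i)"
  proof -
    have "(\<Sum>i=0..N. vgen i * (fps_X ^ 2 ^ i) $ N) = (\<Sum>i=0..N. if N = 2 ^ i then vgen i else 0)"
      by (intro sum.cong) auto
    also have "\<dots> = sum vgen {i \<in> {0..N}. N = 2 ^ i}" by (rule sum.inter_filter[symmetric]) simp
    also have "{i \<in> {0..N}. N = 2 ^ i} = {i. i \<le> Suc j \<and> Suc j = 2 ^ i}" by (auto simp: N_def)
    finally show ?thesis .
  qed
  finally show "two_coeff vgen j - (\<Sum>i\<in>{i. i \<le> Suc j \<and> Suc j = 2 ^ i}. vgen i) \<in> v_square {0<..}"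
    by (simp add: two_coeff_def s_def N_def)
qed

lemma two_coeff_BPk:
  assumes h: "hazewinkel_in_generators h"
  shows "BP_to_BPk k (two_coeff h j) \<in> Z2polys {1..k}"
    and "BP_to_BPk k (two_coeff h j) - (\<Sum>i\<in>{i. i \<le> k \<and> Suc j = 2 ^ i}. vgen i) \<in> v_square {1..k}"
proof -
  have "{1..} = {0::nat<..}" "insert 0 {0<..} = (UNIV :: nat set)" by auto
  then have hn: "h n \<in> BPs" "h n - vgen n \<in> v_square {0<..}" if "n \<ge> 1" for n
    using h that unfolding hazewinkel_in_generators_def BP_def v_square_def v_ideal_def by auto
  let ?r = "\<lambda>i. if i \<in> {1..k} then var i else 0 :: qv"
  note \<rho> = BP_to_BPk_eq_subst[of k]
  have \<rho>_carr: "BP_to_BPk k p \<in> Z2polys {1..k}" if "p \<in> BPs" for p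
    unfolding \<rho> using that by (rule substitute_Z2polys) (auto intro: Z2polys_var)
  have num: "substitute g 2 = 2" for g using substitute_qconst[of g 2] by simp
  have \<rho>v: "BP_to_BPk k (vgen i) = (if i \<le> k then vgen i else 0)" for i
    by (auto simp: \<rho> vgen_def num)
  have \<rho>_sq: "BP_to_BPk k p \<in> v_square {1..k}" if "p \<in> v_square {0<..}" for p
  proof (rule v_square_image[OF _ _ _ _ that])
    fix i show "BP_to_BPk k (vgen i) \<in> v_ideal {1..k}"
    proof (cases "i \<le> k")
      case True
      then have "i \<in> insert 0 {1..k}" by auto
      from vgen_in_v_ideal[OF this] show ?thesis using True by (simp add: \<rho>v)
    qed (simp add: \<rho>v Z2_ideal_zero[OF ideal_v_ideal])
  qed (use \<rho>_carr in \<open>auto simp: \<rho> substitute_add substitute_mult\<close>)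
  let ?\<phi> = "substitute h"
  have \<phi>_carr: "?\<phi> p \<in> BPs" if "p \<in> BPs" for p
    using that by (rule substitute_Z2polys) (auto intro: hn)
  have \<phi>v: "?\<phi> (vgen i) - vgen i \<in> v_square {0<..}" for i
    using hn[of i] Z2_ideal_zero[OF ideal_v_square] by (auto simp: vgen_def num)
  have \<phi>_sq: "?\<phi> p \<in> v_square {0<..}" if "p \<in> v_square {0<..}" for p
  proof (rule v_square_image[OF _ _ _ _ that])
    fix i :: nat
    have "vgen i + (?\<phi> (vgen i) - vgen i) \<in> v_ideal {0<..}"
      by (intro Z2_ideal_add[OF ideal_v_ideal] vgen_in_v_ideal subsetD[OF v_square_subset_v_ideal] \<phi>v)
        auto
    then show "?\<phi> (vgen i) \<in> v_ideal {0<..}" by simp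
  qed (auto simp: substitute_add substitute_mult \<phi>_carr)
  define W where "W = {i. i \<le> Suc j \<and> Suc j = 2 ^ i}"
  have two: "two_coeff h j = ?\<phi> (two_coeff vgen j)"
    by (simp add: two_coeff_def two_series_subst[of h])
  show "BP_to_BPk k (two_coeff h j) \<in> Z2polys {1..k}"
    unfolding two by (intro \<rho>_carr \<phi>_carr two_coeff_vgen)
  have "?\<phi> (two_coeff vgen j - sum vgen W) + (\<Sum>i\<in>W. ?\<phi> (vgen i) - vgen i) \<in> v_square {0<..}"
    unfolding W_def
    by (intro Z2_ideal_add[OF ideal_v_square] \<phi>_sq two_coeff_vgen Z2_ideal_sum[OF ideal_v_square] \<phi>v)
  also have "?\<phi> (two_coeff vgen j - sum vgen W) + (\<Sum>i\<in>W. ?\<phi> (vgen i) - vgen i) =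
      two_coeff h j - sum vgen W"
    by (simp add: substitute_diff substitute_sum sum_subtractf two)
  finally have "BP_to_BPk k (two_coeff h j - sum vgen W) \<in> v_square {1..k}" by (rule \<rho>_sq)
  also have "BP_to_BPk k (two_coeff h j - sum vgen W) =
      BP_to_BPk k (two_coeff h j) - (\<Sum>i\<in>W. BP_to_BPk k (vgen i))"
    unfolding \<rho> by (simp add: substitute_diff substitute_sum)
  also have "(\<Sum>i\<in>W. BP_to_BPk k (vgen i)) = (\<Sum>i\<in>{i. i \<le> k \<and> Suc j = 2 ^ i}. vgen i)"
  proof -
    have "finite W" by (simp add: W_def)
    moreover have "i \<le> Suc j" if "Suc j = 2 ^ i" for i
      using less_exp[of i] that by simp
    then have "{i \<in> W. i \<le> k} = {i. i \<le> k \<and> Suc j = 2 ^ i}" by (auto simp: W_def)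
    ultimately show ?thesis unfolding \<rho>v by (simp add: sum.inter_filter[symmetric])
  qed
  finally show "BP_to_BPk k (two_coeff h j) - (\<Sum>i\<in>{i. i \<le> k \<and> Suc j = 2 ^ i}. vgen i) \<in> v_square {1..k}" .
qed

unbundle no fps_syntax

section \<open>Free modules, spans and quotient modules\<close>

lemma free_module_module:
  fixes R (structure)
  assumes "cring R"
  shows "module R (free_module R X)"
proof -
  interpret cring R by fact
  let ?F = "free_module R X"
  have fin: "finite {x. f x \<oplus> g x \<noteq> \<zero>}" "{x. f x \<oplus> g x \<noteq> \<zero>} \<subseteq> X"
    if "f \<in> carrier ?F" "g \<in> carrier ?F" for f g
  proof -
    have "{x. f x \<oplus> g x \<noteq> \<zero>} \<subseteq> {x. f x \<noteq> \<zero>} \<union> {x. g x \<noteq> \<zero>}" by auto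
    then show "finite {x. f x \<oplus> g x \<noteq> \<zero>}" "{x. f x \<oplus> g x \<noteq> \<zero>} \<subseteq> X"
      using that by (auto simp: free_module_def intro: finite_subset)
  qed
  show ?thesis
  proof (rule moduleI)
    show "abelian_group ?F"
    proof (rule abelian_groupI)
      fix f assume f: "f \<in> carrier ?F"
      have "\<ominus> f x = \<zero> \<longleftrightarrow> f x = \<zero>" for x
        using f by (auto simp: free_module_def)
      then have "(\<lambda>x. \<ominus> f x) \<in> carrier ?F" using f by (simp add: free_module_def)
      then show "\<exists>g\<in>carrier ?F. g \<oplus>\<^bsub>?F\<^esub> f = \<zero>\<^bsub>?F\<^esub>"
        using f by (intro bexI[of _ "\<lambda>x. \<ominus> f x"]) (auto simp: free_module_def l_neg)
    next
      fix f g assume fg: "f \<in> carrier ?F" "g \<in> carrier ?F"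
      then show "f \<oplus>\<^bsub>?F\<^esub> g \<in> carrier ?F" using fin[OF fg] by (simp add: free_module_def)
    qed (auto simp: free_module_def a_assoc a_comm a_lcomm)
  next
    fix a f assume a: "a \<in> carrier R" and f: "f \<in> carrier ?F"
    have "{x. a \<otimes> f x \<noteq> \<zero>} \<subseteq> {x. f x \<noteq> \<zero>}" using a by auto
    then show "a \<odot>\<^bsub>?F\<^esub> f \<in> carrier ?F"
      using a f by (auto simp: free_module_def intro: finite_subset)
  qed (auto simp: free_module_def cring_axioms l_distr r_distr m_assoc)
qed

lemma basis_elt_carrier:
  assumes "cring R" "x \<in> X"
  shows "basis_elt R x \<in> carrier (free_module R X)"
proof -
  interpret cring R by fact
  have "{y. basis_elt R x y \<noteq> \<zero>\<^bsub>R\<^esub>} \<subseteq> {x}" by (auto simp: basis_elt_def)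
  then show ?thesis
    using assms(2) finite_subset[of _ "{x}"] by (auto simp: free_module_def basis_elt_def)
qed

lemma
  assumes "module R M" "S \<subseteq> carrier M"
  shows submodule_submodule_span: "submodule (submodule_span R M S) R M"
    and submodule_span_superset: "S \<subseteq> submodule_span R M S"
proof -
  interpret module R M by fact
  show "S \<subseteq> submodule_span R M S" by (auto simp: submodule_span_def)
  note E = submoduleE
  show "submodule (submodule_span R M S) R M"
  proof (rule submoduleI)
    show "submodule_span R M S \<subseteq> carrier M"
      using carrier_is_submodule assms(2) by (auto simp: submodule_span_def)
    have "\<zero>\<^bsub>M\<^esub> \<in> N" if "submodule N R M" for N
      using subgroup.one_closed[OF submodule.axioms(1)[OF that]] by simp
    then show "\<zero>\<^bsub>M\<^esub> \<in> submodule_span R M S" by (auto simp: submodule_span_def)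
  qed (use E in \<open>auto simp: submodule_span_def\<close>)
qed

locale module_quotient = module R M for R :: "('a, 'b) ring_scheme" and M :: "('a, 'm, 'd) module_scheme" +
  fixes N :: "'m set"
  assumes sub: "submodule N R M"
begin

abbreviation "Q \<equiv> quotient_module M N"

lemma abelian_subgroup: "abelian_subgroup N M"
  by (rule abelian_subgroupI3) (use submodule.axioms(1)[OF sub] in \<open>auto intro: additive_subgroup.intro abelian_group_axioms\<close>)

lemma carrier_quotient: "carrier Q = (\<lambda>x. N +>\<^bsub>M\<^esub> x) ` carrier M"
  by (auto simp: quotient_module_def A_RCOSETS_def' a_r_coset_def)

lemma coset_carrier: "x \<in> carrier M \<Longrightarrow> N +>\<^bsub>M\<^esub> x \<in> carrier Q"
  by (auto simp: carrier_quotient)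

lemma coset_add:
  assumes "x \<in> carrier M" "y \<in> carrier M"
  shows "N +>\<^bsub>M\<^esub> (x \<oplus>\<^bsub>M\<^esub> y) = (N +>\<^bsub>M\<^esub> x) \<oplus>\<^bsub>Q\<^esub> (N +>\<^bsub>M\<^esub> y)"
  using abelian_subgroup.a_rcos_sum[OF abelian_subgroup assms] by (simp add: quotient_module_def)

lemma coset_zero: "N +>\<^bsub>M\<^esub> \<zero>\<^bsub>M\<^esub> = \<zero>\<^bsub>Q\<^esub>"
  using M.a_coset_add_zero[OF submoduleE(1)[OF sub]] by (simp add: quotient_module_def)

lemma abelian_group_quotient: "abelian_group Q"
proof (rule abelian_groupI)
  show "\<zero>\<^bsub>Q\<^esub> \<in> carrier Q" using coset_carrier[OF M.zero_closed] by (simp add: coset_zero)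
next
  fix X assume "X \<in> carrier Q"
  then obtain x where x: "x \<in> carrier M" "X = N +>\<^bsub>M\<^esub> x" by (auto simp: carrier_quotient)
  then show "\<zero>\<^bsub>Q\<^esub> \<oplus>\<^bsub>Q\<^esub> X = X" by (simp add: coset_zero[symmetric] coset_add[symmetric])
  show "\<exists>Y\<in>carrier Q. Y \<oplus>\<^bsub>Q\<^esub> X = \<zero>\<^bsub>Q\<^esub>"
    using x by (intro bexI[of _ "N +>\<^bsub>M\<^esub> (\<ominus>\<^bsub>M\<^esub> x)"])
      (simp_all add: coset_zero[symmetric] coset_add[symmetric] coset_carrier M.l_neg)
qed (auto simp: carrier_quotient coset_add[symmetric] M.a_assoc M.a_comm M.a_lcomm)

lemma coset_smult:
  assumes r: "r \<in> carrier R" and x: "x \<in> carrier M"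
  shows "N +>\<^bsub>M\<^esub> (r \<odot>\<^bsub>M\<^esub> x) = r \<odot>\<^bsub>Q\<^esub> (N +>\<^bsub>M\<^esub> x)"
proof -
  interpret A: abelian_subgroup N M by (rule abelian_subgroup)
  have NM: "N \<subseteq> carrier M" by (rule A.a_subset)
  have "N +>\<^bsub>M\<^esub> (r \<odot>\<^bsub>M\<^esub> y) = N +>\<^bsub>M\<^esub> (r \<odot>\<^bsub>M\<^esub> x)" if "y \<in> N +>\<^bsub>M\<^esub> x" for y
  proof -
    obtain n where n: "n \<in> N" "y = n \<oplus>\<^bsub>M\<^esub> x" using \<open>y \<in> N +>\<^bsub>M\<^esub> x\<close> by (auto simp: a_r_coset_def')
    have "r \<odot>\<^bsub>M\<^esub> y = r \<odot>\<^bsub>M\<^esub> n \<oplus>\<^bsub>M\<^esub> r \<odot>\<^bsub>M\<^esub> x"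
      unfolding n(2) using r x n(1) NM by (intro smult_r_distr) auto
    moreover have "r \<odot>\<^bsub>M\<^esub> n \<in> N" using submoduleE(4)[OF sub r n(1)] .
    ultimately have "r \<odot>\<^bsub>M\<^esub> y \<in> N +>\<^bsub>M\<^esub> (r \<odot>\<^bsub>M\<^esub> x)" by (auto simp: a_r_coset_def')
    then show ?thesis
      using A.a_repr_independence'[of "r \<odot>\<^bsub>M\<^esub> y" "r \<odot>\<^bsub>M\<^esub> x"] r x by simp
  qed
  moreover have "x \<in> N +>\<^bsub>M\<^esub> x" using A.a_rcos_self[OF x] .
  ultimately have "(\<Union>a\<in>N +>\<^bsub>M\<^esub> x. N +>\<^bsub>M\<^esub> (r \<odot>\<^bsub>M\<^esub> a)) = N +>\<^bsub>M\<^esub> (r \<odot>\<^bsub>M\<^esub> x)" by blast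
  then show ?thesis by (simp add: quotient_module_def)
qed

lemma module_quotient: "module R Q"
proof (rule moduleI)
  show "cring R" by (rule R.cring_axioms)
  show "abelian_group Q" by (rule abelian_group_quotient)
qed (auto simp: carrier_quotient coset_smult[symmetric] coset_add[symmetric] smult_l_distr smult_r_distr smult_assoc1)

lemma coset_hom: "abelian_group_hom M Q (\<lambda>x. N +>\<^bsub>M\<^esub> x)"
proof (rule abelian_group_homI)
  show "group_hom (add_monoid M) (add_monoid Q) (\<lambda>x. N +>\<^bsub>M\<^esub> x)"
    using abelian_group.a_group[OF abelian_group_quotient] M.a_group
    by (intro group_hom.intro group_hom_axioms.intro homI)
      (auto simp: coset_carrier coset_add)
qed (auto intro: abelian_group_quotient M.abelian_group_axioms)

lemma coset_mem: "x \<in> N \<Longrightarrow> N +>\<^bsub>M\<^esub> x = \<zero>\<^bsub>Q\<^esub>"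
  using M.a_coset_join2[of x N] submodule.axioms(1)[OF sub] submoduleE(1)[OF sub]
  by (auto simp: quotient_module_def)

lemma coset_minus:
  assumes "x \<in> carrier M" "y \<in> carrier M"
  shows "N +>\<^bsub>M\<^esub> (x \<ominus>\<^bsub>M\<^esub> y) = (N +>\<^bsub>M\<^esub> x) \<ominus>\<^bsub>Q\<^esub> (N +>\<^bsub>M\<^esub> y)"
proof -
  interpret H: abelian_group_hom M Q "\<lambda>x. N +>\<^bsub>M\<^esub> x" by (rule coset_hom)
  show ?thesis using assms by (simp add: a_minus_def)
qed

lemma coset_finsum:
  assumes "finite A" "g \<in> A \<rightarrow> carrier M"
  shows "N +>\<^bsub>M\<^esub> finsum M g A = finsum Q (\<lambda>a. N +>\<^bsub>M\<^esub> g a) A"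
proof -
  interpret Q: abelian_group Q by (rule abelian_group_quotient)
  interpret H: abelian_group_hom M Q "\<lambda>x. N +>\<^bsub>M\<^esub> x" by (rule coset_hom)
  show ?thesis using assms
  proof (induction A)
    case (insert a A)
    then have "(\<lambda>a. N +>\<^bsub>M\<^esub> g a) \<in> insert a A \<rightarrow> carrier Q" by (auto simp: coset_carrier Pi_iff)
    then show ?case using insert by (simp add: Pi_iff)
  qed simp
qed

end

lemma
  shows zero_free_module: "\<zero>\<^bsub>free_module (Z2_poly_ring S) X\<^esub> = 0"
    and add_free_module: "f \<oplus>\<^bsub>free_module (Z2_poly_ring S) X\<^esub> g = f + g"
    and smult_free_module: "r \<odot>\<^bsub>free_module (Z2_poly_ring S) X\<^esub> f = (\<lambda>_. r) * f"
  by (auto simp: free_module_def zero_fun_def plus_fun_def times_fun_def)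

lemma module_free_Z2: "module (Z2_poly_ring S) (free_module (Z2_poly_ring S) X)"
  by (intro free_module_module cring_Z2_poly_ring)

text \<open>
  The operations of a free module over a ring of polynomials are the pointwise ones, so that computations in
  it can be done with the type class operations on functions.
\<close>

lemma minus_free_module:
  assumes "f \<in> carrier (free_module (Z2_poly_ring S) X)" "g \<in> carrier (free_module (Z2_poly_ring S) X)"
  shows "f \<ominus>\<^bsub>free_module (Z2_poly_ring S) X\<^esub> g = f - g"
proof -
  interpret module "Z2_poly_ring S" "free_module (Z2_poly_ring S) X" by (rule module_free_Z2)
  have "- g \<in> carrier (free_module (Z2_poly_ring S) X)"
    using assms(2) by (auto simp: free_module_def)
  then have "\<ominus>\<^bsub>free_module (Z2_poly_ring S) X\<^esub> g = - g"
    using M.minus_equality[of "- g" g] assms(2) by (simp add: zero_free_module add_free_module)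
  then show ?thesis by (simp add: a_minus_def add_free_module)
qed

lemma finsum_free_module:
  assumes "finite A" "g \<in> A \<rightarrow> carrier (free_module (Z2_poly_ring S) X)"
  shows "finsum (free_module (Z2_poly_ring S) X) g A = sum g A"
proof -
  interpret module "Z2_poly_ring S" "free_module (Z2_poly_ring S) X" by (rule module_free_Z2)
  show ?thesis using assms
    by (induction A) (auto simp: zero_free_module add_free_module Pi_iff)
qed

section \<open>Shift relations and Dickson invariants\<close>

text \<open>
  The number of digits 1 in binary notation. It is the least number of powers of 2 with a given sum; this
  bounds the number of nonzero entries of an exponent tuple from below.
\<close>

fun binary_ones :: "nat \<Rightarrow> nat" where
  "binary_ones n = (if n = 0 then 0 else n mod 2 + binary_ones (n div 2))"

declare binary_ones.simps [simp del]

lemma binary_ones_0 [simp]: "binary_ones 0 = 0"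
  by (simp add: binary_ones.simps)

lemma binary_ones_rec: "binary_ones n = n mod 2 + binary_ones (n div 2)"
  by (cases "n = 0") (simp_all add: binary_ones.simps)

lemma binary_ones_power_of_2: "binary_ones (2 ^ a) = 1"
  by (induction a) (simp_all add: binary_ones.simps)

lemma binary_ones_add_power_of_2: "binary_ones (n + 2 ^ a) \<le> binary_ones n + 1"
proof (induction n arbitrary: a rule: less_induct)
  case (less n)
  show ?case
  proof (cases "n = 0")
    case True
    then show ?thesis by (simp add: binary_ones_power_of_2)
  next
    case False
    then have lt: "n div 2 < n" by simp
    show ?thesis
    proof (cases a)
      case 0
      show ?thesis
      proof (cases "even n")
        case True
        then have "(n + 1) mod 2 = 1" "(n + 1) div 2 = n div 2" "n mod 2 = 0"
          by presburger+
        then show ?thesis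
          using 0 binary_ones_rec[of n] binary_ones_rec[of "n + 1"] by simp
      next
        case False
        then have "(n + 1) mod 2 = 0" "(n + 1) div 2 = n div 2 + 2 ^ 0" "n mod 2 = 1"
          by (auto elim!: oddE)
        then show ?thesis
          using 0 binary_ones_rec[of n] binary_ones_rec[of "n + 1"] less.IH[OF lt, of 0] by simp
      qed
    next
      case (Suc b)
      have "(n + 2 ^ a) mod 2 = n mod 2" "(n + 2 ^ a) div 2 = n div 2 + 2 ^ b"
        using Suc by auto
      then show ?thesis
        using binary_ones_rec[of n] binary_ones_rec[of "n + 2 ^ a"] less.IH[OF lt, of b] by simp
    qed
  qed
qed

lemma binary_ones_sum_powers_of_2:
  assumes "finite A" "\<And>i. i \<in> A \<Longrightarrow> E i \<noteq> 0 \<Longrightarrow> \<exists>n. E i = (2::nat) ^ n"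
  shows "binary_ones (sum E A) \<le> card A"
  using assms
proof (induction A)
  case (insert x A)
  have IH: "binary_ones (sum E A) \<le> card A" using insert by auto
  show ?case
  proof (cases "E x = 0")
    case True
    then show ?thesis using insert.hyps IH by simp
  next
    case False
    then obtain n where "E x = 2 ^ n" using insert.prems by blast
    then show ?thesis
      using insert.hyps IH binary_ones_add_power_of_2[of "sum E A" n] by (simp add: add.commute)
  qed
qed simp

lemma binary_ones_mersenne: "binary_ones (2 ^ k - 1) = k"
proof (induction k)
  case (Suc k)
  have "(2 ^ Suc k - 1 :: nat) = 2 * (2 ^ k - 1) + 1"
    using one_le_power[of "2::nat" k] by (simp; linarith)
  then show ?case using Suc binary_ones_rec[of "2 ^ Suc k - 1"] by simp
qed simp

text \<open>
  A subgroup \<open>N\<close> of an abelian group. Membership in \<open>N\<close> expresses vanishing in the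
  quotient.
\<close>

locale additive_subset =
  fixes N :: "'w::ab_group_add set"
  assumes zero_mem: "0 \<in> N"
    and diff_mem: "\<And>a b. a \<in> N \<Longrightarrow> b \<in> N \<Longrightarrow> a - b \<in> N"
begin

lemma add_mem: "a \<in> N \<Longrightarrow> b \<in> N \<Longrightarrow> a + b \<in> N"
  using diff_mem[of a "0 - b"] diff_mem[OF zero_mem, of b] by simp

lemma sum_mem: "(\<And>x. x \<in> A \<Longrightarrow> g x \<in> N) \<Longrightarrow> sum g A \<in> N"
  by (induction A rule: infinite_finite_induct) (auto intro: zero_mem add_mem)

lemma add_cancel_left_mem: "a \<in> N \<Longrightarrow> a + b \<in> N \<longleftrightarrow> b \<in> N"
  using add_mem diff_mem[of "a + b" a] by auto

text \<open>
  The terms cancel in pairs, as the common value of a pair has order at most 2 modulo \<open>N\<close>.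
\<close>

lemma sum_involution_mem:
  assumes "finite A"
    and "\<And>a. a \<in> A \<Longrightarrow> \<tau> a \<in> A \<and> \<tau> a \<noteq> a \<and> \<tau> (\<tau> a) = a \<and> g (\<tau> a) = g a \<and> g a + g a \<in> N"
  shows "sum g A \<in> N"
  using assms
proof (induction A rule: finite_psubset_induct)
  case (psubset A)
  show ?case
  proof (cases "A = {}")
    case False
    then obtain a where a: "a \<in> A" by blast
    define B where "B = A - {a, \<tau> a}"
    have "\<tau> b \<in> B" if "b \<in> B" for b
      using that psubset.prems[of b] psubset.prems[of a] a unfolding B_def by auto
    then have "sum g B \<in> N"
      using psubset.prems a by (intro psubset.IH) (auto simp: B_def)
    moreover have "sum g A = g a + g a + sum g B"
    proof -
      have "A = insert a (insert (\<tau> a) B)" "finite B" "a \<notin> insert (\<tau> a) B" "\<tau> a \<notin> B"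
        using a psubset.prems[of a] psubset.hyps by (auto simp: B_def)
      then show ?thesis using psubset.prems[of a] a by (simp add: add.assoc)
    qed
    ultimately show ?thesis
      using psubset.prems[of a] a by (simp add: add_mem)
  qed (simp add: zero_mem)
qed

end

text \<open>
  The index of $S^e z_I$, for a monomial $S^e$ in the $k$ shift operators.
\<close>

definition index_shift :: "nat \<Rightarrow> (nat \<Rightarrow> nat) \<Rightarrow> (nat \<Rightarrow> int) \<Rightarrow> nat \<Rightarrow> int" where
  "index_shift k e I = (\<lambda>i. if i \<in> {1..k} then I i - int (e i) else I i)"

text \<open>
  The monomials $\prod_m x_m^{2^{\sigma(m)}}$ of the Moore determinant $\det(x_m^{2^j})$, where
  $1 \le m \le k$ and $0 \le j < k$, correspond to these bijections \<open>\<sigma>\<close>; modulo 2 the determinant is their sum.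
\<close>

definition bijective_exponents :: "nat \<Rightarrow> (nat \<Rightarrow> nat) set" where
  "bijective_exponents k = {\<sigma> \<in> {1..k} \<rightarrow>\<^sub>E {..<k}. bij_betw \<sigma> {1..k} {..<k}}"

lemma finite_bijective_exponents: "finite (bijective_exponents k)"
  unfolding bijective_exponents_def
  by (rule finite_subset[of _ "{1..k} \<rightarrow>\<^sub>E {..<k}"]) (auto intro: finite_PiE)

context additive_subset
begin

text \<open>
  Cramer's rule modulo 2. Multiply relation \<open>m\<close> by the cofactor of the entry \<open>(m, j)\<close> of the Moore matrix
  and add up. The resulting terms are indexed by pairs \<open>(m, \<tau>)\<close>, where \<open>\<tau>\<close> restricts to a bijection from the
  rows other than \<open>m\<close> to the columns other than \<open>j\<close>, and \<open>\<tau> m\<close> is the column taken from relation \<open>m\<close>. If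
  \<open>\<tau> m = j\<close>, then \<open>\<tau>\<close> is a bijection and contributes to the determinant. Otherwise the term also arises from the
  other row with the value \<open>\<tau> m\<close>, and the two cancel.
\<close>

lemma cramer_elimination:
  fixes \<psi> :: "nat \<Rightarrow> (nat \<Rightarrow> int) \<Rightarrow> 'w"
  assumes two: "\<And>j I. j < k \<Longrightarrow> \<psi> j I + \<psi> j I \<in> N"
    and rel: "\<And>m I. m \<in> {1..k} \<Longrightarrow> (\<Sum>j<k. \<psi> j (I(m := I m - 2 ^ j))) \<in> N"
    and j: "j < k"
  shows "(\<Sum>\<sigma>\<in>bijective_exponents k. \<psi> j (index_shift k (\<lambda>i. 2 ^ \<sigma> i) I)) \<in> N"
proof -
  define T where "T m = {\<tau> \<in> {1..k} \<rightarrow>\<^sub>E {..<k}. bij_betw \<tau> ({1..k} - {m}) ({..<k} - {j})}" for m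
  define g where "g = (\<lambda>(m, \<tau>). \<psi> (\<tau> m) (index_shift k (\<lambda>i. 2 ^ \<tau> i) I))"
  define P where "P = Sigma {1..k} T"
  have finT: "finite (T m)" for m
    unfolding T_def by (rule finite_subset[of _ "{1..k} \<rightarrow>\<^sub>E {..<k}"]) (auto intro: finite_PiE)
  then have finP: "finite P" unfolding P_def by blast
  \<comment> \<open>For fixed values in the other rows, the sum over the value in row \<open>m\<close> is relation \<open>m\<close>.\<close>
  have rowsum: "(\<Sum>\<tau>\<in>T m. g (m, \<tau>)) \<in> N" if m: "m \<in> {1..k}" for m
  proof -
    define B where "B = {\<rho> \<in> ({1..k} - {m}) \<rightarrow>\<^sub>E {..<k}. bij_betw \<rho> ({1..k} - {m}) ({..<k} - {j})}"
    have "(\<Sum>\<tau>\<in>T m. g (m, \<tau>)) = (\<Sum>(\<rho>, i)\<in>B \<times> {..<k}. g (m, \<rho>(m := i)))"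
    proof (rule sum.reindex_bij_witness[where i = "\<lambda>(\<rho>, i). \<rho>(m := i)"
          and j = "\<lambda>\<tau>. (restrict \<tau> ({1..k} - {m}), \<tau> m)"], goal_cases)
      case (1 \<tau>)
      then have "\<tau> \<in> {1..k} \<rightarrow>\<^sub>E {..<k}" by (simp add: T_def)
      then show ?case by (auto simp: fun_eq_iff PiE_def extensional_def)
    next
      case (2 \<tau>)
      then have \<tau>: "\<tau> \<in> {1..k} \<rightarrow>\<^sub>E {..<k}" "bij_betw \<tau> ({1..k} - {m}) ({..<k} - {j})"
        by (simp_all add: T_def)
      then have "bij_betw (restrict \<tau> ({1..k} - {m})) ({1..k} - {m}) ({..<k} - {j})"
        by (subst bij_betw_cong[where g = \<tau>]) auto
      with \<tau> m show ?case unfolding B_def by (auto simp: PiE_iff)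
    next
      case (3 b)
      then obtain \<rho> i where b: "b = (\<rho>, i)" "\<rho> \<in> B" "i < k" by auto
      then have "\<rho> \<in> ({1..k} - {m}) \<rightarrow>\<^sub>E {..<k}" by (simp add: B_def)
      then have "restrict (\<rho>(m := i)) ({1..k} - {m}) = \<rho>"
        by (intro ext) (auto simp: PiE_def extensional_def restrict_def)
      then show ?case using b by simp
    next
      case (4 b)
      then obtain \<rho> i where b: "b = (\<rho>, i)" "\<rho> \<in> B" "i < k" by auto
      then have \<rho>: "\<rho> \<in> ({1..k} - {m}) \<rightarrow>\<^sub>E {..<k}" "bij_betw \<rho> ({1..k} - {m}) ({..<k} - {j})"
        by (simp_all add: B_def)
      have "bij_betw (\<rho>(m := i)) ({1..k} - {m}) ({..<k} - {j})"
        using \<rho>(2) by (subst bij_betw_cong[where g = \<rho>]) auto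
      moreover have "\<rho>(m := i) \<in> {1..k} \<rightarrow>\<^sub>E {..<k}"
        using \<rho>(1) m b(3) by (auto simp: PiE_iff extensional_def)
      ultimately show ?case using b by (simp add: T_def)
    next
      case (5 \<tau>)
      then have "\<tau> \<in> {1..k} \<rightarrow>\<^sub>E {..<k}" by (simp add: T_def)
      then have "(restrict \<tau> ({1..k} - {m}))(m := \<tau> m) = \<tau>"
        by (auto simp: fun_eq_iff PiE_def extensional_def)
      then show ?case by simp
    qed
    also have "\<dots> = (\<Sum>\<rho>\<in>B. \<Sum>i<k. g (m, \<rho>(m := i)))"
      by (simp add: sum.cartesian_product)
    also have "\<dots> \<in> N"
    proof (rule sum_mem)
      fix \<rho> assume "\<rho> \<in> B"
      define J where "J = (index_shift k (\<lambda>i. 2 ^ \<rho> i) I)(m := I m)"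
      have "g (m, \<rho>(m := i)) = \<psi> i (J(m := J m - 2 ^ i))" for i
        unfolding g_def J_def index_shift_def using m by (auto intro!: arg_cong[of _ _ "\<psi> i"])
      then show "(\<Sum>i<k. g (m, \<rho>(m := i))) \<in> N"
        using rel[OF m, of J] by simp
    qed
    finally show ?thesis .
  qed
  have "sum g P = (\<Sum>m\<in>{1..k}. \<Sum>\<tau>\<in>T m. g (m, \<tau>))"
    unfolding P_def by (subst sum.Sigma) (auto simp: finT)
  then have total: "sum g P \<in> N"
    using sum_mem[of "{1..k}", OF rowsum] by simp
  define P0 where "P0 = {p \<in> P. snd p (fst p) = j}"
  define P1 where "P1 = {p \<in> P. snd p (fst p) \<noteq> j}"
  have split: "sum g P = sum g P1 + sum g P0"
  proof -
    have "P = P1 \<union> P0" "P1 \<inter> P0 = {}" "finite P1" "finite P0"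
      unfolding P0_def P1_def using finP by auto
    then show ?thesis using sum.union_disjoint[of P1 P0 g] by simp
  qed

  \<comment> \<open>Row \<open>m\<close> is replaced by the other row in which \<open>\<tau>\<close> takes the value \<open>\<tau> m\<close>.\<close>
  define swap where
    "swap = (\<lambda>(m, \<tau> :: nat \<Rightarrow> nat). (the_inv_into ({1..k} - {m}) \<tau> (\<tau> m), \<tau>))"
  have "sum g P1 \<in> N"
  proof (rule sum_involution_mem[where \<tau> = swap])
    show "finite P1" unfolding P1_def using finP by simp
  next
    fix p assume "p \<in> P1"
    then obtain m \<tau> where p: "p = (m, \<tau>)" "m \<in> {1..k}" "\<tau> \<in> {1..k} \<rightarrow>\<^sub>E {..<k}" "\<tau> m \<noteq> j"
      and bij: "bij_betw \<tau> ({1..k} - {m}) ({..<k} - {j})"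
      unfolding P1_def P_def T_def by auto
    define m' where "m' = the_inv_into ({1..k} - {m}) \<tau> (\<tau> m)"
    have inj: "inj_on \<tau> ({1..k} - {m})" using bij by (simp add: bij_betw_def)
    have "\<tau> m \<in> \<tau> ` ({1..k} - {m})"
      using bij p by (auto simp: bij_betw_def)
    then obtain n where n: "n \<in> {1..k} - {m}" "\<tau> n = \<tau> m" by (metis imageE)
    have m'n: "m' = n"
      unfolding m'_def using the_inv_into_f_f[OF inj n(1)] n(2) by simp
    have "{1..k} - {n} = insert m ({1..k} - {m} - {n})" "{1..k} - {m} = insert n ({1..k} - {m} - {n})"
      using n p(2) by auto
    then have same: "\<tau> ` ({1..k} - {n}) = \<tau> ` ({1..k} - {m})"
      using n(2) by (metis image_insert)
    then have img: "\<tau> ` ({1..k} - {n}) = {..<k} - {j}"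
      using bij by (simp add: bij_betw_def)
    have "card ({1..k} - {n}) = card ({1..k} - {m})" using n p(2) by simp
    then have inj': "inj_on \<tau> ({1..k} - {n})"
      using same card_image[OF inj] by (intro eq_card_imp_inj_on) auto
    have "m \<in> {1..k} - {n}" using n(1) p(2) by blast
    then have returns: "the_inv_into ({1..k} - {n}) \<tau> (\<tau> n) = m"
      using the_inv_into_f_f[OF inj', of m] n(2) by simp
    have "n \<in> {1..k}" using n(1) by blast
    moreover have "\<tau> \<in> T n"
      unfolding T_def bij_betw_def using p(3) img inj' by (intro CollectI conjI)
    ultimately have "(n, \<tau>) \<in> P" unfolding P_def by (rule SigmaI)
    then have "(n, \<tau>) \<in> P1" unfolding P1_def using n(2) p(4) by simp
    moreover have "n \<noteq> m" using n(1) by blast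
    moreover have "\<tau> m < k" using PiE_mem[OF p(3,2)] by simp
    then have "g p + g p \<in> N" using two p(1) by (simp add: g_def)
    moreover have "g (n, \<tau>) = g p" using p(1) n(2) by (simp add: g_def)
    moreover have "swap p = (n, \<tau>)" "swap (n, \<tau>) = p"
      using m'n returns p(1) unfolding m'_def swap_def by simp_all
    ultimately show "swap p \<in> P1 \<and> swap p \<noteq> p \<and> swap (swap p) = p \<and> g (swap p) = g p \<and> g p + g p \<in> N"
      using p(1) by simp
  qed
  with total split have "sum g P0 \<in> N" by (simp add: add_cancel_left_mem)
  also have "sum g P0 = (\<Sum>\<sigma>\<in>bijective_exponents k. \<psi> j (index_shift k (\<lambda>i. 2 ^ \<sigma> i) I))"
  proof (rule sum.reindex_bij_witness[where j = snd
        and i = "\<lambda>\<sigma>. (the_inv_into {1..k} \<sigma> j, \<sigma>)"], goal_cases)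
    case (1 p)
    then obtain m \<tau> where p: "p = (m, \<tau>)" "m \<in> {1..k}" "\<tau> \<in> {1..k} \<rightarrow>\<^sub>E {..<k}" "\<tau> m = j"
      and bij: "bij_betw \<tau> ({1..k} - {m}) ({..<k} - {j})"
      unfolding P0_def P_def T_def by auto
    have "bij_betw \<tau> (({1..k} - {m}) \<union> {m}) (({..<k} - {j}) \<union> {j})"
      using bij p j by (intro bij_betw_combine) (auto simp: bij_betw_def)
    then have "inj_on \<tau> {1..k}" using p by (simp add: bij_betw_def insert_absorb)
    then show ?case using p the_inv_into_f_f[of \<tau> "{1..k}" m] by simp
  next
    case (2 p)
    then obtain m \<tau> where p: "p = (m, \<tau>)" "m \<in> {1..k}" "\<tau> \<in> {1..k} \<rightarrow>\<^sub>E {..<k}" "\<tau> m = j"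
      and bij: "bij_betw \<tau> ({1..k} - {m}) ({..<k} - {j})"
      unfolding P0_def P_def T_def by auto
    have "bij_betw \<tau> (({1..k} - {m}) \<union> {m}) (({..<k} - {j}) \<union> {j})"
      using bij p j by (intro bij_betw_combine) (auto simp: bij_betw_def)
    moreover have "({1..k} - {m}) \<union> {m} = {1..k}" "({..<k} - {j}) \<union> {j} = {..<k}"
      using p j by auto
    ultimately show ?case using p by (simp add: bijective_exponents_def)
  next
    case (3 \<sigma>)
    then show ?case by simp
  next
    case (4 \<sigma>)
    then have \<sigma>: "\<sigma> \<in> {1..k} \<rightarrow>\<^sub>E {..<k}" "bij_betw \<sigma> {1..k} {..<k}"
      by (auto simp: bijective_exponents_def)
    define m where "m = the_inv_into {1..k} \<sigma> j"
    have "inj_on \<sigma> {1..k}" "j \<in> \<sigma> ` {1..k}" using \<sigma>(2) j by (auto simp: bij_betw_def)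
    then have m: "m \<in> {1..k}" "\<sigma> m = j"
      using the_inv_into_into[OF _ _ subset_refl] f_the_inv_into_f unfolding m_def by metis+
    have "bij_betw \<sigma> ({1..k} - {m}) ({..<k} - {j})"
      using bij_betw_DiffI[OF \<sigma>(2), of "{m}" "{j}"] m j by (auto simp: bij_betw_def)
    then show ?case
      using \<sigma>(1) m unfolding P0_def P_def T_def m_def[symmetric] by auto
  next
    case (5 p)
    then show ?case by (simp add: P0_def g_def split_beta)
  qed
  finally show ?thesis .
qed

text \<open>
  The Moore determinant annihilates the functions $\psi_j$. Among its monomials the one with exponents
  $1, 2, 4, \ldots, 2^{k-1}$ is lexicographically least. Applied to an index raised by these exponents, it gives
  back $\psi_j(I)$, while all other monomials give values at lexicographically smaller indices, which vanish by
  induction. The induction starts because $\psi_j$ vanishes unless all entries are positive.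
\<close>

lemma shift_relations_unique:
  fixes \<psi> :: "nat \<Rightarrow> (nat \<Rightarrow> int) \<Rightarrow> 'w"
  assumes van: "\<And>j I m. j < k \<Longrightarrow> m \<in> {1..k} \<Longrightarrow> I m \<le> 0 \<Longrightarrow> \<psi> j I \<in> N"
    and two: "\<And>j I. j < k \<Longrightarrow> \<psi> j I + \<psi> j I \<in> N"
    and rel: "\<And>m I. m \<in> {1..k} \<Longrightarrow> (\<Sum>j<k. \<psi> j (I(m := I m - 2 ^ j))) \<in> N"
    and j: "j < k"
  shows "\<psi> j I \<in> N"
proof -
  define r where "r = inv_image (lex less_than) (\<lambda>I. map (\<lambda>i. nat (I i)) [1..<Suc k])"
  have "wf r" unfolding r_def by (intro wf_inv_image wf_lex wf_less_than)
  then show ?thesis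
  proof (induction I rule: wf_induct_rule)
    case (less I)
    show ?case
    proof (cases "\<exists>m\<in>{1..k}. I m \<le> 0")
      case True
      then show ?thesis using van j by blast
    next
      case False
      then have pos: "I m > 0" if "m \<in> {1..k}" for m using that by force
      define L where "L = restrict (\<lambda>i::nat. i - 1) {1..k}"
      define J where "J = (\<lambda>i. if i \<in> {1..k} then I i + int (2 ^ L i) else I i)"
      have "bij_betw L {1..k} {..<k}"
        by (rule bij_betw_byWitness[where f' = Suc]) (auto simp: L_def)
      then have LB: "L \<in> bijective_exponents k"
        by (auto simp: bijective_exponents_def L_def)
      have JL: "index_shift k (\<lambda>i. 2 ^ L i) J = I"
        by (auto simp: index_shift_def J_def)
      have other: "\<psi> j (index_shift k (\<lambda>i. 2 ^ \<sigma> i) J) \<in> N"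
        if \<sigma>: "\<sigma> \<in> bijective_exponents k - {L}" for \<sigma>
      proof -
        define I' where "I' = index_shift k (\<lambda>i. 2 ^ \<sigma> i) J"
        have \<sigma>1: "\<sigma> \<in> {1..k} \<rightarrow>\<^sub>E {..<k}" "inj_on \<sigma> {1..k}" "\<sigma> \<noteq> L"
          using \<sigma> by (auto simp: bijective_exponents_def bij_betw_def)
        have "\<exists>i. i \<in> {1..k} \<and> \<sigma> i \<noteq> i - 1"
        proof (rule ccontr)
          assume "\<not> ?thesis"
          then have "\<sigma> = L" using \<sigma>1(1) by (auto simp: L_def fun_eq_iff PiE_def extensional_def)
          then show False using \<sigma>1 by simp
        qed
        define m where "m = (LEAST i. i \<in> {1..k} \<and> \<sigma> i \<noteq> i - 1)"
        have m: "m \<in> {1..k}" "\<sigma> m \<noteq> m - 1"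
          using LeastI_ex[OF \<open>\<exists>i. i \<in> {1..k} \<and> \<sigma> i \<noteq> i - 1\<close>] unfolding m_def by auto
        have before: "\<sigma> i = i - 1" if "1 \<le> i" "i < m" for i
          using not_less_Least[of i "\<lambda>i. i \<in> {1..k} \<and> \<sigma> i \<noteq> i - 1"] that m unfolding m_def[symmetric] by auto
        \<comment> \<open>The values below \<open>m - 1\<close> have been used up by the rows before \<open>m\<close>.\<close>
        have "\<sigma> m > m - 1"
        proof (rule ccontr)
          assume "\<not> ?thesis"
          then have "\<sigma> m < m - 1" using m(2) by simp
          then have "\<sigma> (Suc (\<sigma> m)) = \<sigma> m" using before[of "Suc (\<sigma> m)"] by simp
          then have "Suc (\<sigma> m) = m"
            using inj_onD[OF \<sigma>1(2), of "Suc (\<sigma> m)" m] m \<open>\<sigma> m < m - 1\<close> by auto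
          then show False using \<open>\<sigma> m < m - 1\<close> by simp
        qed
        then have "(2::int) ^ (m - 1) < 2 ^ \<sigma> m" by simp
        then have lessm: "I' m < I m"
          using m by (simp add: I'_def index_shift_def J_def L_def)
        have eqbefore: "I' i = I i" if "1 \<le> i" "i < m" for i
          using that before[OF that] m by (simp add: I'_def index_shift_def J_def L_def)
        have upt: "[1..<Suc k] = [1..<m] @ m # [Suc m..<Suc k]"
          using m(1) upt_add_eq_append[of 1 m "Suc k - m"] upt_conv_Cons[of m "Suc k"] by simp
        have "nat (I' m) < nat (I m)" using lessm pos[OF m(1)] by simp
        then have "(nat (I' m) # map (\<lambda>i. nat (I' i)) [Suc m..<Suc k],
            nat (I m) # map (\<lambda>i. nat (I i)) [Suc m..<Suc k]) \<in> lex less_than"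
          unfolding Cons_in_lex by simp
        then have "(map (\<lambda>i. nat (I i)) [1..<m] @ nat (I' m) # map (\<lambda>i. nat (I' i)) [Suc m..<Suc k],
            map (\<lambda>i. nat (I i)) [1..<m] @ nat (I m) # map (\<lambda>i. nat (I i)) [Suc m..<Suc k]) \<in> lex less_than"
          by (rule lex_append_leftI)
        moreover have "map (\<lambda>i. nat (I' i)) [1..<m] = map (\<lambda>i. nat (I i)) [1..<m]"
          using eqbefore by (intro map_cong) auto
        ultimately have "(I', I) \<in> r"
          unfolding r_def in_inv_image upt map_append list.map by (simp only:)
        then show ?thesis using less.IH unfolding I'_def by blast
      qed
      have "(\<Sum>\<sigma>\<in>bijective_exponents k. \<psi> j (index_shift k (\<lambda>i. 2 ^ \<sigma> i) J)) \<in> N"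
        by (rule cramer_elimination[where \<psi> = \<psi> and k = k]) (use two rel j in auto)
      also have "(\<Sum>\<sigma>\<in>bijective_exponents k. \<psi> j (index_shift k (\<lambda>i. 2 ^ \<sigma> i) J)) =
          (\<Sum>\<sigma>\<in>bijective_exponents k - {L}. \<psi> j (index_shift k (\<lambda>i. 2 ^ \<sigma> i) J)) + \<psi> j I"
        using sum.remove[OF finite_bijective_exponents LB, of "\<lambda>\<sigma>. \<psi> j (index_shift k (\<lambda>i. 2 ^ \<sigma> i) J)"] JL
        by (simp add: add.commute)
      finally show ?thesis
        by (subst (asm) add_cancel_left_mem) (auto intro: sum_mem other)
    qed
  qed
qed

end

lemma mem_exponent_tuples_iff:
  assumes "j \<le> k"
  shows "E \<in> exponent_tuples k j \<longleftrightarrow> E \<in> extensional {1..k} \<and>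
    (\<forall>i\<in>{1..k}. E i \<noteq> 0 \<longrightarrow> (\<exists>n. E i = 2 ^ n)) \<and> sum E {1..k} + 2 ^ j = 2 ^ k"
proof -
  have "(2::nat) ^ j \<le> 2 ^ k" using assms by simp
  then show ?thesis unfolding exponent_tuples_def PiE_def by auto
qed

lemma finite_exponent_tuples: "finite (exponent_tuples k j)"
proof (rule finite_subset)
  show "exponent_tuples k j \<subseteq> {1..k} \<rightarrow>\<^sub>E {..2 ^ k}"
  proof
    fix E assume E: "E \<in> exponent_tuples k j"
    have "E i \<le> 2 ^ k" if "i \<in> {1..k}" for i
      using member_le_sum[of i "{1..k}" E] that E
      by (simp add: exponent_tuples_def) 
    then show "E \<in> {1..k} \<rightarrow>\<^sub>E {..2 ^ k}"
      using E by (auto simp: exponent_tuples_def PiE_iff)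
  qed
qed (auto intro: finite_PiE)

text \<open>
  The variable $x_m$ occurs in $x^E x_m^{2^j}$ with exponent $E_m + 2^j$. If the summands are
  different powers of 2, exchange them; if they are equal, merge them into one power of 2, with new $E_m = 0$; if
  $E_m = 0$, split $2^j$ into two equal halves. None of this changes the monomial. The first case is its own
  inverse, and the other two are inverse to each other.
\<close>

definition exponent_swap :: "nat \<Rightarrow> nat \<times> (nat \<Rightarrow> nat) \<Rightarrow> nat \<times> (nat \<Rightarrow> nat)" where
  "exponent_swap m = (\<lambda>(j, E).
     if E m = 0 then (j - 1, E(m := 2 ^ (j - 1)))
     else if E m = 2 ^ j then (j + 1, E(m := 0))
     else (THE a. E m = 2 ^ a, E(m := 2 ^ j)))"

text \<open>
  The halving of $2^j$ fails only for $j = 0$. Then $E$ would have the sum $2^k - 1$, which requires $k$ nonzero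
  entries, whereas $E_m = 0$.
\<close>

lemma exponent_swap:
  assumes m: "m \<in> {1..k}" and j: "j \<le> k" and E: "E \<in> exponent_tuples k j"
    and j'E': "exponent_swap m (j, E) = (j', E')"
  shows "j' \<le> k" "E' \<in> exponent_tuples k j'" "(j', E') \<noteq> (j, E)"
    "exponent_swap m (j', E') = (j, E)" "E' m + 2 ^ j' = E m + 2 ^ j" "\<And>i. i \<noteq> m \<Longrightarrow> E' i = E i"
proof -
  have ext: "E \<in> extensional {1..k}"
    and pow: "\<And>i. i \<in> {1..k} \<Longrightarrow> E i \<noteq> 0 \<Longrightarrow> \<exists>n. E i = 2 ^ n"
    and sumE: "sum E {1..k} + 2 ^ j = 2 ^ k"
    using E mem_exponent_tuples_iff[OF j, of E] by auto
  have the_exp: "(THE a. (2::nat) ^ b = 2 ^ a) = b" for b by (rule the_equality) auto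
  have split: "sum F {1..k} = F m + sum F ({1..k} - {m})" for F :: "nat \<Rightarrow> nat"
    using m by (simp add: sum.remove)
  have main: "j' \<le> k \<and> (\<exists>e. E' = E(m := e) \<and> (e \<noteq> 0 \<longrightarrow> (\<exists>n. e = 2 ^ n)) \<and> e + 2 ^ j' = E m + 2 ^ j) \<and>
      (j', E') \<noteq> (j, E) \<and> exponent_swap m (j', E') = (j, E)"
  proof (cases "E m = 0")
    case True
    have "j \<noteq> 0"
    proof
      assume "j = 0"
      then have "sum E ({1..k} - {m}) = 2 ^ k - 1"
        using sumE split[of E] True by simp
      then have "k = binary_ones (sum E ({1..k} - {m}))" by (simp only: binary_ones_mersenne)
      also have "\<dots> \<le> card ({1..k} - {m})"
        by (rule binary_ones_sum_powers_of_2) (use pow in auto)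
      also have "\<dots> < k" using m by simp
      finally show False by simp
    qed
    then obtain b where b: "j = Suc b" by (cases j) auto
    have "E(m := 0) = E" using True by auto
    then have "exponent_swap m (b, E(m := 2 ^ b)) = (j, E)"
      by (simp add: exponent_swap_def b)
    moreover have "j' = b" "E' = E(m := 2 ^ b)"
      using j'E' True b by (auto simp add: exponent_swap_def)
    ultimately show ?thesis
      using True b j by (intro conjI exI[of _ "2 ^ b"]) auto
  next
    case False
    then obtain a where a: "E m = 2 ^ a" using pow m by blast
    have le: "E m + 2 ^ j \<le> 2 ^ k" using sumE split[of E] by simp
    show ?thesis
    proof (cases "a = j")
      case True
      have "(2::nat) ^ Suc j \<le> 2 ^ k" using le a True by simp
      then have "Suc j \<le> k" using power_le_imp_le_exp[of "2::nat" "Suc j" k] by simp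
      moreover have "E(m := 2 ^ j) = E" using a True by auto
      then have "exponent_swap m (Suc j, E(m := 0)) = (j, E)"
        by (simp add: exponent_swap_def)
      moreover have "j' = Suc j" "E' = E(m := 0)"
        using j'E' a True by (simp_all add: exponent_swap_def)
      ultimately show ?thesis
        using a True by (intro conjI exI[of _ 0]) auto
    next
      case False
      have "(2::nat) ^ a \<le> 2 ^ k" using le unfolding a by linarith
      then have "a \<le> k" using power_le_imp_le_exp[of "2::nat" a k] by simp
      moreover have "E(m := 2 ^ a) = E" using a by auto
      then have "exponent_swap m (a, E(m := 2 ^ j)) = (j, E)"
        using False by (simp add: exponent_swap_def the_exp)
      moreover have "j' = a" "E' = E(m := 2 ^ j)"
        using j'E' a False the_exp[of a] by (auto simp add: exponent_swap_def)
      ultimately show ?thesis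
        using a False by (intro conjI exI[of _ "2 ^ j"]) auto
    qed
  qed
  then obtain e where e: "E' = E(m := e)" "e \<noteq> 0 \<longrightarrow> (\<exists>n. e = 2 ^ n)" "e + 2 ^ j' = E m + 2 ^ j"
    by blast
  show j'k: "j' \<le> k" and "(j', E') \<noteq> (j, E)" "exponent_swap m (j', E') = (j, E)" using main by auto
  show "E' m + 2 ^ j' = E m + 2 ^ j" "\<And>i. i \<noteq> m \<Longrightarrow> E' i = E i" using e by auto
  have "sum E' ({1..k} - {m}) = sum E ({1..k} - {m})" using e(1) by (intro sum.cong) auto
  then have "sum E' {1..k} + 2 ^ j' = 2 ^ k"
    using sumE split[of E] split[of E'] e by simp
  then show "E' \<in> exponent_tuples k j'"
    unfolding mem_exponent_tuples_iff[OF j'k] using ext pow e(1,2) m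
    by (simp add: extensional_def)
qed

lemma exponent_tuples_top: "exponent_tuples k k = {restrict (\<lambda>_. 0) {1..k}}"
  by (auto simp: exponent_tuples_def PiE_def extensional_def fun_eq_iff)

context additive_subset
begin

text \<open>
  Let $c_j$ be the claimed multiple of $\psi_k$. The differences $\psi_j - c_j$, $j < k$, satisfy the homogeneous
  relations: since $c_k = \psi_k$, this amounts to $\sum_{j \le k} c_j(I - 2^j e_m) = 0$, where the terms
  cancel in pairs under \<open>exponent_swap\<close>.
\<close>

theorem dickson_relations:
  fixes \<psi> :: "nat \<Rightarrow> (nat \<Rightarrow> int) \<Rightarrow> 'w"
  assumes cong: "\<And>j I I'. (\<And>i. i \<in> {1..k} \<Longrightarrow> I i = I' i) \<Longrightarrow> \<psi> j I = \<psi> j I'"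
    and van: "\<And>j I m. j \<le> k \<Longrightarrow> m \<in> {1..k} \<Longrightarrow> I m \<le> 0 \<Longrightarrow> \<psi> j I \<in> N"
    and two: "\<And>j I. j \<le> k \<Longrightarrow> \<psi> j I + \<psi> j I \<in> N"
    and rel: "\<And>m I. m \<in> {1..k} \<Longrightarrow> (\<Sum>j\<le>k. \<psi> j (I(m := I m - 2 ^ j))) \<in> N"
    and j: "j < k"
  shows "\<psi> j I - (\<Sum>E\<in>exponent_tuples k j. \<psi> k (\<lambda>i. I i - int (E i))) \<in> N"
proof -
  define c where "c = (\<lambda>j (I :: nat \<Rightarrow> int). \<Sum>E\<in>exponent_tuples k j. \<psi> k (\<lambda>i. I i - int (E i)))"
  define \<chi> where "\<chi> = (\<lambda>j I. \<psi> j I - c j I)"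
  have c_two: "c j I + c j I \<in> N" for j I
    unfolding c_def sum.distrib[symmetric] using two by (intro sum_mem) simp
  have c_top: "c k I = \<psi> k I" for I
    unfolding c_def exponent_tuples_top by (auto intro: cong)
  have "\<chi> j I \<in> N"
  proof (rule shift_relations_unique[where \<psi> = \<chi> and k = k])
    fix j m and I :: "nat \<Rightarrow> int" assume "j < k" "m \<in> {1..k}" "I m \<le> 0"
    moreover have "c j I \<in> N"
      unfolding c_def
    proof (rule sum_mem)
      fix E show "\<psi> k (\<lambda>i. I i - int (E i)) \<in> N"
        using \<open>m \<in> {1..k}\<close> \<open>I m \<le> 0\<close> by (intro van[of k m]) auto
    qed
    ultimately show "\<chi> j I \<in> N" unfolding \<chi>_def by (intro diff_mem van) auto
  next
    fix j and I :: "nat \<Rightarrow> int" assume "j < k"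
    then have "(\<psi> j I + \<psi> j I) - (c j I + c j I) \<in> N" by (intro diff_mem two c_two) simp
    then show "\<chi> j I + \<chi> j I \<in> N" by (simp add: \<chi>_def algebra_simps)
  next
    fix m and I :: "nat \<Rightarrow> int" assume m: "m \<in> {1..k}"
    define I' where "I' = (\<lambda>j. I(m := I m - 2 ^ j))"
    have cancel: "(\<Sum>j\<le>k. c j (I' j)) \<in> N"
    proof -
      define P where "P = Sigma {..k} (exponent_tuples k)"
      define g where "g = (\<lambda>(j, E). \<psi> k (\<lambda>i. I' j i - int (E i)))"
      have "(\<Sum>j\<le>k. c j (I' j)) = sum g P"
        unfolding P_def g_def c_def by (subst sum.Sigma) (auto simp: finite_exponent_tuples)
      also have "\<dots> \<in> N"
      proof (rule sum_involution_mem[where \<tau> = "exponent_swap m"])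
        show "finite P" by (simp add: P_def finite_exponent_tuples)
        fix p assume "p \<in> P"
        then obtain j E where p: "p = (j, E)" "j \<le> k" "E \<in> exponent_tuples k j"
          by (auto simp: P_def)
        obtain j' E' where s: "exponent_swap m (j, E) = (j', E')" by fastforce
        note swap = exponent_swap[OF m p(2,3) s]
        have "int (E' m + 2 ^ j') = int (E m + 2 ^ j)" using swap(5) by simp
        then have "(\<lambda>i. I' j' i - int (E' i)) = (\<lambda>i. I' j i - int (E i))"
          unfolding I'_def using swap(6) by (auto simp: fun_eq_iff)
        then have "g (j', E') = g (j, E)" by (simp add: g_def)
        then show "exponent_swap m p \<in> P \<and> exponent_swap m p \<noteq> p \<and>
            exponent_swap m (exponent_swap m p) = p \<and> g (exponent_swap m p) = g p \<and> g p + g p \<in> N"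
          using p s swap two[of k] by (auto simp: P_def g_def)
      qed
      finally show ?thesis .
    qed
    have "(\<Sum>j\<le>k. \<psi> j (I' j)) - (\<Sum>j\<le>k. c j (I' j)) \<in> N"
      using rel[OF m, of I] cancel unfolding I'_def by (intro diff_mem)
    also have "(\<Sum>j\<le>k. \<psi> j (I' j)) - (\<Sum>j\<le>k. c j (I' j)) = (\<Sum>j<k. \<chi> j (I' j))"
      by (simp add: \<chi>_def sum_subtractf lessThan_Suc_atMost[symmetric] c_top)
    finally show "(\<Sum>j<k. \<chi> j (I(m := I m - 2 ^ j))) \<in> N" by (simp add: I'_def)
  qed (rule j)
  then show ?thesis by (simp add: \<chi>_def c_def)
qed

end

section \<open>Tensor powers as quotients of a free module\<close>

text \<open>
  Identities in the tensor power are stated as membership in the kernel \<open>K\<close> of the projection from the free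
  module on tuples.
\<close>

locale tensor_power_Z2 =
  fixes S :: "nat set" and M :: "(qv, 'm, 'd) module_scheme" and k :: nat
  assumes module_M: "module (Z2_poly_ring S) M"
begin

abbreviation "R \<equiv> Z2_poly_ring S"
abbreviation "F \<equiv> tensor_free R M k"
abbreviation "K \<equiv> tensor_kernel R M k"
abbreviation "tuples \<equiv> PiE {1..k} (\<lambda>_. carrier M)"
abbreviation "e \<equiv> basis_elt R"

sublocale M: module R M by (rule module_M)
sublocale F: module R F unfolding tensor_free_def by (rule module_free_Z2)

lemmas F_simps = zero_free_module[of S tuples, folded tensor_free_def]
  add_free_module[where S = S and X = tuples, folded tensor_free_def]
  smult_free_module[where S = S and X = tuples, folded tensor_free_def]

lemmas minus_F = minus_free_module[where S = S and X = tuples, folded tensor_free_def]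

lemma e_carrier: "t \<in> tuples \<Longrightarrow> e t \<in> carrier F"
  unfolding tensor_free_def by (intro basis_elt_carrier cring_Z2_poly_ring)

lemma smult_carrier: "r \<in> Z2polys S \<Longrightarrow> f \<in> carrier F \<Longrightarrow> (\<lambda>_. r) * f \<in> carrier F"
  using F.smult_closed[of r f] by (simp add: F_simps)

lemma upd_tuples: "t \<in> tuples \<Longrightarrow> i \<in> {1..k} \<Longrightarrow> x \<in> carrier M \<Longrightarrow> t(i := x) \<in> tuples"
  by (auto simp: PiE_iff extensional_def)

lemma tensor_relations_carrier: "tensor_relations R M k \<subseteq> carrier F"
proof
  fix f assume "f \<in> tensor_relations R M k"
  then consider (add) t i x y where "t \<in> tuples" "i \<in> {1..k}" "x \<in> carrier M" "y \<in> carrier M"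
      "f = e (t(i := x \<oplus>\<^bsub>M\<^esub> y)) \<ominus>\<^bsub>F\<^esub> (e (t(i := x)) \<oplus>\<^bsub>F\<^esub> e (t(i := y)))"
    | (smult) t i x r where "t \<in> tuples" "i \<in> {1..k}" "x \<in> carrier M" "r \<in> carrier R"
      "f = e (t(i := r \<odot>\<^bsub>M\<^esub> x)) \<ominus>\<^bsub>F\<^esub> (r \<odot>\<^bsub>F\<^esub> e (t(i := x)))"
    unfolding tensor_relations_def by blast
  then show "f \<in> carrier F"
  proof cases
    case add
    then show ?thesis
      unfolding add(5) by (intro F.M.minus_closed F.M.add.m_closed e_carrier upd_tuples M.M.add.m_closed)
  next
    case smult
    then show ?thesis
      unfolding smult(5) by (intro F.M.minus_closed F.smult_closed e_carrier upd_tuples M.smult_closed)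
  qed
qed

lemma submodule_K: "submodule K R F"
  unfolding tensor_kernel_def by (intro submodule_submodule_span F.module_axioms tensor_relations_carrier)

lemma K_add: "f \<in> K \<Longrightarrow> g \<in> K \<Longrightarrow> f + g \<in> K"
  using F.submoduleE(5)[OF submodule_K] by (simp add: F_simps)

lemma K_smult: "r \<in> Z2polys S \<Longrightarrow> f \<in> K \<Longrightarrow> (\<lambda>_. r) * f \<in> K"
  using F.submoduleE(4)[OF submodule_K, of r f] by (simp add: F_simps)

lemma K_carrier: "f \<in> K \<Longrightarrow> f \<in> carrier F"
  using F.submoduleE(1)[OF submodule_K] by blast

lemma K_zero: "0 \<in> K"
  using subgroup.one_closed[OF submodule.axioms(1)[OF submodule_K]] by (simp add: F_simps)

lemma K_tensor_add:
  assumes "t \<in> tuples" "i \<in> {1..k}" "x \<in> carrier M" "y \<in> carrier M"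
  shows "e (t(i := x \<oplus>\<^bsub>M\<^esub> y)) - (e (t(i := x)) + e (t(i := y))) \<in> K"
proof -
  have "e (t(i := x \<oplus>\<^bsub>M\<^esub> y)) \<ominus>\<^bsub>F\<^esub> (e (t(i := x)) \<oplus>\<^bsub>F\<^esub> e (t(i := y))) \<in> tensor_relations R M k"
    unfolding tensor_relations_def using assms by blast
  then have "e (t(i := x \<oplus>\<^bsub>M\<^esub> y)) \<ominus>\<^bsub>F\<^esub> (e (t(i := x)) \<oplus>\<^bsub>F\<^esub> e (t(i := y))) \<in> K"
    using submodule_span_superset[OF F.module_axioms tensor_relations_carrier]
    unfolding tensor_kernel_def by blast
  then show ?thesis
    using minus_F[of "e (t(i := x \<oplus>\<^bsub>M\<^esub> y))" "e (t(i := x)) \<oplus>\<^bsub>F\<^esub> e (t(i := y))"]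
      e_carrier[OF upd_tuples[OF assms(1,2)]] assms(3,4) F.M.add.m_closed
    by (simp add: F_simps)
qed

lemma K_tensor_smult:
  assumes "t \<in> tuples" "i \<in> {1..k}" "x \<in> carrier M" "r \<in> Z2polys S"
  shows "e (t(i := r \<odot>\<^bsub>M\<^esub> x)) - (\<lambda>_. r) * e (t(i := x)) \<in> K"
proof -
  have "e (t(i := r \<odot>\<^bsub>M\<^esub> x)) \<ominus>\<^bsub>F\<^esub> (r \<odot>\<^bsub>F\<^esub> e (t(i := x))) \<in> tensor_relations R M k"
    unfolding tensor_relations_def using assms by auto
  then have "e (t(i := r \<odot>\<^bsub>M\<^esub> x)) \<ominus>\<^bsub>F\<^esub> (r \<odot>\<^bsub>F\<^esub> e (t(i := x))) \<in> K"
    using submodule_span_superset[OF F.module_axioms tensor_relations_carrier]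
    unfolding tensor_kernel_def by blast
  then show ?thesis
    using minus_F[of "e (t(i := r \<odot>\<^bsub>M\<^esub> x))" "r \<odot>\<^bsub>F\<^esub> e (t(i := x))"]
      e_carrier[OF upd_tuples[OF assms(1,2)]] assms(3,4) F.smult_closed[of r]
    by (simp add: F_simps)
qed

lemma K_tensor_zero:
  assumes "t \<in> tuples" "i \<in> {1..k}" "t i = \<zero>\<^bsub>M\<^esub>"
  shows "e t \<in> K"
proof -
  have "t(i := \<zero>\<^bsub>M\<^esub>) = t" using assms(3) by auto
  moreover have "(\<lambda>_. 0) * e t = 0" by (auto simp: fun_eq_iff)
  ultimately show ?thesis
    using K_tensor_smult[OF assms(1,2), of "\<zero>\<^bsub>M\<^esub>" 0] M.smult_l_null[of "\<zero>\<^bsub>M\<^esub>"] by simp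
qed

lemma K_tensor_finsum:
  assumes t: "t \<in> tuples" and i: "i \<in> {1..k}" and A: "finite A" and g: "\<And>a. a \<in> A \<Longrightarrow> g a \<in> carrier M"
  shows "e (t(i := finsum M g A)) - (\<Sum>a\<in>A. e (t(i := g a))) \<in> K"
  using A g
proof (induction A)
  case empty
  show ?case using K_tensor_zero[OF upd_tuples[OF t i M.M.zero_closed] i] by (simp add: fun_upd_def)
next
  case (insert a A)
  have gA: "g \<in> A \<rightarrow> carrier M" and ga: "g a \<in> carrier M" using insert.prems by auto
  have "e (t(i := g a \<oplus>\<^bsub>M\<^esub> finsum M g A)) - (e (t(i := g a)) + e (t(i := finsum M g A))) \<in> K"
    using t i ga gA by (intro K_tensor_add M.M.finsum_closed)
  moreover have "e (t(i := finsum M g A)) - (\<Sum>a\<in>A. e (t(i := g a))) \<in> K"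
    using insert.IH insert.prems by blast
  ultimately have "(e (t(i := g a \<oplus>\<^bsub>M\<^esub> finsum M g A)) - (e (t(i := g a)) + e (t(i := finsum M g A)))) +
      (e (t(i := finsum M g A)) - (\<Sum>a\<in>A. e (t(i := g a)))) \<in> K"
    by (rule K_add)
  moreover have "x - (y + z) + (z - w) = x - (y + w)" for x y z w :: "(nat \<Rightarrow> 'm) \<Rightarrow> qv"
    by simp
  ultimately show ?case
    by (simp only: M.M.finsum_insert[OF insert.hyps gA ga] sum.insert[OF insert.hyps])
qed

sublocale T: module_quotient R F K
  by (intro module_quotient.intro module_quotient_axioms.intro F.module_axioms submodule_K)

lemma tensor_power_eq: "tensor_power R M k = T.Q"
  by (simp add: tensor_power_def)

end

section \<open>The relations between the generators $z_i$\<close>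

lemma BPk_eq: "BPk k = Z2_poly_ring {1..k}"
  by (simp add: BPk_def)

lemma BZ2_relation_carrier: "hazewinkel_in_generators h \<Longrightarrow> BZ2_relation h k ` {1..} \<subseteq> carrier (BZ2_free k)"
proof
  fix f assume h: "hazewinkel_in_generators h" and "f \<in> BZ2_relation h k ` {1..}"
  then obtain i where f: "f = BZ2_relation h k i" by blast
  interpret module "BPk k" "BZ2_free k"
    unfolding BZ2_free_def BPk_eq by (rule module_free_Z2)
  show "f \<in> carrier (BZ2_free k)"
    unfolding f BZ2_relation_def
  proof (intro M.finsum_closed Pi_I smult_closed)
    fix j assume "j \<in> {..<i}"
    show "BP_to_BPk k (two_coeff h j) \<in> carrier (BPk k)"
      using two_coeff_BPk(1)[OF h] by (simp add: BPk_eq)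
    show "basis_elt (BPk k) (i - j) \<in> carrier (BZ2_free k)"
      unfolding BZ2_free_def using \<open>j \<in> {..<i}\<close> by (intro basis_elt_carrier R.cring_axioms) auto
  qed
qed

lemma BZ2_quotient:
  assumes "hazewinkel_in_generators h"
  shows "module_quotient (Z2_poly_ring {1..k}) (BZ2_free k) (BZ2_kernel h k)"
proof -
  have m: "module (Z2_poly_ring {1..k}) (BZ2_free k)"
    unfolding BZ2_free_def BPk_eq by (rule module_free_Z2)
  then show ?thesis
    unfolding BZ2_kernel_def BPk_eq
    using submodule_submodule_span[OF m BZ2_relation_carrier[OF assms]]
    by (intro module_quotient.intro module_quotient_axioms.intro)
qed

lemma zgen_carrier:
  assumes "hazewinkel_in_generators h"
  shows "zgen h k n \<in> carrier (BPk_BZ2 h k)"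
proof -
  interpret Q: module_quotient "Z2_poly_ring {1..k}" "BZ2_free k" "BZ2_kernel h k"
    by (rule BZ2_quotient[OF assms])
  interpret QM: module "Z2_poly_ring {1..k}" "BPk_BZ2 h k"
    using Q.module_quotient by (simp add: BPk_BZ2_def)
  show ?thesis
  proof (cases "n \<le> 0")
    case False
    then have "basis_elt (BPk k) (nat n) \<in> carrier (BZ2_free k)"
      unfolding BZ2_free_def BPk_eq by (intro basis_elt_carrier cring_Z2_poly_ring) auto
    then show ?thesis using Q.coset_carrier False by (simp add: zgen_def BPk_BZ2_def)
  qed (simp add: zgen_def)
qed

lemma zgen_relation:
  assumes "hazewinkel_in_generators h" "p \<ge> 1"
  shows "finsum (BPk_BZ2 h k) (\<lambda>l. BP_to_BPk k (two_coeff h l) \<odot>\<^bsub>BPk_BZ2 h k\<^esub> zgen h k (int p - int l)) {..<p} =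
    \<zero>\<^bsub>BPk_BZ2 h k\<^esub>"
proof -
  let ?N = "BZ2_kernel h k" and ?B = "BZ2_free k" and ?M = "BPk_BZ2 h k"
  interpret Q: module_quotient "Z2_poly_ring {1..k}" ?B ?N
    by (rule BZ2_quotient[OF assms(1)])
  interpret QM: module "Z2_poly_ring {1..k}" ?M
    using Q.module_quotient by (simp add: BPk_BZ2_def)
  let ?g = "\<lambda>l. BP_to_BPk k (two_coeff h l) \<odot>\<^bsub>?B\<^esub> basis_elt (BPk k) (p - l)"
  have a: "BP_to_BPk k (two_coeff h l) \<in> carrier (Z2_poly_ring {1..k})" for l
    using two_coeff_BPk(1)[OF assms(1)] by simp
  have b: "basis_elt (BPk k) (p - l) \<in> carrier ?B" if "l < p" for l
    unfolding BZ2_free_def BPk_eq using that by (intro basis_elt_carrier cring_Z2_poly_ring) auto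
  have z: "zgen h k (int p - int l) = ?N +>\<^bsub>?B\<^esub> basis_elt (BPk k) (p - l)" if "l < p" for l
    using that by (simp add: zgen_def nat_diff_distrib)
  have "BZ2_relation h k p \<in> ?N"
    using submodule_span_superset[OF Q.module_axioms BZ2_relation_carrier[OF assms(1)]] assms(2)
    unfolding BZ2_kernel_def BPk_eq by auto
  then have "\<zero>\<^bsub>?M\<^esub> = ?N +>\<^bsub>?B\<^esub> BZ2_relation h k p"
    using Q.coset_mem by (simp add: BPk_BZ2_def)
  also have "\<dots> = finsum ?M (\<lambda>l. ?N +>\<^bsub>?B\<^esub> ?g l) {..<p}"
    unfolding BZ2_relation_def BPk_BZ2_def
    by (rule Q.coset_finsum) (use a b in auto)
  also have "\<dots> = finsum ?M (\<lambda>l. BP_to_BPk k (two_coeff h l) \<odot>\<^bsub>?M\<^esub> zgen h k (int p - int l)) {..<p}"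
    by (intro QM.M.finsum_cong')
      (use a b z in \<open>auto simp: Q.coset_smult[folded BPk_BZ2_def] intro!: QM.smult_closed Q.coset_carrier[folded BPk_BZ2_def]\<close>)
  finally show ?thesis ..
qed

section \<open>Multiplication by $v_j$ modulo higher filtration\<close>

lemma filtration_eq:
  "filtration h k s = submodule_span (Z2_poly_ring {1..k}) (BZ2_tensor h k)
     {r \<odot>\<^bsub>BZ2_tensor h k\<^esub> x | r x. r \<in> ideal_power (Z2_poly_ring {1..k}) (v_ideal {1..k}) s \<and>
        x \<in> carrier (BZ2_tensor h k)}"
proof -
  have "{0..k} = insert 0 {1..k}" by auto
  then show ?thesis by (simp only: filtration_def BPk_eq v_ideal_def)
qed

theorem corollary1p6:
  fixes k j :: nat and h :: "nat \<Rightarrow> qv" and I :: "nat \<Rightarrow> int"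
  assumes "k \<ge> 1"
    and "hazewinkel_in_generators h"
    and "j \<le> k - 1"
    and "\<forall>i\<in>{1..k}. I i \<ge> 1"
  shows "(vgen j \<odot>\<^bsub>BZ2_tensor h k\<^esub> z_tensor h k I)
           \<ominus>\<^bsub>BZ2_tensor h k\<^esub>
         (vgen k \<odot>\<^bsub>BZ2_tensor h k\<^esub>
           (\<Oplus>\<^bsub>BZ2_tensor h k\<^esub>E \<in> exponent_tuples k j. z_tensor h k (\<lambda>i. I i - int (E i))))
         \<in> filtration h k 2"
proof -
  note h = assms(2)
  note One_nat_def [simp del]
  have jk: "j < k" using assms(1,3) by simp
  let ?M = "BPk_BZ2 h k" and ?T = "BZ2_tensor h k" and ?S = "{1..k}"
  interpret MQ: module_quotient "Z2_poly_ring ?S" "BZ2_free k" "BZ2_kernel h k"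
    by (rule BZ2_quotient[OF h])
  interpret TP: tensor_power_Z2 ?S ?M k
    unfolding BPk_BZ2_def by (intro tensor_power_Z2.intro MQ.module_quotient)
  have T_eq: "?T = TP.T.Q"
    unfolding BZ2_tensor_def BPk_eq by (rule TP.tensor_power_eq)
  interpret T: module "Z2_poly_ring ?S" ?T
    unfolding T_eq by (rule TP.T.module_quotient)
  define \<Phi> where "\<Phi> = (\<lambda>f. TP.K +>\<^bsub>TP.F\<^esub> f)"
  have \<Phi>_carrier: "\<Phi> f \<in> carrier ?T" if "f \<in> carrier TP.F" for f
    unfolding \<Phi>_def T_eq using that by (rule TP.T.coset_carrier)
  have \<Phi>_minus: "\<Phi> (f - g) = \<Phi> f \<ominus>\<^bsub>?T\<^esub> \<Phi> g" if "f \<in> carrier TP.F" "g \<in> carrier TP.F" for f g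
    using TP.T.coset_minus[OF that] TP.minus_F[OF that] by (simp add: \<Phi>_def T_eq)
  have \<Phi>_smult: "\<Phi> ((\<lambda>_. r) * f) = r \<odot>\<^bsub>?T\<^esub> \<Phi> f" if "r \<in> Z2polys ?S" "f \<in> carrier TP.F" for r f
    using TP.T.coset_smult[of r f] that by (simp add: \<Phi>_def T_eq TP.F_simps)
  have \<Phi>_sum: "\<Phi> (sum g A) = finsum ?T (\<lambda>a. \<Phi> (g a)) A"
    if "finite A" "\<And>a. a \<in> A \<Longrightarrow> g a \<in> carrier TP.F" for g and A :: "(nat \<Rightarrow> nat) set"
    using TP.T.coset_finsum[of A g] finsum_free_module[of A g ?S TP.tuples] that
    by (auto simp: \<Phi>_def T_eq tensor_free_def)
  define gens where "gens = {r \<odot>\<^bsub>?T\<^esub> x | r x. r \<in> v_square ?S \<and> x \<in> carrier ?T}"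
  have filt: "filtration h k 2 = submodule_span (Z2_poly_ring ?S) ?T gens"
    by (simp only: filtration_eq gens_def v_square_def)
  have sq_carrier: "v_square ?S \<subseteq> Z2polys ?S" by (rule Z2_ideal_subset[OF ideal_v_square])
  then have gens: "gens \<subseteq> carrier ?T"
    using T.smult_closed by (auto simp: gens_def)
  note sub = submodule_submodule_span[OF T.module_axioms gens, folded filt]
  note gens_filt = submodule_span_superset[OF T.module_axioms gens, folded filt]
  \<comment> \<open>The preimage of $F_2$ in the free module.\<close>
  define N where "N = {f \<in> carrier TP.F. \<Phi> f \<in> filtration h k 2}"
  have K_N: "f \<in> N" if "f \<in> TP.K" for f
  proof -
    have "\<Phi> f = \<zero>\<^bsub>?T\<^esub>" unfolding \<Phi>_def T_eq using that by (rule TP.T.coset_mem)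
    moreover have "\<zero>\<^bsub>?T\<^esub> \<in> filtration h k 2"
      using subgroup.one_closed[OF submodule.axioms(1)[OF sub]] by simp
    ultimately show ?thesis using TP.K_carrier[OF that] by (simp add: N_def)
  qed
  interpret N: additive_subset N
  proof
    show "0 \<in> N" by (rule K_N[OF TP.K_zero])
    fix f g assume fg: "f \<in> N" "g \<in> N"
    then have c: "f \<in> carrier TP.F" "g \<in> carrier TP.F" by (auto simp: N_def)
    have "f - g \<in> carrier TP.F"
      using TP.minus_F[OF c] TP.F.M.minus_closed[OF c] by simp
    moreover have "\<Phi> f \<ominus>\<^bsub>?T\<^esub> \<Phi> g \<in> filtration h k 2"
      unfolding a_minus_def using fg T.submoduleE(3,5)[OF sub] by (auto simp: N_def)
    ultimately show "f - g \<in> N" using \<Phi>_minus[OF c] by (simp add: N_def)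
  qed
  have square_N: "(\<lambda>_. r) * f \<in> N" if "r \<in> v_square ?S" "f \<in> carrier TP.F" for r f
  proof -
    have "r \<in> Z2polys ?S" using that sq_carrier by blast
    moreover have "r \<odot>\<^bsub>?T\<^esub> \<Phi> f \<in> filtration h k 2"
      using gens_filt that \<Phi>_carrier by (auto simp: gens_def)
    ultimately show ?thesis
      using \<Phi>_smult TP.smult_carrier that by (simp add: N_def)
  qed
  define \<tau> where "\<tau> = (\<lambda>I. restrict (\<lambda>i. zgen h k (I i)) ?S)"
  have \<tau>_tuples: "\<tau> I \<in> TP.tuples" for I
    using zgen_carrier[OF h] by (auto simp: \<tau>_def)
  note e_carrier = TP.e_carrier[OF \<tau>_tuples]
  have z: "z_tensor h k I = \<Phi> (TP.e (\<tau> I))" for I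
    by (simp add: z_tensor_def pure_tensor_def \<Phi>_def \<tau>_def BPk_eq)
  have v: "vgen i \<in> Z2polys ?S" "vgen i \<in> v_ideal ?S" if "i \<le> k" for i
  proof -
    have "i \<in> insert 0 ?S" using that by auto
    then show "vgen i \<in> Z2polys ?S" "vgen i \<in> v_ideal ?S"
      by (rule Z2polys_vgen, rule vgen_in_v_ideal)
  qed
  define \<psi> where "\<psi> = (\<lambda>i I. (\<lambda>_. vgen i) * TP.e (\<tau> I))"
  have van: "\<psi> i I \<in> N" if "i \<le> k" "m \<in> ?S" "I m \<le> 0" for i I m
  proof -
    have "TP.e (\<tau> I) \<in> TP.K"
      using that by (intro TP.K_tensor_zero[OF \<tau>_tuples that(2)]) (simp add: \<tau>_def zgen_def)
    then show ?thesis unfolding \<psi>_def using v[OF that(1)] by (intro K_N TP.K_smult)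
  qed
  have "\<psi> j I - (\<Sum>E\<in>exponent_tuples k j. \<psi> k (\<lambda>i. I i - int (E i))) \<in> N"
  proof (rule N.dickson_relations)
    fix i and I I' :: "nat \<Rightarrow> int" assume "\<And>n. n \<in> {1..k} \<Longrightarrow> I n = I' n"
    then have "\<tau> I = \<tau> I'" unfolding \<tau>_def by (intro restrict_ext) simp
    then show "\<psi> i I = \<psi> i I'" by (simp add: \<psi>_def)
  next
    fix i and I :: "nat \<Rightarrow> int" assume "i \<le> k"
    then have "vgen 0 * vgen i \<in> v_square ?S" by (intro v_square_prod v) simp_all
    from square_N[OF this e_carrier] have "(\<lambda>_. vgen 0 * vgen i) * TP.e (\<tau> I) \<in> N" .
    also have "(\<lambda>_. vgen 0 * vgen i) * TP.e (\<tau> I) = \<psi> i I + \<psi> i I"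
    proof -
      have "vgen 0 = 2" by (simp add: vgen_def)
      then show ?thesis by (simp add: \<psi>_def fun_eq_iff mult.assoc)
    qed
    finally show "\<psi> i I + \<psi> i I \<in> N" .
  next
    fix m and I :: "nat \<Rightarrow> int" assume m: "m \<in> {1..k}"
    show "(\<Sum>i\<le>k. \<psi> i (I(m := I m - 2 ^ i))) \<in> N"
    proof (cases "I m \<le> 1")
      case True
      show ?thesis
      proof (rule N.sum_mem)
        fix i assume i: "i \<in> {..k}"
        have "(1::int) \<le> 2 ^ i" by simp
        then have "I m - 2 ^ i \<le> 0" using True by linarith
        then show "\<psi> i (I(m := I m - 2 ^ i)) \<in> N" using i m by (intro van[of i m]) auto
      qed
    next
      case False
      \<comment> \<open>Relation number \<open>p = I m - 1\<close> involves \<open>p - l = I m - 2 ^ i\<close> for the coefficient $a_l$ with \<open>l = 2 ^ i - 1\<close>.\<close>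
      define p where "p = nat (I m - 1)"
      have p: "p \<ge> 1" "int p = I m - 1" using False by (auto simp: p_def)
      \<comment> \<open>\<open>w l\<close> is the residue of the coefficient \<open>a l\<close> modulo the square of the ideal.\<close>
      define a where "a = (\<lambda>l. BP_to_BPk k (two_coeff h l))"
      define w where "w = (\<lambda>l. \<Sum>i\<in>{i. i \<le> k \<and> Suc l = 2 ^ i}. vgen i)"
      define E where "E = (\<lambda>n. TP.e ((\<tau> I)(m := zgen h k n)))"
      have a: "a l \<in> Z2polys ?S" "a l - w l \<in> v_square ?S" for l
        unfolding a_def w_def by (rule two_coeff_BPk[OF h])+
      have E_carrier: "E n \<in> carrier TP.F" for n
        unfolding E_def by (intro TP.e_carrier TP.upd_tuples \<tau>_tuples m zgen_carrier[OF h])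
      have \<psi>E: "\<psi> i (I(m := n)) = (\<lambda>_. vgen i) * E n" for i n
      proof -
        have "\<tau> (I(m := n)) = (\<tau> I)(m := zgen h k n)" using m by (auto simp: \<tau>_def fun_eq_iff)
        then show ?thesis by (simp add: \<psi>_def E_def)
      qed
      have "(\<Sum>l<p. TP.e ((\<tau> I)(m := a l \<odot>\<^bsub>?M\<^esub> zgen h k (int p - int l)))) \<in> N"
      proof -
        let ?g = "\<lambda>l. a l \<odot>\<^bsub>?M\<^esub> zgen h k (int p - int l)"
        have "TP.e ((\<tau> I)(m := finsum ?M ?g {..<p})) \<in> TP.K"
          unfolding a_def zgen_relation[OF h p(1)]
          using TP.K_tensor_zero[OF TP.upd_tuples[OF \<tau>_tuples m TP.M.M.zero_closed] m] by simp
        moreover have "TP.e ((\<tau> I)(m := finsum ?M ?g {..<p})) - (\<Sum>l<p. TP.e ((\<tau> I)(m := ?g l))) \<in> TP.K"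
          using a zgen_carrier[OF h] by (intro TP.K_tensor_finsum \<tau>_tuples m) auto
        ultimately show ?thesis
          using N.diff_mem[OF K_N K_N] by fastforce
      qed
      moreover have "(\<Sum>l<p. TP.e ((\<tau> I)(m := a l \<odot>\<^bsub>?M\<^esub> zgen h k (int p - int l))) -
          (\<lambda>_. a l) * E (int p - int l)) \<in> N"
        unfolding E_def
        by (intro N.sum_mem K_N TP.K_tensor_smult \<tau>_tuples m zgen_carrier[OF h] a)
      moreover have "(\<Sum>l<p. (\<lambda>_. a l - w l) * E (int p - int l)) \<in> N"
        by (intro N.sum_mem square_N a E_carrier)
      ultimately have "(\<Sum>l<p. TP.e ((\<tau> I)(m := a l \<odot>\<^bsub>?M\<^esub> zgen h k (int p - int l)))) -
          (\<Sum>l<p. TP.e ((\<tau> I)(m := a l \<odot>\<^bsub>?M\<^esub> zgen h k (int p - int l))) -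
            (\<lambda>_. a l) * E (int p - int l)) -
          (\<Sum>l<p. (\<lambda>_. a l - w l) * E (int p - int l)) \<in> N"
        by (intro N.diff_mem)
      also have "(\<Sum>l<p. TP.e ((\<tau> I)(m := a l \<odot>\<^bsub>?M\<^esub> zgen h k (int p - int l)))) -
          (\<Sum>l<p. TP.e ((\<tau> I)(m := a l \<odot>\<^bsub>?M\<^esub> zgen h k (int p - int l))) -
            (\<lambda>_. a l) * E (int p - int l)) -
          (\<Sum>l<p. (\<lambda>_. a l - w l) * E (int p - int l)) = (\<Sum>l<p. (\<lambda>_. w l) * E (int p - int l))"
        unfolding sum_subtractf[symmetric]
        by (intro sum.cong refl) (auto simp: fun_eq_iff algebra_simps)
      also have "(\<Sum>l<p. (\<lambda>_. w l) * E (int p - int l)) =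
          (\<Sum>l<p. \<Sum>i\<in>{i \<in> {..k}. Suc l = 2 ^ i}. (\<lambda>_. vgen i) * E (int p - int l))"
      proof (intro sum.cong refl)
        fix l
        have "(\<lambda>_ :: nat \<Rightarrow> (nat \<Rightarrow> qv) set. \<Sum>i\<in>A. f i) = (\<Sum>i\<in>A. (\<lambda>_. f i))" for A :: "nat set" and f :: "nat \<Rightarrow> qv"
          by (induction A rule: infinite_finite_induct) (auto simp: fun_eq_iff)
        then show "(\<lambda>_. w l) * E (int p - int l) =
            (\<Sum>i\<in>{i \<in> {..k}. Suc l = 2 ^ i}. (\<lambda>_. vgen i) * E (int p - int l))"
          by (simp add: w_def sum_distrib_right)
      qed
      also have "(\<Sum>l<p. \<Sum>i\<in>{i \<in> {..k}. Suc l = 2 ^ i}. (\<lambda>_. vgen i) * E (int p - int l)) =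
          (\<Sum>i\<in>{i \<in> {..k}. 2 ^ i \<le> p}. \<psi> i (I(m := I m - 2 ^ i)))"
        unfolding \<psi>E
      proof (subst sum.Sigma, simp, simp, rule sum.reindex_bij_witness[where i = "\<lambda>i. (2 ^ i - 1, i)" and j = snd])
        fix q assume "q \<in> (SIGMA l:{..<p}. {i \<in> {..k}. Suc l = 2 ^ i})"
        then obtain l i where q: "q = (l, i)" "l < p" "i \<le> k" "Suc l = 2 ^ i" by auto
        have "int (Suc l) = 2 ^ i" unfolding q(4) by simp
        then have "I m - 2 ^ snd q = int p - int (fst q)" using p(2) q(1) by simp
        then show "(\<lambda>_. vgen (snd q)) * E (I m - 2 ^ snd q) =
            (case q of (l, i) \<Rightarrow> (\<lambda>_. vgen i) * E (int p - int l))"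
          by (simp add: split_beta)
        show "(2 ^ snd q - 1, snd q) = q" "snd q \<in> {i \<in> {..k}. 2 ^ i \<le> p}"
          using q by (auto simp: q(4)[symmetric])
      next
        fix i assume i: "i \<in> {i \<in> {..k}. 2 ^ i \<le> p}"
        have pos: "(0::nat) < 2 ^ i" by simp
        moreover have "2 ^ i \<le> p" using i by simp
        ultimately have "Suc (2 ^ i - 1) = (2::nat) ^ i" "2 ^ i - 1 < p" by linarith+
        then show "(2 ^ i - 1, i) \<in> (SIGMA l:{..<p}. {i \<in> {..k}. Suc l = 2 ^ i})"
          using i by auto
      qed simp
      finally have A: "(\<Sum>i\<in>{i \<in> {..k}. 2 ^ i \<le> p}. \<psi> i (I(m := I m - 2 ^ i))) \<in> N" .
      \<comment> \<open>The remaining terms have a nonpositive index.\<close>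
      have B: "(\<Sum>i\<in>{i \<in> {..k}. \<not> 2 ^ i \<le> p}. \<psi> i (I(m := I m - 2 ^ i))) \<in> N"
      proof (rule N.sum_mem)
        fix i assume i: "i \<in> {i \<in> {..k}. \<not> 2 ^ i \<le> p}"
        then have "int (Suc p) \<le> int (2 ^ i)" by (simp only: mem_Collect_eq zle_int not_le Suc_le_eq)
        then have "I m - 2 ^ i \<le> 0" using p(2) by simp
        then show "\<psi> i (I(m := I m - 2 ^ i)) \<in> N" using i m by (intro van[of i m]) auto
      qed
      have "{..k} = {i \<in> {..k}. 2 ^ i \<le> p} \<union> {i \<in> {..k}. \<not> 2 ^ i \<le> p}" by blast
      then have "(\<Sum>i\<le>k. \<psi> i (I(m := I m - 2 ^ i))) =
          (\<Sum>i\<in>{i \<in> {..k}. 2 ^ i \<le> p}. \<psi> i (I(m := I m - 2 ^ i))) +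
          (\<Sum>i\<in>{i \<in> {..k}. \<not> 2 ^ i \<le> p}. \<psi> i (I(m := I m - 2 ^ i)))"
        by (metis (no_types, lifting) sum.union_disjoint[of "{i \<in> {..k}. 2 ^ i \<le> p}" "{i \<in> {..k}. \<not> 2 ^ i \<le> p}"]
            disjoint_iff finite_atMost finite_Un mem_Collect_eq)
      then show ?thesis using A B N.add_mem by simp
    qed
  qed (use van jk in auto)
  moreover have "(\<Sum>E\<in>exponent_tuples k j. \<psi> k (\<lambda>i. I i - int (E i))) =
      (\<lambda>_. vgen k) * (\<Sum>E\<in>exponent_tuples k j. TP.e (\<tau> (\<lambda>i. I i - int (E i))))"
    by (simp add: \<psi>_def sum_distrib_left)
  ultimately have "\<Phi> ((\<lambda>_. vgen j) * TP.e (\<tau> I) -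
      (\<lambda>_. vgen k) * (\<Sum>E\<in>exponent_tuples k j. TP.e (\<tau> (\<lambda>i. I i - int (E i))))) \<in> filtration h k 2"
    by (simp add: N_def \<psi>_def)
  moreover have S: "(\<Sum>E\<in>exponent_tuples k j. TP.e (\<tau> (\<lambda>i. I i - int (E i)))) \<in> carrier TP.F"
  proof -
    have "finsum TP.F (\<lambda>E. TP.e (\<tau> (\<lambda>i. I i - int (E i)))) (exponent_tuples k j) \<in> carrier TP.F"
      using e_carrier by (intro TP.F.M.finsum_closed) auto
    then show ?thesis
      using finsum_free_module[of "exponent_tuples k j" _ ?S TP.tuples, folded tensor_free_def]
        e_carrier finite_exponent_tuples by simp
  qed
  ultimately show ?thesis
    using jk v[of j] v[of k] e_carrier finite_exponent_tuples
    by (simp add: z \<Phi>_minus \<Phi>_smult \<Phi>_sum TP.smult_carrier)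
qed

end
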